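(* Every nondiagonalizable 3-component system of conservation laws $u^i_t=\frac{d}{dx}f^i(u)$, $i=1,2,3$, of Temple class is dual to a system obtained from a maximal rank 3-web of curves in space.
   Context: All considerations are local and smooth, over $\mathbb R$; geometric objects in projective space are considered up to projective equivalence. Systems. The system $u^i_t=\frac{d}{dx}f^i(u)$, $i=1,2,3$, is assumed strictly hyperbolic: $\nabla f=(\partial f^i/\partial u^j)$ has three distinct real eigenvalues $\lambda^\alpha$ (characteristic speeds) with eigenvector fields $\xi_\alpha$ and left eigenforms (characteristic forms) $\omega^\alpha$, normalized by $\omega^\alpha(\xi_\beta)=\delta^\alpha_\beta$. The system is equivalent to the exterior equations $\omega^\alpha\wedge(dx+\lambda^\alpha dt)=0$ (no summation). The integral curves of $\xi_\alpha$ are the rarefaction curves. The system is of Temple class if all rarefaction curves are straight lines in $u$-space. It is nondiagonalizable if $d\omega^\alpha\wedge\omega^\alpha\ne0$ (no summation) for $\alpha=1,2,3$. A nondiagonalizable 3-component system of Temple class admits 5 conservation laws, i.e. one-forms closed on solutions: $u^i\,dx+f^i\,dt$ ($i=1,2,3$) and two additional ones $B(u)\,dx+A(u)\,dt$, $N(u)\,dx+M(u)\,dt$, which together with $dx$ and $dt$ are linearly independent over $\mathbb R$. Ruled hypersurface and duality. The ruled hypersurface $\Sigma\subset\mathbb P^6$ of a 3-component system with 5 conservation laws (independent modulo $dx,dt$) is the union of the lines, parametrized by the field variables, $Y^j=b^jY^0+a^jY^6$, $j=1,\dots,5$, where $b^j\,dx+a^j\,dt$ is a basis of the conservation laws (e.g.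 $(b^j)=(u^1,u^2,u^3,B,N)$, $(a^j)=(f^1,f^2,f^3,A,M)$). It is 4-dimensional. The dual hypersurface $\Sigma^*\subset(\mathbb P^6)^*$ is the set of hyperplanes tangent to $\Sigma$. Two such systems are dual if their ruled hypersurfaces are dual. Webs. A 3-web of curves in space consists of three foliations $\mathfrak F_1,\mathfrak F_2,\mathfrak F_3$ of a 3-dimensional domain by integral curves of vector fields $\xi_1,\xi_2,\xi_3$ (linearly independent at each point); the 2-dimensional distributions spanned by pairs of these fields are assumed non-integrable. An Abelian relation is a triple of functions $(I_1,I_2,I_3)$, $\xi_k(I_k)=0$ for $k=1,2,3$, with $dI_1+dI_2+dI_3\equiv0$; the constants are normalized so that $I_1+I_2+I_3\equiv0$. The Abelian relations (with functions taken modulo constants) form a vector space, whose dimension is the rank of the web; the rank is at most 5, and the web is of maximal rank if its rank is 5. System obtained from a maximal rank 3-web. It is the system of hydrodynamic type $\omega^\alpha\wedge(dx+\lambda^\alpha dt)=0$, $\alpha=1,2,3$, where $\omega^\alpha$ is the coframe dual to $\xi_1,\xi_2,\xi_3$, with constant characteristic speeds $\lambda^1=\infty$, $\lambda^2=0$, $\lambda^3=-1$, i.e. $\omega^1\wedge dt=0$, $\omega^2\wedge dx=0$, $\omega^3\wedge(dx-dt)=0$ (a rotation of the axes in the $xt$-plane makes all speeds finite). Its conservation laws are the forms $I_1\,dx+I_2\,dt$, where $(I_1,I_2,I_3)$ are the Abelian relations of the web; they form a 5-dimensional space modulo $dx,dt$. *)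

theory Defs
  imports "HOL-Analysis.Analysis"
begin

section \<open>Smooth maps, exterior derivative, Lie bracket\<close>

text \<open>\<open>S\<close> is always an open set; smoothness is \<open>C\<^sup>\<infinity>\<close>, formulated through iterated directional derivatives.\<close>

fun Ck_on :: "nat \<Rightarrow> 'a::euclidean_space set \<Rightarrow> ('a \<Rightarrow> 'b::real_normed_vector) \<Rightarrow> bool" where
  "Ck_on 0 S f \<longleftrightarrow> continuous_on S f"
| "Ck_on (Suc k) S f \<longleftrightarrow>
     (\<forall>x\<in>S. f differentiable (at x)) \<and> (\<forall>v. Ck_on k S (\<lambda>x. frechet_derivative f (at x) v))"

definition smooth_on :: "'a::euclidean_space set \<Rightarrow> ('a \<Rightarrow> 'b::real_normed_vector) \<Rightarrow> bool" where
  "smooth_on S f \<longleftrightarrow> (\<forall>k. Ck_on k S f)"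

text \<open>A one-form \<open>om\<close> on an open subset of \<open>\<real>\<^sup>3\<close> is represented by its covector field:
  its value on \<open>v\<close> at \<open>u\<close> is \<open>om u \<bullet> v\<close>.\<close>

definition ext_deriv ::
  "(real^3 \<Rightarrow> real^3) \<Rightarrow> real^3 \<Rightarrow> real^3 \<Rightarrow> real^3 \<Rightarrow> real" where
  "ext_deriv om u v w =
     frechet_derivative om (at u) v \<bullet> w - frechet_derivative om (at u) w \<bullet> v"

definition ext_deriv_wedge ::
  "(real^3 \<Rightarrow> real^3) \<Rightarrow> real^3 \<Rightarrow> real^3 \<Rightarrow> real^3 \<Rightarrow> real^3 \<Rightarrow> real" where
  "ext_deriv_wedge om u v1 v2 v3 =
     ext_deriv om u v1 v2 * (om u \<bullet> v3) + ext_deriv om u v2 v3 * (om u \<bullet> v1)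
     + ext_deriv om u v3 v1 * (om u \<bullet> v2)"

definition lie_bracket ::
  "(real^3 \<Rightarrow> real^3) \<Rightarrow> (real^3 \<Rightarrow> real^3) \<Rightarrow> real^3 \<Rightarrow> real^3" where
  "lie_bracket X Y u = frechet_derivative Y (at u) (X u) - frechet_derivative X (at u) (Y u)"

section \<open>Systems of conservation laws of Temple class\<close>

text \<open>For the system \<open>u\<^sub>t = (f(u))\<^sub>x\<close> on \<open>U\<close>, with characteristic speeds \<open>lam\<close>, eigenvector fields \<open>xi\<close>
  and characteristic forms \<open>om\<close>.\<close>

definition strictly_hyperbolic ::
  "(real^3) set \<Rightarrow> (real^3 \<Rightarrow> real^3) \<Rightarrow> (3 \<Rightarrow> real^3 \<Rightarrow> real) \<Rightarrow>
   (3 \<Rightarrow> real^3 \<Rightarrow> real^3) \<Rightarrow> (3 \<Rightarrow> real^3 \<Rightarrow> real^3) \<Rightarrow> bool" where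
  "strictly_hyperbolic U f lam xi om \<longleftrightarrow>
     open U \<and> smooth_on U f \<and>
     (\<forall>\<alpha>. smooth_on U (lam \<alpha>) \<and> smooth_on U (xi \<alpha>) \<and> smooth_on U (om \<alpha>)) \<and>
     (\<forall>u\<in>U.
        inj (\<lambda>\<alpha>. lam \<alpha> u) \<and>
        (\<forall>\<alpha>. frechet_derivative f (at u) (xi \<alpha> u) = lam \<alpha> u *\<^sub>R xi \<alpha> u) \<and>
        (\<forall>\<alpha> v. om \<alpha> u \<bullet> frechet_derivative f (at u) v = lam \<alpha> u * (om \<alpha> u \<bullet> v)) \<and>
        (\<forall>\<alpha> \<beta>. om \<alpha> u \<bullet> xi \<beta> u = (if \<alpha> = \<beta> then 1 else 0)))"

definition integral_curve ::
  "(real^3) set \<Rightarrow> (real^3 \<Rightarrow> real^3) \<Rightarrow> real set \<Rightarrow> (real \<Rightarrow> real^3) \<Rightarrow> bool" where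
  "integral_curve U X J c \<longleftrightarrow>
     open J \<and> is_interval J \<and>
     (\<forall>t\<in>J. c t \<in> U \<and> (c has_vector_derivative X (c t)) (at t))"

text \<open>The considerations being local, a rarefaction curve is straight if it is contained in a line.\<close>

definition temple_class :: "(real^3) set \<Rightarrow> (3 \<Rightarrow> real^3 \<Rightarrow> real^3) \<Rightarrow> bool" where
  "temple_class U xi \<longleftrightarrow> (\<forall>\<alpha> J c. integral_curve U (xi \<alpha>) J c \<longrightarrow> collinear (c ` J))"

definition nondiagonalizable :: "(real^3) set \<Rightarrow> (3 \<Rightarrow> real^3 \<Rightarrow> real^3) \<Rightarrow> bool" where
  "nondiagonalizable U om \<longleftrightarrow>
     (\<forall>\<alpha>. \<forall>u\<in>U. \<exists>v1 v2 v3. ext_deriv_wedge (om \<alpha>) u v1 v2 v3 \<noteq> 0)"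

section \<open>Exterior systems and their conservation laws\<close>

text \<open>The system \<open>\<omega>\<^sup>\<alpha> \<and> (p\<^sup>\<alpha> dx + q\<^sup>\<alpha> dt) = 0\<close>, where \<open>\<omega>\<close> is the coframe dual to \<open>frame\<close> and
  \<open>speed \<alpha> = (p\<^sup>\<alpha>, q\<^sup>\<alpha>)\<close>. The characteristic speed is \<open>\<lambda>\<^sup>\<alpha> = q\<^sup>\<alpha> / p\<^sup>\<alpha>\<close>, with
  \<open>p\<^sup>\<alpha> = 0\<close> encoding \<open>\<lambda>\<^sup>\<alpha> = \<infinity>\<close>.\<close>

record hydro_system =
  field_dom :: "(real^3) set"
  frame :: "3 \<Rightarrow> real^3 \<Rightarrow> real^3"
  speed :: "3 \<Rightarrow> real^3 \<Rightarrow> real \<times> real"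

definition conservation_system ::
  "(real^3) set \<Rightarrow> (3 \<Rightarrow> real^3 \<Rightarrow> real) \<Rightarrow> (3 \<Rightarrow> real^3 \<Rightarrow> real^3) \<Rightarrow> hydro_system" where
  "conservation_system U lam xi =
     \<lparr>field_dom = U, frame = xi, speed = (\<lambda>\<alpha> u. (1, lam \<alpha> u))\<rparr>"

text \<open>\<open>b dx + a dt\<close> is closed on solutions: since
  \<open>d(b dx + a dt) = \<Sum>\<^sub>\<alpha> \<omega>\<^sup>\<alpha> \<and> (\<xi>\<^sub>\<alpha>(b) dx + \<xi>\<^sub>\<alpha>(a) dt)\<close>, it is a combination of the 2-forms
  \<open>\<omega>\<^sup>\<alpha> \<and> (p\<^sup>\<alpha> dx + q\<^sup>\<alpha> dt)\<close> iff each pair \<open>(\<xi>\<^sub>\<alpha>(b), \<xi>\<^sub>\<alpha>(a))\<close> is a multiple of \<open>(p\<^sup>\<alpha>, q\<^sup>\<alpha>)\<close>.\<close>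

definition conservation_law ::
  "hydro_system \<Rightarrow> (real^3 \<Rightarrow> real) \<Rightarrow> (real^3 \<Rightarrow> real) \<Rightarrow> bool" where
  "conservation_law S b a \<longleftrightarrow>
     smooth_on (field_dom S) b \<and> smooth_on (field_dom S) a \<and>
     (\<forall>u \<in> field_dom S. \<forall>\<alpha>. \<exists>m.
        (frechet_derivative b (at u) (frame S \<alpha> u),
         frechet_derivative a (at u) (frame S \<alpha> u)) = m *\<^sub>R speed S \<alpha> u)"

text \<open>\<open>b\<^sup>j dx + a\<^sup>j dt\<close>, \<open>j = 1, \<dots>, 5\<close>, form a basis of the conservation laws modulo \<open>dx\<close>, \<open>dt\<close>.\<close>

definition conservation_basis ::
  "hydro_system \<Rightarrow> (real^3 \<Rightarrow> real^5) \<Rightarrow> (real^3 \<Rightarrow> real^5) \<Rightarrow> bool" where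
  "conservation_basis S b a \<longleftrightarrow>
     (\<forall>j. conservation_law S (\<lambda>u. b u $ j) (\<lambda>u. a u $ j)) \<and>
     (\<forall>c k l. (\<forall>u \<in> field_dom S. (\<Sum>j\<in>UNIV. c j * b u $ j) = k \<and> (\<Sum>j\<in>UNIV. c j * a u $ j) = l)
        \<longrightarrow> (\<forall>j. c j = 0)) \<and>
     (\<forall>b0 a0. conservation_law S b0 a0 \<longrightarrow>
        (\<exists>c k l. \<forall>u \<in> field_dom S.
           b0 u = (\<Sum>j\<in>UNIV. c j * b u $ j) + k \<and> a0 u = (\<Sum>j\<in>UNIV. c j * a u $ j) + l))"

section \<open>Ruled hypersurfaces and duality\<close>

text \<open>\<open>\<real>\<^sup>7\<close> with coordinates \<open>(Y\<^sup>0, (Y\<^sup>1, \<dots>, Y\<^sup>5), Y\<^sup>6)\<close>. Subsets of \<open>\<P>\<^sup>6\<close> are represented by the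
  sets of all their homogeneous coordinate vectors, i.e. by sets of nonzero vectors invariant
  under nonzero scaling. The hyperplane \<open>{Y. n \<bullet> Y = 0}\<close> is represented by \<open>n\<close>, which
  identifies the dual projective space with \<open>\<P>\<^sup>6\<close>.\<close>

type_synonym R7 = "real \<times> (real^5) \<times> real"

definition ruled_point ::
  "(real^3 \<Rightarrow> real^5) \<Rightarrow> (real^3 \<Rightarrow> real^5) \<Rightarrow> (real^3) \<times> real \<times> real \<Rightarrow> R7" where
  "ruled_point b a = (\<lambda>(u, s, r). (s, s *\<^sub>R b u + r *\<^sub>R a u, r))"

definition ruled_hypersurface ::
  "(real^3) set \<Rightarrow> (real^3 \<Rightarrow> real^5) \<Rightarrow> (real^3 \<Rightarrow> real^5) \<Rightarrow> R7 set" where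
  "ruled_hypersurface U b a = {ruled_point b a (u, s, r) | u s r. u \<in> U \<and> (s, r) \<noteq> (0, 0)}"

text \<open>Hyperplanes containing the (projective) tangent space at some point where the
  parametrization is an immersion. At such a point the image of the derivative is the
  5-dimensional linear space over the 4-dimensional tangent space; it contains the point
  itself, the parametrization being homogeneous in \<open>(s, r)\<close>.\<close>

definition dual_hypersurface ::
  "(real^3) set \<Rightarrow> (real^3 \<Rightarrow> real^5) \<Rightarrow> (real^3 \<Rightarrow> real^5) \<Rightarrow> R7 set" where
  "dual_hypersurface U b a =
     {n. n \<noteq> 0 \<and> (\<exists>u s r. u \<in> U \<and> (s, r) \<noteq> (0, 0) \<and>
           inj (frechet_derivative (ruled_point b a) (at (u, s, r))) \<and>
           (\<forall>w. n \<bullet> frechet_derivative (ruled_point b a) (at (u, s, r)) w = 0))}"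

definition projectively_equivalent :: "R7 set \<Rightarrow> R7 set \<Rightarrow> bool" where
  "projectively_equivalent P Q \<longleftrightarrow> (\<exists>A. linear A \<and> bij A \<and> A ` P = Q)"

text \<open>A change of the basis of conservation laws changes the ruled hypersurface by a projective
  transformation, so the choice of bases is immaterial.\<close>

definition dual_systems :: "hydro_system \<Rightarrow> hydro_system \<Rightarrow> bool" where
  "dual_systems S T \<longleftrightarrow>
     (\<exists>b a b' a'. conservation_basis S b a \<and> conservation_basis T b' a' \<and>
        projectively_equivalent (dual_hypersurface (field_dom S) b a)
                                (ruled_hypersurface (field_dom T) b' a'))"

section \<open>3-webs of curves\<close>

text \<open>The distributions spanned by pairs of fields are non-integrable at every point, in the
  sense of Frobenius.\<close>

definition web3 :: "(real^3) set \<Rightarrow> (3 \<Rightarrow> real^3 \<Rightarrow> real^3) \<Rightarrow> bool" where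
  "web3 V X \<longleftrightarrow>
     open V \<and> connected V \<and> V \<noteq> {} \<and> (\<forall>k. smooth_on V (X k)) \<and>
     (\<forall>u\<in>V. inj (\<lambda>k. X k u) \<and> independent (range (\<lambda>k. X k u))) \<and>
     (\<forall>u\<in>V. \<forall>i j. i \<noteq> j \<longrightarrow> lie_bracket (X i) (X j) u \<notin> span {X i u, X j u})"

definition abelian_relation ::
  "(real^3) set \<Rightarrow> (3 \<Rightarrow> real^3 \<Rightarrow> real^3) \<Rightarrow> (3 \<Rightarrow> real^3 \<Rightarrow> real) \<Rightarrow> bool" where
  "abelian_relation V X I \<longleftrightarrow>
     (\<forall>k. smooth_on V (I k)) \<and>
     (\<forall>u\<in>V. (\<forall>k. frechet_derivative (I k) (at u) (X k u) = 0) \<and> (\<Sum>k\<in>UNIV. I k u) = 0)"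

text \<open>\<open>n\<close> is the dimension of the space of Abelian relations, with functions taken modulo constants.\<close>

definition web_rank :: "(real^3) set \<Rightarrow> (3 \<Rightarrow> real^3 \<Rightarrow> real^3) \<Rightarrow> nat \<Rightarrow> bool" where
  "web_rank V X n \<longleftrightarrow>
     (\<exists>E :: nat \<Rightarrow> 3 \<Rightarrow> real^3 \<Rightarrow> real.
        (\<forall>j<n. abelian_relation V X (E j)) \<and>
        (\<forall>c. (\<forall>k. \<exists>d. \<forall>u\<in>V. (\<Sum>j<n. c j * E j k u) = d) \<longrightarrow> (\<forall>j<n. c j = 0)) \<and>
        (\<forall>I. abelian_relation V X I \<longrightarrow>
           (\<exists>c. \<forall>k. \<exists>d. \<forall>u\<in>V. I k u = (\<Sum>j<n. c j * E j k u) + d)))"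

definition maximal_rank_web :: "(real^3) set \<Rightarrow> (3 \<Rightarrow> real^3 \<Rightarrow> real^3) \<Rightarrow> bool" where
  "maximal_rank_web V X \<longleftrightarrow> web3 V X \<and> web_rank V X 5"

text \<open>\<open>\<omega>\<^sup>1 \<and> dt = 0\<close>, \<open>\<omega>\<^sup>2 \<and> dx = 0\<close>, \<open>\<omega>\<^sup>3 \<and> (dx - dt) = 0\<close>. The conservation laws of this system are
  exactly \<open>I\<^sub>1 dx + I\<^sub>2 dt\<close> with \<open>(I\<^sub>1, I\<^sub>2, I\<^sub>3)\<close> an Abelian relation.\<close>

definition web_system :: "(real^3) set \<Rightarrow> (3 \<Rightarrow> real^3 \<Rightarrow> real^3) \<Rightarrow> hydro_system" where
  "web_system V X =
     \<lparr>field_dom = V, frame = X,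
      speed = (\<lambda>k u. if k = 1 then (0, 1) else if k = 2 then (1, 0) else (1, -1))\<rparr>"

end

theory Submission
  imports Defs
begin

text \<open>Write \<open>\<lambda>\<close>, \<open>\<xi>\<close>, \<open>\<omega>\<close> for the speeds, the frame and the coframe. Straightness and the existence of the
  flux \<open>f\<close> force \<open>(D\<^bsub>\<xi>\<alpha>\<^esub> \<omega>\<^sup>\<gamma>)(\<xi>\<^sub>\<beta>) = -(\<lambda>\<^sup>\<alpha> - \<lambda>\<^sup>\<gamma>) \<kappa>\<^sub>\<gamma>\<close> for distinct indices, with \<open>\<kappa>\<^sub>\<gamma> \<noteq> 0\<close> by
  nondiagonalizability. The tensors \<open>E\<^sub>\<alpha> = \<omega>\<^sup>\<alpha> \<otimes> \<omega>\<^sup>\<alpha> / \<kappa>\<^sub>\<alpha>\<close>, as covector-valued one-forms, satisfy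
  \<open>d E\<^sub>\<alpha> = -\<phi>\<^sub>\<alpha> \<and> E\<^sub>\<alpha> + R\<close> with the same \<open>R\<close> for all \<open>\<alpha>\<close>. Since \<open>d\<^sup>2 = 0\<close>, the forms \<open>\<phi>\<^sub>\<alpha>\<close> come from a
  single form \<open>\<phi>\<close>, and a second application gives \<open>d\<phi> = 0\<close>. With \<open>d\<psi> = \<psi> \<phi>\<close>, the differences
  \<open>\<psi> (E\<^sub>2 - E\<^sub>3)\<close> and \<open>\<psi> (E\<^sub>3 - E\<^sub>1)\<close> are closed, hence Hessians of functions \<open>B\<close> and \<open>N\<close>; being diagonal in the
  frame, these are the two additional conserved densities.

  The hypersurface ruled by the lines of the system is tangent to a fixed 4-plane along each line, so its dual
  is ruled by the pencils of hyperplanes through these 4-planes. The pencils are spanned by the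
  Legendre-type transforms of \<open>B\<close> and \<open>N\<close>, and the vanishing of the \<open>11\<close>-, \<open>22\<close>- and \<open>33\<close>-entries of the
  Hessians of \<open>B\<close>, \<open>N\<close> and \<open>B + N\<close> says that the transforms form conservation laws of the web system of the
  rarefaction curves themselves. Completeness holds because a conservation law \<open>(I\<^sub>1, I\<^sub>2)\<close> of the web system
  has the form \<open>dI\<^sub>1 = Hess B \<cdot> W\<close>, \<open>dI\<^sub>2 = Hess N \<cdot> W\<close> for a map \<open>W\<close> whose derivative is diagonal in the frame,
  and the only such maps are \<open>m f + n u + const\<close>.\<close>

section \<open>Smooth maps\<close>

abbreviation fd :: "('a::real_normed_vector \<Rightarrow> 'b::real_normed_vector) \<Rightarrow> 'a \<Rightarrow> 'a \<Rightarrow> 'b" where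
  "fd f u \<equiv> frechet_derivative f (at u)"

lemma Ck_on_cong:
  assumes "open S" "\<And>x. x \<in> S \<Longrightarrow> f x = g x" "Ck_on k S f"
  shows "Ck_on k S g"
  using assms(2,3)
proof (induction k arbitrary: f g)
  case 0
  then show ?case by (simp cong: continuous_on_cong)
next
  case (Suc k)
  have d: "f differentiable at x" if "x \<in> S" for x using Suc.prems(2) that by simp
  have e: "fd f x = fd g x" if "x \<in> S" for x
    using frechet_derivative_transform_within_open[OF d[OF that] \<open>open S\<close> that] Suc.prems(1) by blast
  have "g differentiable at x" if "x \<in> S" for x
    using d[OF that] has_derivative_transform_within_open[OF _ \<open>open S\<close> that, of f _ UNIV g] Suc.prems(1)
    unfolding differentiable_def by blast
  moreover have "Ck_on k S (\<lambda>x. fd g x v)" for v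
    using Suc.IH[of "\<lambda>x. fd f x v" "\<lambda>x. fd g x v"] e Suc.prems(2) by simp
  ultimately show ?case by simp
qed

lemma Ck_on_SucI:
  assumes "open S" "\<And>x. x \<in> S \<Longrightarrow> (f has_derivative f' x) (at x)" "\<And>v. Ck_on k S (\<lambda>x. f' x v)"
  shows "Ck_on (Suc k) S f"
proof -
  have "fd f x = f' x" if "x \<in> S" for x
    using frechet_derivative_at[OF assms(2)[OF that]] by simp
  then have "Ck_on k S (\<lambda>x. fd f x v)" for v
    using Ck_on_cong[OF assms(1) _ assms(3)[of v], of "\<lambda>x. fd f x v"] by simp
  then show ?thesis using assms(2) unfolding Ck_on.simps differentiable_def by blast
qed

lemma Ck_on_Suc_has_derivative:
  assumes "Ck_on (Suc k) S f" "x \<in> S"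
  shows "(f has_derivative fd f x) (at x)"
  using assms frechet_derivative_works by auto

text \<open>\<open>Ck_on\<close> asks for continuity only at the bottom of its recursion, so passing
  to a lower order needs an induction. At order 0 differentiability supplies continuity; above that
  the induction hypothesis applies to the directional derivatives.\<close>

lemma Ck_on_SucD: "Ck_on (Suc k) S f \<Longrightarrow> Ck_on k S f"
proof (induction k arbitrary: f)
  case 0
  then have "isCont f x" if "x \<in> S" for x
    using that differentiable_imp_continuous_within by (metis Ck_on.simps(2))
  then show ?case by (simp add: continuous_at_imp_continuous_on)
next
  case (Suc k)
  have d: "(\<forall>x\<in>S. f differentiable at x) \<and> (\<forall>v. Ck_on (Suc k) S (\<lambda>x. fd f x v))"
    using Suc.prems unfolding Ck_on.simps(2)[of "Suc k"] .
  then have "Ck_on k S (\<lambda>x. fd f x v)" for v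
    using Suc.IH by blast
  then show ?case unfolding Ck_on.simps(2)[of k] using d by blast
qed

lemma Ck_on_add:
  assumes "open S" "Ck_on k S f" "Ck_on k S g"
  shows "Ck_on k S (\<lambda>x. f x + g x)"
  using assms(2,3)
proof (induction k arbitrary: f g)
  case 0
  then show ?case by (simp add: continuous_on_add)
next
  case (Suc k)
  then show ?case
    by (intro Ck_on_SucI[OF assms(1) has_derivative_add[OF Ck_on_Suc_has_derivative Ck_on_Suc_has_derivative]])
       auto
qed

text \<open>The product rule expresses the derivative by values of \<open>h\<close> in which one
  argument is differentiated; the other is lowered by one order through \<open>Ck_on_SucD\<close>,
  so the induction hypothesis covers both terms.\<close>

lemma Ck_on_bilinear:
  assumes "open S" "bounded_bilinear h" "Ck_on k S f" "Ck_on k S g"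
  shows "Ck_on k S (\<lambda>x. h (f x) (g x))"
  using assms(3,4)
proof (induction k arbitrary: f g)
  case 0
  then show ?case using bounded_bilinear.continuous_on[OF assms(2)] by simp
next
  case (Suc k)
  interpret bounded_bilinear h by fact
  show ?case
  proof (rule Ck_on_SucI[OF \<open>open S\<close>])
    show "((\<lambda>x. h (f x) (g x)) has_derivative (\<lambda>v. h (f x) (fd g x v) + h (fd f x v) (g x))) (at x)"
      if "x \<in> S" for x
      using FDERIV[OF Ck_on_Suc_has_derivative[OF Suc.prems(1) that]
          Ck_on_Suc_has_derivative[OF Suc.prems(2) that]] .
    show "Ck_on k S (\<lambda>x. h (f x) (fd g x v) + h (fd f x v) (g x))" for v
      using Suc.prems Ck_on_SucD[OF Suc.prems(1)] Ck_on_SucD[OF Suc.prems(2)]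
      by (intro Ck_on_add[OF \<open>open S\<close>] Suc.IH) auto
  qed
qed

section \<open>Closure properties of smooth maps\<close>

lemma smooth_on_const [simp, intro]: "smooth_on S (\<lambda>x. c)"
proof -
  have "Ck_on k S (\<lambda>x. c)" for k
    by (induction k arbitrary: c) (auto simp: frechet_derivative_const)
  then show ?thesis by (simp add: smooth_on_def)
qed

lemma smooth_on_has_derivative:
  assumes "smooth_on S f" "x \<in> S"
  shows "(f has_derivative fd f x) (at x)"
  using assms Ck_on_Suc_has_derivative unfolding smooth_on_def by blast

lemma smooth_on_continuous: "smooth_on S f \<Longrightarrow> continuous_on S f"
  unfolding smooth_on_def using Ck_on.simps(1) by blast

lemma smooth_on_fd: "smooth_on S f \<Longrightarrow> smooth_on S (\<lambda>x. fd f x v)"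
  unfolding smooth_on_def using Ck_on.simps(2) by blast

lemma smooth_onI:
  assumes "open S" "\<And>x. x \<in> S \<Longrightarrow> (f has_derivative f' x) (at x)" "\<And>v. smooth_on S (\<lambda>x. f' x v)"
  shows "smooth_on S f"
  unfolding smooth_on_def
proof
  fix k
  show "Ck_on k S f"
    using Ck_on_SucD[OF Ck_on_SucI[OF assms(1,2)]] assms(3) unfolding smooth_on_def by blast
qed

lemma smooth_on_cong:
  "open S \<Longrightarrow> (\<And>x. x \<in> S \<Longrightarrow> f x = g x) \<Longrightarrow> smooth_on S f \<Longrightarrow> smooth_on S g"
  unfolding smooth_on_def using Ck_on_cong by blast

lemma Ck_on_subset: "T \<subseteq> S \<Longrightarrow> Ck_on k S f \<Longrightarrow> Ck_on k T f"
  by (induction k arbitrary: f) (auto intro: continuous_on_subset)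

lemma smooth_on_subset: "smooth_on S f \<Longrightarrow> T \<subseteq> S \<Longrightarrow> smooth_on T f"
  unfolding smooth_on_def using Ck_on_subset by blast

lemma smooth_on_bilinear:
  "open S \<Longrightarrow> bounded_bilinear h \<Longrightarrow> smooth_on S f \<Longrightarrow> smooth_on S g \<Longrightarrow> smooth_on S (\<lambda>x. h (f x) (g x))"
  unfolding smooth_on_def using Ck_on_bilinear by blast

lemmas smooth_on_scaleR = smooth_on_bilinear[OF _ bounded_bilinear_scaleR]
lemmas smooth_on_inner = smooth_on_bilinear[OF _ bounded_bilinear_inner]
lemmas smooth_on_mult = smooth_on_bilinear[OF _ bounded_bilinear_mult]

text \<open>With an extra scalar argument, frozen at 1, a linear map becomes bilinear, which reduces
  the claim to \<open>smooth_on_bilinear\<close>.\<close>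

lemma smooth_on_linear:
  assumes "open S" "bounded_linear h" "smooth_on S f"
  shows "smooth_on S (\<lambda>x. h (f x))"
proof -
  interpret bounded_linear h by fact
  have "bounded_bilinear (\<lambda>(r::real) y. r *\<^sub>R h y)"
    using bounded_bilinear.comp[OF bounded_bilinear_scaleR bounded_linear_ident bounded_linear_axioms] .
  from smooth_on_bilinear[OF assms(1) this smooth_on_const[of S 1] assms(3)] show ?thesis by simp
qed

lemma smooth_on_add:
  "open S \<Longrightarrow> smooth_on S f \<Longrightarrow> smooth_on S g \<Longrightarrow> smooth_on S (\<lambda>x. f x + g x)"
  unfolding smooth_on_def using Ck_on_add by blast

lemma smooth_on_minus: "open S \<Longrightarrow> smooth_on S f \<Longrightarrow> smooth_on S (\<lambda>x. - f x)"
  by (rule smooth_on_linear[OF _ bounded_linear_minus[OF bounded_linear_ident]])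

lemma smooth_on_diff:
  "open S \<Longrightarrow> smooth_on S f \<Longrightarrow> smooth_on S g \<Longrightarrow> smooth_on S (\<lambda>x. f x - g x)"
  using smooth_on_add[OF _ _ smooth_on_minus, of S f g] by simp

lemma smooth_on_sum:
  "open S \<Longrightarrow> (\<And>i. i \<in> I \<Longrightarrow> smooth_on S (f i)) \<Longrightarrow> smooth_on S (\<lambda>x. \<Sum>i\<in>I. f i x)"
  by (induction I rule: infinite_finite_induct) (auto intro: smooth_on_add)

lemma smooth_on_id: "open S \<Longrightarrow> smooth_on S (\<lambda>x. x)"
  by (rule smooth_onI[where f' = "\<lambda>x v. v"]) auto

text \<open>The derivative of the reciprocal is a polynomial in the reciprocal and the derivative of
  \<open>f\<close>. Order \<open>k\<close> of the reciprocal therefore yields order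
  \<open>k + 1\<close> of the same function.\<close>

lemma smooth_on_inverse:
  fixes f :: "_ \<Rightarrow> real"
  assumes "open S" "smooth_on S f" "\<And>x. x \<in> S \<Longrightarrow> f x \<noteq> 0"
  shows "smooth_on S (\<lambda>x. inverse (f x))"
proof -
  have "Ck_on k S (\<lambda>x. inverse (f x))" for k
  proof (induction k)
    case 0
    then show ?case using assms by (auto intro: continuous_on_inverse smooth_on_continuous)
  next
    case (Suc k)
    show ?case
    proof (rule Ck_on_SucI[OF assms(1)])
      show "((\<lambda>x. inverse (f x)) has_derivative (\<lambda>v. - (inverse (f x) * fd f x v * inverse (f x)))) (at x)"
        if "x \<in> S" for x
        using Deriv.has_derivative_inverse[OF assms(3) smooth_on_has_derivative[OF assms(2)], OF that that] .
      have "Ck_on k S (\<lambda>x. -1 * (inverse (f x) * fd f x v * inverse (f x)))" for v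
      proof (intro Ck_on_bilinear[OF assms(1) bounded_bilinear_mult] Suc)
        show "Ck_on k S (\<lambda>x. -1::real)" using smooth_on_const[of S "-1::real"] unfolding smooth_on_def by blast
        show "Ck_on k S (\<lambda>x. fd f x v)" using smooth_on_fd[OF assms(2)] by (auto simp: smooth_on_def)
      qed
      then show "Ck_on k S (\<lambda>x. - (inverse (f x) * fd f x v * inverse (f x)))" for v by simp
    qed
  qed
  then show ?thesis by (simp add: smooth_on_def)
qed

lemma smooth_on_divide:
  fixes f g :: "_ \<Rightarrow> real"
  assumes "open S" "smooth_on S f" "smooth_on S g" "\<And>x. x \<in> S \<Longrightarrow> g x \<noteq> 0"
  shows "smooth_on S (\<lambda>x. f x / g x)"
  unfolding divide_inverse using assms by (intro smooth_on_mult smooth_on_inverse) auto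

lemma smooth_on_exp:
  fixes f :: "_ \<Rightarrow> real"
  assumes "open S" "smooth_on S f"
  shows "smooth_on S (\<lambda>x. exp (f x))"
proof -
  have "Ck_on k S (\<lambda>x. exp (f x))" for k
  proof (induction k)
    case 0
    then show ?case using assms by (auto intro: continuous_on_exp smooth_on_continuous)
  next
    case (Suc k)
    show ?case
    proof (rule Ck_on_SucI[OF assms(1)])
      show "((\<lambda>x. exp (f x)) has_derivative (\<lambda>v. exp (f x) * fd f x v)) (at x)"
        if "x \<in> S" for x
        using has_derivative_exp[OF smooth_on_has_derivative[OF assms(2) that]] by (simp add: mult.commute)
      show "Ck_on k S (\<lambda>x. exp (f x) * fd f x v)" for v
        using smooth_on_fd[OF assms(2)] Suc
        by (intro Ck_on_bilinear[OF assms(1) bounded_bilinear_mult]) (auto simp: smooth_on_def)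
    qed
  qed
  then show ?thesis by (simp add: smooth_on_def)
qed

lemma smooth_on_vec_nth: "open S \<Longrightarrow> smooth_on S f \<Longrightarrow> smooth_on S (\<lambda>x. f x $ i)"
  by (rule smooth_on_linear[OF _ bounded_linear_vec_nth])

lemma has_derivative_sum_Basis:
  fixes f :: "'a::euclidean_space \<Rightarrow> 'b::real_normed_vector"
  assumes "(f has_derivative f') F"
  shows "f' v = (\<Sum>b\<in>Basis. (v \<bullet> b) *\<^sub>R f' b)"
proof -
  interpret bounded_linear f' using assms by (rule has_derivative_bounded_linear)
  have "f' v = f' (\<Sum>b\<in>Basis. (v \<bullet> b) *\<^sub>R b)" by (simp add: euclidean_representation)
  also have "\<dots> = (\<Sum>b\<in>Basis. (v \<bullet> b) *\<^sub>R f' b)" by (simp add: sum scaleR)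
  finally show ?thesis .
qed

text \<open>Smoothness is defined through constant directions only, so the moving direction
  \<open>X x\<close> is expanded in the standard basis.\<close>

lemma smooth_on_fd_field:
  assumes "open S" "smooth_on S f" "smooth_on S X"
  shows "smooth_on S (\<lambda>x. fd f x (X x))"
proof (rule smooth_on_cong[OF assms(1)])
  show "smooth_on S (\<lambda>x. \<Sum>b\<in>Basis. (X x \<bullet> b) *\<^sub>R fd f x b)"
    by (intro smooth_on_sum smooth_on_scaleR smooth_on_inner smooth_on_fd smooth_on_const assms)
  show "(\<Sum>b\<in>Basis. (X x \<bullet> b) *\<^sub>R fd f x b) = fd f x (X x)" if "x \<in> S" for x
    by (rule has_derivative_sum_Basis[OF smooth_on_has_derivative[OF assms(2) that], symmetric])
qed

lemmas smooth_on_intros = smooth_on_const smooth_on_fd_field smooth_on_scaleR smooth_on_inner smooth_on_mult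
  smooth_on_add smooth_on_diff smooth_on_minus smooth_on_sum smooth_on_id smooth_on_vec_nth
  smooth_on_divide smooth_on_exp

lemma smooth_on_fd_linear:
  "smooth_on S f \<Longrightarrow> x \<in> S \<Longrightarrow> bounded_linear (fd f x)"
  using has_derivative_bounded_linear smooth_on_has_derivative by blast

section \<open>Second derivatives and closed forms\<close>

lemma has_derivative_along_line:
  assumes "(f has_derivative f') (at (p + s *\<^sub>R v))"
  shows "((\<lambda>s. f (p + s *\<^sub>R v)) has_vector_derivative f' v) (at s)"
proof -
  have "((\<lambda>s. p + s *\<^sub>R v) has_vector_derivative v) (at s)"
    by (auto intro!: derivative_eq_intros)
  from vector_derivative_diff_chain_within[OF this, of f f'] assms show ?thesis
    by (simp add: o_def has_derivative_at_withinI)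
qed

text \<open>The mean value theorem is applied twice: along \<open>v\<close> to the increment of
  \<open>g\<close> across \<open>h *\<^sub>R w\<close>, then along \<open>w\<close> to the resulting
  increment of the \<open>v\<close>-derivative.\<close>

lemma second_difference_mean_value:
  fixes g :: "'a::euclidean_space \<Rightarrow> real"
  assumes "smooth_on (ball u r) g" "0 < h" "h * (norm v + norm w) < r"
  shows "\<exists>x\<in>ball u r. g (u + h *\<^sub>R v + h *\<^sub>R w) - g (u + h *\<^sub>R v) - g (u + h *\<^sub>R w) + g u
           = h * h * fd (\<lambda>x. fd g x v) x w"
proof -
  have mem: "u + s *\<^sub>R v + t *\<^sub>R w \<in> ball u r" if "0 \<le> s" "s \<le> h" "0 \<le> t" "t \<le> h" for s t
  proof -
    have "norm (s *\<^sub>R v + t *\<^sub>R w) \<le> \<bar>s\<bar> * norm v + \<bar>t\<bar> * norm w"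
      by (metis norm_scaleR norm_triangle_ineq)
    also have "\<dots> \<le> h * norm v + h * norm w"
      using that by (intro add_mono mult_right_mono) auto
    also have "\<dots> < r" using assms(3) by (simp add: algebra_simps)
    finally have "norm (- (s *\<^sub>R v + t *\<^sub>R w)) < r" by (simp only: norm_minus_cancel)
    moreover have "u - (u + s *\<^sub>R v + t *\<^sub>R w) = - (s *\<^sub>R v + t *\<^sub>R w)" by simp
    ultimately show ?thesis by (simp only: mem_ball dist_norm)
  qed
  have "((\<lambda>s. g (u + s *\<^sub>R v + h *\<^sub>R w) - g (u + s *\<^sub>R v)) has_real_derivative
     fd g (u + s *\<^sub>R v + h *\<^sub>R w) v - fd g (u + s *\<^sub>R v) v) (at s)" if "0 \<le> s" "s \<le> h" for s
  proof (rule DERIV_diff)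
    have "(g has_derivative fd g (u + h *\<^sub>R w + s *\<^sub>R v)) (at (u + h *\<^sub>R w + s *\<^sub>R v))"
      using smooth_on_has_derivative[OF assms(1) mem[of s h]] that assms(2) by (simp add: algebra_simps)
    from has_derivative_along_line[OF this]
    show "((\<lambda>s. g (u + s *\<^sub>R v + h *\<^sub>R w)) has_real_derivative fd g (u + s *\<^sub>R v + h *\<^sub>R w) v) (at s)"
      by (simp add: has_real_derivative_iff_has_vector_derivative algebra_simps)
    have "(g has_derivative fd g (u + s *\<^sub>R v)) (at (u + s *\<^sub>R v))"
      using smooth_on_has_derivative[OF assms(1) mem[of s 0]] that assms(2) by simp
    from has_derivative_along_line[OF this]
    show "((\<lambda>s. g (u + s *\<^sub>R v)) has_real_derivative fd g (u + s *\<^sub>R v) v) (at s)"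
      by (simp add: has_real_derivative_iff_has_vector_derivative)
  qed
  from MVT2[OF assms(2) this] obtain s where s: "0 < s" "s < h"
    and 1: "g (u + h *\<^sub>R v + h *\<^sub>R w) - g (u + h *\<^sub>R v) - (g (u + h *\<^sub>R w) - g u)
       = h * (fd g (u + s *\<^sub>R v + h *\<^sub>R w) v - fd g (u + s *\<^sub>R v) v)"
    by auto
  have "((\<lambda>t. fd g (u + s *\<^sub>R v + t *\<^sub>R w) v) has_real_derivative
     fd (\<lambda>x. fd g x v) (u + s *\<^sub>R v + t *\<^sub>R w) w) (at t)" if "0 \<le> t" "t \<le> h" for t
  proof -
    have "((\<lambda>x. fd g x v) has_derivative fd (\<lambda>x. fd g x v) (u + s *\<^sub>R v + t *\<^sub>R w)) (at (u + s *\<^sub>R v + t *\<^sub>R w))"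
      using smooth_on_has_derivative[OF smooth_on_fd[OF assms(1)] mem[of s t]] that s by simp
    from has_derivative_along_line[OF this] show ?thesis
      by (simp add: has_real_derivative_iff_has_vector_derivative)
  qed
  from MVT2[OF assms(2) this] obtain t where t: "0 < t" "t < h"
    and 2: "fd g (u + s *\<^sub>R v + h *\<^sub>R w) v - fd g (u + s *\<^sub>R v) v
      = h * fd (\<lambda>x. fd g x v) (u + s *\<^sub>R v + t *\<^sub>R w) w"
    by auto
  have "u + s *\<^sub>R v + t *\<^sub>R w \<in> ball u r" using mem s t by simp
  then show ?thesis using 1 unfolding 2 by (auto simp: algebra_simps intro!: bexI)
qed

text \<open>Schwarz's theorem. The second difference is symmetric in \<open>v\<close> and
  \<open>w\<close>, so the two mixed derivatives take a common value, possibly at different points,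
  in every small ball around \<open>u\<close>. Continuity then excludes a gap at
  \<open>u\<close>.\<close>

lemma second_derivative_symmetric_real:
  fixes g :: "'a::euclidean_space \<Rightarrow> real"
  assumes "open S" "smooth_on S g" "u \<in> S"
  shows "fd (\<lambda>x. fd g x v) u w = fd (\<lambda>x. fd g x w) u v"
proof (rule ccontr)
  define p where "p = (\<lambda>x. fd (\<lambda>x. fd g x v) x w)"
  define q where "q = (\<lambda>x. fd (\<lambda>x. fd g x w) x v)"
  assume "fd (\<lambda>x. fd g x v) u w \<noteq> fd (\<lambda>x. fd g x w) u v"
  then have ne: "p u \<noteq> q u" by (simp add: p_def q_def)
  define e where "e = \<bar>p u - q u\<bar> / 2"
  have e: "e > 0" using ne by (simp add: e_def)
  have "continuous_on S p" "continuous_on S q"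
    unfolding p_def q_def by (intro smooth_on_continuous smooth_on_fd assms)+
  then have "isCont p u" "isCont q u"
    using assms(1,3) continuous_on_eq_continuous_at by blast+
  then obtain r1 r2 where r1: "r1 > 0" "\<And>x. dist x u < r1 \<Longrightarrow> dist (p x) (p u) < e"
    and r2: "r2 > 0" "\<And>x. dist x u < r2 \<Longrightarrow> dist (q x) (q u) < e"
    using e unfolding continuous_at_eps_delta dist_norm by (metis real_norm_def)
  obtain r3 where r3: "r3 > 0" "ball u r3 \<subseteq> S" using assms(1,3) open_contains_ball by blast
  define r where "r = min r1 (min r2 r3)"
  have r: "r > 0" "ball u r \<subseteq> S" using r1 r2 r3 by (auto simp: r_def)
  \<comment> \<open>Scaled so that the parallelogram spanned by \<open>h *\<^sub>R v\<close> and
    \<open>h *\<^sub>R w\<close> stays in the ball; the summand 1 covers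
    \<open>v = w = 0\<close>.\<close>
  define h where "h = r / (2 * (norm v + norm w + 1))"
  have n: "norm v + norm w + 1 > 0" by (smt (verit) norm_ge_zero)
  have h: "h > 0" using r n by (simp add: h_def)
  have "h * (norm v + norm w) \<le> h * (norm v + norm w + 1)" using h by simp
  also have "\<dots> = r / 2" using n by (simp add: h_def field_simps)
  also have "\<dots> < r" using r by simp
  finally have hr: "h * (norm v + norm w) < r" .
  have sm: "smooth_on (ball u r) g" using smooth_on_subset[OF assms(2) r(2)] .
  obtain x y where xy: "x \<in> ball u r" "y \<in> ball u r" "h * h * p x = h * h * q y"
    using second_difference_mean_value[OF sm h hr] second_difference_mean_value[OF sm h, of w v] hr
    by (fastforce simp: p_def q_def algebra_simps)
  then have "p x = q y" using h by simp
  moreover have "dist (p x) (p u) < e" "dist (q y) (q u) < e"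
    using xy r1(2)[of x] r2(2)[of y] by (auto simp: r_def dist_commute)
  ultimately show False unfolding e_def dist_real_def by (smt (verit) field_sum_of_halves)
qed

lemma second_derivative_symmetric:
  fixes f :: "'a::euclidean_space \<Rightarrow> 'b::euclidean_space"
  assumes "open S" "smooth_on S f" "u \<in> S"
  shows "fd (\<lambda>x. fd f x v) u w = fd (\<lambda>x. fd f x w) u v"
proof (rule euclidean_eqI)
  fix b :: 'b
  have 1: "fd (\<lambda>x. f x \<bullet> b) x v = fd f x v \<bullet> b" if "x \<in> S" for x v
    using frechet_derivative_at[OF has_derivative_inner_left[OF smooth_on_has_derivative[OF assms(2) that], of b]]
    by metis
  have 2: "fd (\<lambda>x. fd (\<lambda>x. f x \<bullet> b) x v) u w = fd (\<lambda>x. fd f x v) u w \<bullet> b" for v w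
  proof -
    have "((\<lambda>x. fd f x v \<bullet> b) has_derivative (\<lambda>w. fd (\<lambda>x. fd f x v) u w \<bullet> b)) (at u)"
      by (intro has_derivative_inner_left smooth_on_has_derivative[OF smooth_on_fd[OF assms(2)] assms(3)])
    then have "((\<lambda>x. fd (\<lambda>x. f x \<bullet> b) x v) has_derivative (\<lambda>w. fd (\<lambda>x. fd f x v) u w \<bullet> b)) (at u)"
      by (rule has_derivative_transform_within_open[OF _ assms(1,3)]) (simp add: 1)
    from frechet_derivative_at[OF this] show ?thesis by metis
  qed
  have "smooth_on S (\<lambda>x. f x \<bullet> b)" by (intro smooth_on_intros assms)
  from second_derivative_symmetric_real[OF assms(1) this assms(3), of v w]
  show "fd (\<lambda>x. fd f x v) u w \<bullet> b = fd (\<lambda>x. fd f x w) u v \<bullet> b" by (simp add: 2)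
qed

text \<open>The Poincare lemma on a ball. The potential is the integral of the form along the
  segment from the centre, differentiated under the integral sign.\<close>

lemma closed_one_form_exact:
  fixes F :: "'a::euclidean_space \<Rightarrow> 'a"
  assumes smooth: "smooth_on (ball c r) F"
    and closed: "\<And>u v w. u \<in> ball c r \<Longrightarrow> fd F u v \<bullet> w = fd F u w \<bullet> v"
  shows "\<exists>\<Phi>. smooth_on (ball c r) \<Phi> \<and> (\<forall>u\<in>ball c r. (\<Phi> has_derivative (\<lambda>v. F u \<bullet> v)) (at u))"
proof -
  let ?B = "ball c r"
  have mem: "c + t *\<^sub>R (x - c) \<in> ?B" if "x \<in> ?B" "t \<in> cbox 0 1" for x and t :: real
  proof -
    have "norm (t *\<^sub>R (x - c)) \<le> 1 * norm (x - c)"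
      unfolding norm_scaleR using that by (intro mult_right_mono) auto
    then show ?thesis using that by (simp add: dist_norm norm_minus_commute)
  qed
  define f where "f = (\<lambda>x t. F (c + t *\<^sub>R (x - c)) \<bullet> (x - c))"
  define f' where "f' = (\<lambda>x t v. t * (fd F (c + t *\<^sub>R (x - c)) v \<bullet> (x - c)) + F (c + t *\<^sub>R (x - c)) \<bullet> v)"
  define L where "L = (\<lambda>x t. Blinfun (f' x t))"
  have der: "((\<lambda>x. f x t) has_derivative f' x t) (at x)" if "x \<in> ?B" "t \<in> cbox 0 1" for x t
  proof -
    have b: "bounded_linear (fd F (c + t *\<^sub>R (x - c)))"
      by (rule smooth_on_fd_linear[OF smooth mem[OF that]])
    have "((\<lambda>x. c + t *\<^sub>R (x - c)) has_derivative (\<lambda>v. t *\<^sub>R v)) (at x)"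
      by (auto intro!: derivative_eq_intros)
    from diff_chain_at[OF this smooth_on_has_derivative[OF smooth mem[OF that]]]
    have "((\<lambda>x. F (c + t *\<^sub>R (x - c))) has_derivative (\<lambda>v. fd F (c + t *\<^sub>R (x - c)) (t *\<^sub>R v))) (at x)"
      by (simp add: o_def)
    note has_derivative_inner[OF this has_derivative_diff[OF has_derivative_ident has_derivative_const]]
    then show ?thesis unfolding f_def f'_def
      by (rule has_derivative_eq_rhs) (auto simp: linear_cmul[OF bounded_linear.linear[OF b]] fun_eq_iff)
  qed
  have L: "blinfun_apply (L x t) = f' x t" if "x \<in> ?B" "t \<in> cbox 0 1" for x t
    unfolding L_def using has_derivative_bounded_linear[OF der[OF that]] by (rule bounded_linear_Blinfun_apply)
  have cont0: "continuous_on (?B \<times> cbox 0 1) (\<lambda>z. G (c + snd z *\<^sub>R (fst z - c)))"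
    if "continuous_on ?B G" for G :: "'a \<Rightarrow> 'a"
    by (rule continuous_on_compose2[OF that]) (auto intro!: continuous_intros mem simp: split_beta simp del: mem_ball)
  have cont: "continuous_on (?B \<times> cbox 0 1) (\<lambda>(x, t). L x t)"
  proof (rule continuous_on_blinfun_componentwise)
    fix i :: 'a
    have "continuous_on (?B \<times> cbox 0 1) (\<lambda>z. f' (fst z) (snd z) i)"
      unfolding f'_def
      by (intro continuous_intros cont0 smooth_on_continuous smooth smooth_on_fd)
    then show "continuous_on (?B \<times> cbox 0 1) (\<lambda>z. blinfun_apply (case z of (x, t) \<Rightarrow> L x t) i)"
      by (rule continuous_on_eq) (use L in \<open>auto simp: split_beta simp del: mem_ball\<close>)
  qed
  have contf: "continuous_on (cbox 0 1) (f x)" if "x \<in> ?B" for x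
    unfolding f_def using mem[OF that]
    by (intro continuous_intros continuous_on_compose2[OF smooth_on_continuous[OF smooth]]) auto
  have contL: "continuous_on (cbox 0 1) (L x)" if "x \<in> ?B" for x
    using continuous_on_compose2[OF cont continuous_on_Pair[OF continuous_on_const[of _ x] continuous_on_id, of "cbox 0 1"]] that
    by (auto simp del: mem_ball)
  define \<Phi> where "\<Phi> = (\<lambda>x. integral (cbox 0 1) (f x))"
  have dPhi: "(\<Phi> has_derivative (\<lambda>v. F x \<bullet> v)) (at x)" if x: "x \<in> ?B" for x
  proof -
    have "(\<Phi> has_derivative integral (cbox 0 1) (L x)) (at x within ?B)"
      unfolding \<Phi>_def
    proof (rule leibniz_rule[OF _ integrable_continuous[OF contf] cont x convex_ball])
      show "((\<lambda>x. f x t) has_derivative blinfun_apply (L y t)) (at y within ?B)"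
        if "y \<in> ?B" "t \<in> cbox 0 1" for y t
        unfolding L[OF that] by (rule has_derivative_at_withinI[OF der[OF that]])
    qed
    moreover have "blinfun_apply (integral (cbox 0 1) (L x)) v = F x \<bullet> v" for v
    proof -
      \<comment> \<open>Closedness turns the integrand of the differentiated integral into a total
        \<open>t\<close>-derivative; its primitive is 0 at \<open>t = 0\<close> and
        \<open>F x \<bullet> v\<close> at \<open>t = 1\<close>.\<close>
      have "((\<lambda>t. t * (F (c + t *\<^sub>R (x - c)) \<bullet> v)) has_vector_derivative L x t v) (at t within {0..1})"
        if t: "0 \<le> t" "t \<le> 1" for t
      proof -
        have t': "t \<in> cbox 0 1" using t by simp
        have "((\<lambda>t. F (c + t *\<^sub>R (x - c))) has_vector_derivative fd F (c + t *\<^sub>R (x - c)) (x - c)) (at t)"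
          by (rule has_derivative_along_line[OF smooth_on_has_derivative[OF smooth mem[OF x t']]])
        then have "((\<lambda>t. F (c + t *\<^sub>R (x - c)) \<bullet> v) has_vector_derivative fd F (c + t *\<^sub>R (x - c)) (x - c) \<bullet> v) (at t)"
          by (rule bounded_linear.has_vector_derivative[OF bounded_linear_inner_left])
        then have "((\<lambda>t. t * (F (c + t *\<^sub>R (x - c)) \<bullet> v)) has_vector_derivative
            t * (fd F (c + t *\<^sub>R (x - c)) (x - c) \<bullet> v) + 1 * (F (c + t *\<^sub>R (x - c)) \<bullet> v)) (at t)"
          by (intro has_vector_derivative_mult has_vector_derivative_id)
        then show ?thesis
          unfolding L[OF x t'] f'_def
          using closed[OF mem[OF x t'], of v "x - c"] by (simp add: has_vector_derivative_at_within)
      qed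
      from fundamental_theorem_of_calculus[OF _ this]
      have "((\<lambda>t. L x t v) has_integral F x \<bullet> v) (cbox 0 1)" by simp
      then show ?thesis
        using blinfun_apply_integral[OF integrable_continuous[OF contL[OF x]], of v] by (simp add: integral_unique)
    qed
    then have "blinfun_apply (integral (cbox 0 1) (L x)) = (\<lambda>v. F x \<bullet> v)" by (rule ext)
    ultimately show ?thesis using at_within_open[OF x open_ball] by simp
  qed
  have "smooth_on ?B \<Phi>"
    by (rule smooth_onI[OF open_ball dPhi]) (auto intro!: smooth_on_intros smooth)
  then show ?thesis using dPhi by blast
qed

text \<open>The hypothesis reads \<open>d \<eta> = - \<phi> \<and> \<eta> + \<rho>\<close> with a
  wedge product. Since \<open>d (d \<eta>) = 0\<close> and \<open>\<phi> \<and> \<phi> = 0\<close>,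
  it implies \<open>d \<phi> \<and> \<eta> = \<phi> \<and> \<rho> + d \<rho>\<close>, which is
  stated here on three constant vectors.\<close>

lemma ext_deriv_structure:
  fixes \<eta> \<phi> :: "real^3 \<Rightarrow> real^3" and \<rho> :: "real^3 \<Rightarrow> real^3 \<Rightarrow> real^3 \<Rightarrow> real"
  assumes "open S" "u \<in> S" and \<eta>: "smooth_on S \<eta>" and \<phi>: "smooth_on S \<phi>"
    and \<rho>: "\<And>v w. smooth_on S (\<lambda>x. \<rho> x v w)"
    and eq: "\<And>x v w. x \<in> S \<Longrightarrow>
      ext_deriv \<eta> x v w = (\<phi> x \<bullet> w) * (\<eta> x \<bullet> v) - (\<phi> x \<bullet> v) * (\<eta> x \<bullet> w) + \<rho> x v w"
  shows "ext_deriv \<phi> u v1 v2 * (\<eta> u \<bullet> v3) + ext_deriv \<phi> u v2 v3 * (\<eta> u \<bullet> v1) + ext_deriv \<phi> u v3 v1 * (\<eta> u \<bullet> v2)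
    = (\<phi> u \<bullet> v1) * \<rho> u v2 v3 + (\<phi> u \<bullet> v2) * \<rho> u v3 v1 + (\<phi> u \<bullet> v3) * \<rho> u v1 v2
      + fd (\<lambda>x. \<rho> x v2 v3) u v1 + fd (\<lambda>x. \<rho> x v3 v1) u v2 + fd (\<lambda>x. \<rho> x v1 v2) u v3"
proof -
  have step: "fd (\<lambda>x. fd \<eta> x b) u a \<bullet> c - fd (\<lambda>x. fd \<eta> x c) u a \<bullet> b
     = (fd \<phi> u a \<bullet> c) * (\<eta> u \<bullet> b) + (\<phi> u \<bullet> c) * (fd \<eta> u a \<bullet> b)
      - ((fd \<phi> u a \<bullet> b) * (\<eta> u \<bullet> c) + (\<phi> u \<bullet> b) * (fd \<eta> u a \<bullet> c)) + fd (\<lambda>x. \<rho> x b c) u a" for a b c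
  proof -
    have d\<eta>: "(\<eta> has_derivative fd \<eta> u) (at u)" and d\<phi>: "(\<phi> has_derivative fd \<phi> u) (at u)"
      and d\<rho>: "((\<lambda>x. \<rho> x b c) has_derivative fd (\<lambda>x. \<rho> x b c) u) (at u)"
      and d2: "\<And>v. ((\<lambda>x. fd \<eta> x v) has_derivative fd (\<lambda>x. fd \<eta> x v) u) (at u)"
      using smooth_on_has_derivative[OF _ assms(2)] \<eta> \<phi> \<rho> smooth_on_fd by blast+
    have 1: "((\<lambda>x. fd \<eta> x b \<bullet> c - fd \<eta> x c \<bullet> b) has_derivative
        (\<lambda>a. fd (\<lambda>x. fd \<eta> x b) u a \<bullet> c - fd (\<lambda>x. fd \<eta> x c) u a \<bullet> b)) (at u)"
      by (intro has_derivative_diff has_derivative_inner_left d2)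
    note prod = has_derivative_mult[OF has_derivative_inner_left[OF d\<phi>] has_derivative_inner_left[OF d\<eta>]]
    have 2: "((\<lambda>x. (\<phi> x \<bullet> c) * (\<eta> x \<bullet> b) - (\<phi> x \<bullet> b) * (\<eta> x \<bullet> c) + \<rho> x b c) has_derivative
        (\<lambda>a. (fd \<phi> u a \<bullet> c) * (\<eta> u \<bullet> b) + (\<phi> u \<bullet> c) * (fd \<eta> u a \<bullet> b)
      - ((fd \<phi> u a \<bullet> b) * (\<eta> u \<bullet> c) + (\<phi> u \<bullet> b) * (fd \<eta> u a \<bullet> c)) + fd (\<lambda>x. \<rho> x b c) u a)) (at u)"
      by (rule has_derivative_eq_rhs[OF has_derivative_add[OF has_derivative_diff[OF prod prod] d\<rho>]])
         (auto simp: algebra_simps)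
    have "((\<lambda>x. fd \<eta> x b \<bullet> c - fd \<eta> x c \<bullet> b) has_derivative
        (\<lambda>a. (fd \<phi> u a \<bullet> c) * (\<eta> u \<bullet> b) + (\<phi> u \<bullet> c) * (fd \<eta> u a \<bullet> b)
      - ((fd \<phi> u a \<bullet> b) * (\<eta> u \<bullet> c) + (\<phi> u \<bullet> b) * (fd \<eta> u a \<bullet> c)) + fd (\<lambda>x. \<rho> x b c) u a)) (at u)"
      by (rule has_derivative_transform_within_open[OF 2 assms(1,2)])
         (use eq[of _ b c] in \<open>simp add: ext_deriv_def\<close>)
    from has_derivative_unique[OF 1 this] show ?thesis by meson
  qed
  have sym: "fd (\<lambda>x. fd \<eta> x v) u w = fd (\<lambda>x. fd \<eta> x w) u v" for v w
    by (rule second_derivative_symmetric[OF assms(1) \<eta> assms(2)])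
  have r: "\<rho> u v w = fd \<eta> u v \<bullet> w - fd \<eta> u w \<bullet> v - ((\<phi> u \<bullet> w) * (\<eta> u \<bullet> v) - (\<phi> u \<bullet> v) * (\<eta> u \<bullet> w))" for v w
    using eq[OF assms(2), of v w] by (simp add: ext_deriv_def)
  show ?thesis
    unfolding ext_deriv_def r
    using step[where a=v1 and b=v2 and c=v3] step[where a=v2 and b=v3 and c=v1] step[where a=v3 and b=v1 and c=v2]
      sym[of v1 v2] sym[of v2 v3] sym[of v3 v1]
    by (simp add: algebra_simps)
qed

section \<open>Integral curves\<close>

text \<open>Compactness bounds the partial derivatives, their sum bounds the operator norm, and
  convexity of the ball gives the mean value inequality. The summand 1 in \<open>K\<close> only
  makes the constant positive.\<close>

lemma smooth_on_lipschitz_on_cball: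
  fixes X :: "'a::euclidean_space \<Rightarrow> 'b::real_normed_vector"
  assumes "smooth_on U X" "cball p r \<subseteq> U"
  shows "\<exists>K>0. \<forall>x\<in>cball p r. \<forall>y\<in>cball p r. norm (X x - X y) \<le> K * norm (x - y)"
proof -
  have "\<exists>M. \<forall>x\<in>cball p r. norm (fd X x b) \<le> M" for b
  proof -
    have "continuous_on (cball p r) (\<lambda>x. fd X x b)"
      using smooth_on_continuous[OF smooth_on_fd[OF assms(1)]] assms(2) continuous_on_subset by blast
    then have "bounded ((\<lambda>x. fd X x b) ` cball p r)"
      by (intro compact_imp_bounded compact_continuous_image) auto
    then show ?thesis unfolding bounded_iff by blast
  qed
  then obtain M where M: "\<And>b x. x \<in> cball p r \<Longrightarrow> norm (fd X x b) \<le> M b" by metis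
  define K where "K = (\<Sum>b\<in>Basis. \<bar>M b\<bar>) + 1"
  have K: "K > 0" unfolding K_def by (smt (verit) sum_nonneg abs_ge_zero)
  have "norm (X x - X y) \<le> K * norm (x - y)" if "x \<in> cball p r" "y \<in> cball p r" for x y
  proof (rule differentiable_bound[OF convex_cball _ _ that])
    fix z assume z: "z \<in> cball p r"
    then have zU: "z \<in> U" using assms(2) by blast
    show "(X has_derivative fd X z) (at z within cball p r)"
      by (rule has_derivative_at_withinI[OF smooth_on_has_derivative[OF assms(1) zU]])
    have "onorm (fd X z) \<le> (\<Sum>b\<in>Basis. norm (fd X z b))"
      by (rule onorm_componentwise[OF smooth_on_fd_linear[OF assms(1) zU]])
    also have "\<dots> \<le> (\<Sum>b\<in>Basis. \<bar>M b\<bar>)"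
      using M[OF z] by (intro sum_mono) (meson abs_ge_self order_trans)
    finally show "onorm (fd X z) \<le> K" by (simp add: K_def)
  qed
  with K show ?thesis by blast
qed

text \<open>Banach's fixed point theorem for the integral operator on bounded continuous curves. The
  field is assumed globally bounded and Lipschitz, so no domain has to be tracked during the
  iteration.\<close>

lemma picard_lindelof:
  fixes Y :: "'a::euclidean_space \<Rightarrow> 'a"
  assumes lip: "\<And>x y. norm (Y x - Y y) \<le> K * norm (x - y)" and bound: "\<And>x. norm (Y x) \<le> M"
    and h: "0 < h" "3 * h * K < 1" and K: "0 < K"
  shows "\<exists>c. c 0 = p \<and> (\<forall>t. norm (c t - p) \<le> 3 * h * M) \<and>
    (\<forall>t\<in>{-h<..<h}. (c has_vector_derivative Y (c t)) (at t))"
proof -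
  have Ycont: "continuous_on A Y" for A
  proof (rule continuous_onI)
    fix x e assume "0 < (e::real)" "x \<in> A"
    show "\<exists>d>0. \<forall>y\<in>A. dist y x < d \<longrightarrow> dist (Y y) (Y x) \<le> e"
    proof (intro exI[of _ "e / K"] conjI ballI impI)
      show "0 < e / K" using \<open>0 < e\<close> K by simp
      fix y assume "dist y x < e / K"
      then have "K * norm (y - x) \<le> e" using K by (simp add: dist_norm field_simps)
      then show "dist (Y y) (Y x) \<le> e" using lip[of y x] unfolding dist_norm by linarith
    qed
  qed
  \<comment> \<open>Clamping time to \<open>[-h, h]\<close> lets the operator act on curves defined
    on the whole line, where bounded continuous functions form a complete space.\<close>
  define cl where "cl = (\<lambda>t. max (-h) (min h t))"
  have cl: "-h \<le> cl t" "cl t \<le> h" for t using h by (auto simp: cl_def)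
  have clc: "continuous_on A cl" for A unfolding cl_def by (intro continuous_intros)
  define G where "G = (\<lambda>(c::real \<Rightarrow>\<^sub>C 'a) t. integral {-h..t} (\<lambda>s. Y (c s)))"
  have contYc: "continuous_on A (\<lambda>s. Y (apply_bcontfun c s))" for c A
    by (rule continuous_on_compose2[OF Ycont]) auto
  have G: "(G c has_vector_derivative Y (c t)) (at t within {-h..h})" if "t \<in> {-h..h}" for c t
    unfolding G_def by (rule integral_has_vector_derivative[OF contYc that])
  have Gcont: "continuous_on {-h..h} (G c)" for c
    using G has_vector_derivative_continuous by (fastforce simp: continuous_on_eq_continuous_within)
  \<comment> \<open>The integral from 0 to \<open>cl t\<close>, written as a difference of integrals
    from \<open>-h\<close> to avoid a sign distinction. Their lengths are at most
    \<open>2 * h\<close> and \<open>h\<close>, whence the factor 3 in the bounds.\<close>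
  define T where "T = (\<lambda>c t. p + (G c (cl t) - G c 0))"
  have GB: "norm (G c (cl t)) \<le> M * (2 * h)" "norm (G c 0) \<le> M * h" for c t
  proof -
    have M: "0 \<le> M" using bound[of 0] norm_ge_zero order_trans by blast
    have "norm (G c (cl t)) \<le> M * (cl t - - h)"
      unfolding G_def by (rule integral_bound) (use cl bound contYc in auto)
    also have "\<dots> \<le> M * (2 * h)" using cl[of t] M by (intro mult_left_mono) auto
    finally show "norm (G c (cl t)) \<le> M * (2 * h)" .
    have "norm (G c 0) \<le> M * (0 - - h)"
      unfolding G_def by (rule integral_bound) (use h bound contYc in auto)
    then show "norm (G c 0) \<le> M * h" by simp
  qed
  have TB: "norm (T c t - p) \<le> 3 * h * M" for c t
    using GB(1)[of c t] GB(2)[of c] norm_triangle_ineq4[of "G c (cl t)" "G c 0"] by (simp add: T_def algebra_simps)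
  have Tb: "T c \<in> bcontfun" for c
  proof (rule bcontfun_normI)
    show "continuous_on UNIV (T c)"
      unfolding T_def by (intro continuous_intros continuous_on_compose2[OF Gcont clc]) (use cl in auto)
    show "norm (T c t) \<le> norm p + 3 * h * M" for t
      using TB[of c t] norm_triangle_ineq[of "T c t - p" p] by simp
  qed
  have Tapp: "apply_bcontfun (Bcontfun (T c)) = T c" for c by (rule Bcontfun_inverse[OF Tb])
  have "dist (Bcontfun (T c)) (Bcontfun (T d)) \<le> (3 * h * K) * dist c d" for c d
  proof (rule dist_bound)
    fix t
    have Gd: "G c s - G d s = integral {-h..s} (\<lambda>s. Y (c s) - Y (d s))" for s
      unfolding G_def by (intro integral_diff[symmetric] integrable_continuous_real contYc)
    have Yd: "norm (Y (c s) - Y (d s)) \<le> K * dist c d" for s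
      using lip[of "c s" "d s"] Bounded_Continuous_Function.dist_bounded[of c s d] K by (smt (verit) dist_norm mult_left_mono)
    have "norm (G c (cl t) - G d (cl t)) \<le> K * dist c d * (cl t - - h)"
      unfolding Gd by (rule integral_bound) (use cl Yd contYc in \<open>auto intro!: continuous_intros\<close>)
    also have "\<dots> \<le> K * dist c d * (2 * h)" using cl[of t] K by (intro mult_left_mono) auto
    finally have 1: "norm (G c (cl t) - G d (cl t)) \<le> K * dist c d * (2 * h)" .
    have 2: "norm (G c 0 - G d 0) \<le> K * dist c d * (0 - - h)"
      unfolding Gd by (rule integral_bound) (use h Yd contYc in \<open>auto intro!: continuous_intros\<close>)
    have "T c t - T d t = (G c (cl t) - G d (cl t)) - (G c 0 - G d 0)" by (simp add: T_def)
    then have "norm (T c t - T d t) \<le> norm (G c (cl t) - G d (cl t)) + norm (G c 0 - G d 0)"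
      by (metis norm_triangle_ineq4)
    also have "\<dots> \<le> K * dist c d * (2 * h) + K * dist c d * (0 - - h)" by (rule add_mono[OF 1 2])
    also have "\<dots> = (3 * h * K) * dist c d" by (simp add: algebra_simps)
    finally show "dist (Bcontfun (T c) t) (Bcontfun (T d) t) \<le> 3 * h * K * dist c d"
      unfolding Tapp dist_norm .
  qed
  then have "\<exists>!c. Bcontfun (T c) = c"
    using h K by (intro banach_fix_type[where c = "3 * h * K"]) auto
  then obtain c where c: "apply_bcontfun c = T c" using Tapp by metis
  show ?thesis
  proof (intro exI[of _ "apply_bcontfun c"] conjI allI ballI)
    show "c 0 = p" unfolding c using h by (simp add: T_def cl_def)
    show "norm (c t - p) \<le> 3 * h * M" for t unfolding c by (rule TB)
    fix t assume t: "t \<in> {-h<..<h}"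
    then have "(G c has_vector_derivative Y (c t)) (at t)"
      using G[of t c] at_within_interior[of t "{-h..h}"] by (simp add: interior_atLeastAtMost_real)
    then have "((\<lambda>t. p + (G c t - G c 0)) has_vector_derivative Y (c t)) (at t)"
      by (auto intro!: derivative_eq_intros)
    then show "(c has_vector_derivative Y (c t)) (at t)"
      by (rule has_vector_derivative_transform_within_open[OF _ open_greaterThanLessThan t])
         (auto simp: c T_def cl_def)
  qed
qed

text \<open>Composing \<open>X\<close> with the nearest-point projection onto a closed ball in
  \<open>U\<close> gives a globally bounded Lipschitz field. For short times the solution stays in
  the ball, where the two fields agree.\<close>

lemma integral_curve_exists:
  fixes X :: "real^3 \<Rightarrow> real^3"
  assumes "open U" "smooth_on U X" "p \<in> U"
  shows "\<exists>c d. 0 < d \<and> c 0 = p \<and> integral_curve U X {-d<..<d} c"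
proof -
  obtain r where r: "r > 0" "cball p r \<subseteq> U" using assms(1,3) open_contains_cball by blast
  obtain K where K: "K > 0" "\<And>x y. x \<in> cball p r \<Longrightarrow> y \<in> cball p r \<Longrightarrow> norm (X x - X y) \<le> K * norm (x - y)"
    using smooth_on_lipschitz_on_cball[OF assms(2) r(2)] by blast
  define cp where "cp = closest_point (cball p r)"
  have ne: "cball p r \<noteq> {}" using r by simp
  have cp: "cp x \<in> cball p r" for x
    unfolding cp_def by (rule closest_point_in_set[OF closed_cball ne])
  define Y where "Y = (\<lambda>x. X (cp x))"
  have lip: "norm (Y x - Y y) \<le> K * norm (x - y)" for x y
  proof -
    have "norm (Y x - Y y) \<le> K * dist (cp x) (cp y)"
      unfolding Y_def dist_norm by (rule K(2)[OF cp cp])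
    also have "\<dots> \<le> K * dist x y"
      using closest_point_lipschitz[OF convex_cball closed_cball ne] K(1)
      by (intro mult_left_mono) (auto simp: cp_def)
    finally show ?thesis by (simp add: dist_norm)
  qed
  have "continuous_on (cball p r) X"
    using smooth_on_continuous[OF assms(2)] r(2) continuous_on_subset by blast
  then have "bounded (X ` cball p r)" by (intro compact_imp_bounded compact_continuous_image) auto
  then obtain M where M: "M > 0" "\<And>x. x \<in> cball p r \<Longrightarrow> norm (X x) \<le> M"
    unfolding bounded_pos by blast
  \<comment> \<open>The first bound makes the iteration a contraction, the second keeps the curve in
    \<open>cball p r\<close>.\<close>
  define h where "h = min (1 / (4 * K)) (r / (3 * M))"
  have h: "h > 0" "3 * h * K < 1" "3 * h * M \<le> r"
  proof -
    show "h > 0" using K(1) M(1) r(1) by (simp add: h_def)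
    have "h * K \<le> 1 / (4 * K) * K" using K(1) by (intro mult_right_mono) (auto simp: h_def)
    then show "3 * h * K < 1" using K(1) by simp
    have "h * M \<le> r / (3 * M) * M" using M(1) by (intro mult_right_mono) (auto simp: h_def)
    then show "3 * h * M \<le> r" using M(1) by simp
  qed
  have "norm (Y x) \<le> M" for x unfolding Y_def by (rule M(2)[OF cp])
  from picard_lindelof[OF lip this h(1,2) K(1), of p] obtain c where
    c: "c 0 = p" "\<And>t. norm (c t - p) \<le> 3 * h * M"
      "\<And>t. t \<in> {-h<..<h} \<Longrightarrow> (c has_vector_derivative Y (c t)) (at t)" by blast
  have mem: "c t \<in> cball p r" for t
    using c(2)[of t] h(3) by (simp add: dist_norm norm_minus_commute)
  have "Y (c t) = X (c t)" for t unfolding Y_def cp_def using closest_point_self[OF mem] by simp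
  then have "integral_curve U X {-h<..<h} c"
    unfolding integral_curve_def using mem r(2) c(3) by (auto simp del: mem_cball)
  then show ?thesis using h(1) c(1) by blast
qed

text \<open>Along a curve contained in a line of direction \<open>e\<close>, every covector that
  kills \<open>e\<close> kills the velocity at all times. If \<open>X p \<noteq> 0\<close> then
  \<open>X p\<close> is parallel to \<open>e\<close>, so \<open>n\<close> is such a covector, and
  differentiating \<open>n \<bullet> X (c t) = 0\<close> at time 0 gives the claim.\<close>

lemma straight_integral_curves_acceleration:
  fixes X :: "real^3 \<Rightarrow> real^3"
  assumes "open U" "smooth_on U X" "p \<in> U"
    and straight: "\<And>J c. integral_curve U X J c \<Longrightarrow> collinear (c ` J)"
    and n: "n \<bullet> X p = 0"
  shows "n \<bullet> fd X p (X p) = 0"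
proof -
  obtain c d where d: "0 < d" and c0: "c 0 = p" and c: "integral_curve U X {-d<..<d} c"
    using integral_curve_exists[OF assms(1-3)] by blast
  define J where "J = {-d<..<d}"
  have J: "open J" "0 \<in> J" using d by (auto simp: J_def)
  have cJ: "c t \<in> U" "(c has_vector_derivative X (c t)) (at t)" if "t \<in> J" for t
    using c that unfolding integral_curve_def J_def by blast+
  obtain e where e: "\<And>t s. t \<in> J \<Longrightarrow> s \<in> J \<Longrightarrow> \<exists>k. c t - c s = k *\<^sub>R e"
    using straight[OF c] unfolding collinear_def J_def by blast
  have orth: "m \<bullet> X (c t) = 0" if me: "m \<bullet> e = 0" and t: "t \<in> J" for m t
  proof -
    have const: "m \<bullet> c s = m \<bullet> c 0" if s: "s \<in> J" for s
    proof -
      obtain k where "c s - c 0 = k *\<^sub>R e" using e[OF s J(2)] by blast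
      then have "m \<bullet> (c s - c 0) = 0" using me by simp
      then show ?thesis by (simp add: inner_diff_right)
    qed
    have "((\<lambda>s. m \<bullet> c s) has_vector_derivative m \<bullet> X (c t)) (at t)"
      by (rule bounded_linear.has_vector_derivative[OF bounded_linear_inner_right cJ(2)[OF t]])
    moreover have "((\<lambda>s. m \<bullet> c s) has_vector_derivative 0) (at t)"
      by (rule has_vector_derivative_transform_within_open[OF has_vector_derivative_const J(1) t])
         (use const in auto)
    ultimately show ?thesis using vector_derivative_unique_at by blast
  qed
  show ?thesis
  proof (cases "X p = 0")
    case True
    then show ?thesis
      using linear_0[OF bounded_linear.linear[OF smooth_on_fd_linear[OF assms(2,3)]]] by simp
  next
    case False
    \<comment> \<open>The part of \<open>X p\<close> orthogonal to \<open>e\<close>. For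
      \<open>e = 0\<close> the quotient is 0 and \<open>m = X p\<close>, so the argument covers this
      case too.\<close>
    define m where "m = X p - ((X p \<bullet> e) / (e \<bullet> e)) *\<^sub>R e"
    have "m \<bullet> e = 0" by (simp add: m_def inner_diff_left)
    then have "m \<bullet> X p = 0" using orth[OF _ J(2)] c0 by simp
    with \<open>m \<bullet> e = 0\<close> have "m \<bullet> m = 0" by (simp add: m_def inner_diff_right)
    then have "X p = ((X p \<bullet> e) / (e \<bullet> e)) *\<^sub>R e" by (simp add: m_def)
    with n False have "n \<bullet> e = 0" by (metis inner_scaleR_right mult_eq_0_iff scale_eq_0_iff)
    have "(X has_derivative fd X p) (at (c 0))"
      using smooth_on_has_derivative[OF assms(2,3)] c0 by simp
    then have "((X \<circ> c) has_vector_derivative fd X p (X p)) (at 0)"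
      using vector_derivative_diff_chain_within[of c "X p" 0 UNIV X "fd X p"] cJ(2)[OF J(2)] c0
      by (simp add: has_derivative_at_withinI)
    then have "((\<lambda>t. n \<bullet> X (c t)) has_vector_derivative n \<bullet> fd X p (X p)) (at 0)"
      using bounded_linear.has_vector_derivative[OF bounded_linear_inner_right] by (fastforce simp: o_def)
    moreover have "((\<lambda>t. n \<bullet> X (c t)) has_vector_derivative 0) (at 0)"
      by (rule has_vector_derivative_transform_within_open[OF has_vector_derivative_const J])
         (use orth[OF \<open>n \<bullet> e = 0\<close>] in auto)
    ultimately show ?thesis using vector_derivative_unique_at by blast
  qed
qed

section \<open>Frames with straight integral curves\<close>

lemma UNIV_3_distinct:
  fixes a b c :: 3
  assumes "a \<noteq> b" "b \<noteq> c" "a \<noteq> c"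
  shows "UNIV = {a, b, c}"
  using assms exhaust_3[of a] exhaust_3[of b] exhaust_3[of c] UNIV_3 by auto

lemma sum_3_distinct:
  fixes a b c :: 3
  assumes "a \<noteq> b" "b \<noteq> c" "a \<noteq> c"
  shows "(\<Sum>i\<in>UNIV. g i) = g a + g b + (g c :: 'b::comm_monoid_add)"
  unfolding UNIV_3_distinct[OF assms] using assms by (simp add: add.assoc)

lemma fd_eqI: "(f has_derivative f') (at x) \<Longrightarrow> fd f x v = f' v"
  using frechet_derivative_at by metis

lemma ext_deriv_scaleR:
  fixes k :: "real^3 \<Rightarrow> real"
  assumes "(k has_derivative fd k u) (at u)" "(\<eta> has_derivative fd \<eta> u) (at u)"
  shows "ext_deriv (\<lambda>x. k x *\<^sub>R \<eta> x) u v w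
    = fd k u v * (\<eta> u \<bullet> w) - fd k u w * (\<eta> u \<bullet> v) + k u * ext_deriv \<eta> u v w"
  unfolding ext_deriv_def fd_eqI[OF has_derivative_scaleR[OF assms]]
  by (simp add: inner_add_left algebra_simps)

lemma ext_deriv_add:
  assumes "(\<eta> has_derivative fd \<eta> u) (at u)" "(\<theta> has_derivative fd \<theta> u) (at u)"
  shows "ext_deriv (\<lambda>x. \<eta> x + \<theta> x) u v w = ext_deriv \<eta> u v w + ext_deriv \<theta> u v w"
  unfolding ext_deriv_def fd_eqI[OF has_derivative_add[OF assms]]
  by (simp add: inner_add_left)

text \<open>The pointwise algebra behind \<open>ext_deriv_eta\<close>, in frame components. Naming
  the reciprocal of \<open>k\<close> makes it a polynomial identity modulo
  \<open>k * i = 1\<close>.\<close>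

lemma eta_identity:
  fixes k :: real
  assumes k: "k \<noteq> 0"
    and N: "\<And>va vb vc wa wb wc. N va vb vc wa wb wc = va * wa * naa + va * wb * nab + va * wc * nac + vb * wa * nba
       - vb * wc * (lb - la) * k + vc * wa * nca - vc * wb * (lc - la) * k"
    and D: "\<And>va vb vc. D va vb vc = va * da + vb * db + vc * dc"
    and P: "\<And>va vb vc. P va vb vc = va * pa + vb * (db / k + nab - 2 * nba) + vc * (dc / k + nac - 2 * nca)"
  shows "(ea / k * N va vb vc wa wb wc + (N va vb vc ea eb ec / k - ea * D va vb vc / (k * k)) * wa)
    - (ea / k * N wa wb wc va vb vc + (N wa wb wc ea eb ec / k - ea * D wa wb wc / (k * k)) * va)
    = P wa wb wc * (ea / k * va) - P va vb vc * (ea / k * wa)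
      + (- (lb - lc) * (vb * wc - vc * wb) * ea - (lc - la) * (vc * wa - va * wc) * eb - (la - lb) * (va * wb - vb * wa) * ec)"
proof -
  define i where "i = 1 / k"
  have i: "x / k = x * i" "k * i = 1" "x / (k * k) = x * i * i" for x using k by (auto simp: i_def)
  show ?thesis unfolding N D P i(1,3) using i(2) by algebra
qed

section \<open>Moving frames and their dual coframes\<close>

locale dual_frames =
  fixes U :: "(real^3) set" and xi om :: "3 \<Rightarrow> real^3 \<Rightarrow> real^3"
  assumes openU: "open U"
    and smooth_xi: "\<And>\<alpha>. smooth_on U (xi \<alpha>)" and smooth_om: "\<And>\<alpha>. smooth_on U (om \<alpha>)"
    and dual: "\<And>u \<alpha> \<beta>. u \<in> U \<Longrightarrow> om \<alpha> u \<bullet> xi \<beta> u = (if \<alpha> = \<beta> then 1 else 0)"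
begin

abbreviation N :: "3 \<Rightarrow> real^3 \<Rightarrow> real^3 \<Rightarrow> real^3 \<Rightarrow> real" where
  "N \<gamma> u v w \<equiv> fd (om \<gamma>) u v \<bullet> w"

text \<open>Duality says that the coframe matrix times the frame matrix is the identity; the
  expansion is the product in the other order.\<close>

lemma frame_expansion:
  assumes "u \<in> U"
  shows "v = (\<Sum>\<alpha>\<in>UNIV. (om \<alpha> u \<bullet> v) *\<^sub>R xi \<alpha> u)"
proof -
  define A where "A = (\<chi> i. om i u)"
  define B where "B = (\<chi> i j. xi j u $ i)"
  have "A ** B = mat 1"
    using dual[OF assms] by (simp add: A_def B_def matrix_matrix_mult_def mat_def vec_eq_iff inner_vec_def)
  then have BA: "B ** A = mat 1" using matrix_left_right_inverse by blast
  have "v = B *v (A *v v)" by (simp add: matrix_vector_mul_assoc BA)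
  also have "\<dots> = (\<Sum>\<alpha>\<in>UNIV. (om \<alpha> u \<bullet> v) *\<^sub>R xi \<alpha> u)"
    by (simp add: vec_eq_iff matrix_vector_mult_def A_def B_def inner_vec_def mult.commute)
  finally show ?thesis .
qed

lemma inner_expansion:
  assumes "u \<in> U"
  shows "p \<bullet> v = (\<Sum>\<alpha>\<in>UNIV. (om \<alpha> u \<bullet> v) * (p \<bullet> xi \<alpha> u))"
proof -
  have "p \<bullet> v = p \<bullet> (\<Sum>\<alpha>\<in>UNIV. (om \<alpha> u \<bullet> v) *\<^sub>R xi \<alpha> u)" using frame_expansion[OF assms, of v] by simp
  then show ?thesis by (simp add: inner_sum_right)
qed

lemma linear_expansion:
  assumes "u \<in> U" "bounded_linear h"
  shows "h v = (\<Sum>\<alpha>\<in>UNIV. (om \<alpha> u \<bullet> v) *\<^sub>R h (xi \<alpha> u))"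
proof -
  have "h v = h (\<Sum>\<alpha>\<in>UNIV. (om \<alpha> u \<bullet> v) *\<^sub>R xi \<alpha> u)" using frame_expansion[OF assms(1), of v] by simp
  then show ?thesis using bounded_linear.linear[OF assms(2)] by (simp add: linear_sum linear_cmul)
qed

lemma frame_eqI:
  assumes "u \<in> U" "\<And>\<alpha>. om \<alpha> u \<bullet> v = om \<alpha> u \<bullet> w"
  shows "v = w"
  using frame_expansion[OF assms(1), of v] frame_expansion[OF assms(1), of w] assms(2) by simp

lemma coframe_eqI:
  assumes "u \<in> U" "\<And>\<alpha>. p \<bullet> xi \<alpha> u = q \<bullet> xi \<alpha> u"
  shows "p = q"
proof -
  have "(p - q) \<bullet> (p - q) = 0"
    using inner_expansion[OF assms(1), of "p - q" "p - q"] assms(2) by (simp add: inner_diff_left)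
  then show ?thesis by simp
qed

lemma linear_eq_on_frame:
  assumes "u \<in> U" "bounded_linear h" "bounded_linear g" "\<And>\<alpha>. h (xi \<alpha> u) = g (xi \<alpha> u)"
  shows "h v = g v"
  using linear_expansion[OF assms(1,2), of v] linear_expansion[OF assms(1,3), of v] assms(4) by simp

lemma N_expansion:
  assumes "u \<in> U"
  shows "N \<gamma> u v w = (\<Sum>\<alpha>\<in>UNIV. \<Sum>\<beta>\<in>UNIV. (om \<alpha> u \<bullet> v) * (om \<beta> u \<bullet> w) * N \<gamma> u (xi \<alpha> u) (xi \<beta> u))"
proof -
  have "fd (om \<gamma>) u v = (\<Sum>\<alpha>\<in>UNIV. (om \<alpha> u \<bullet> v) *\<^sub>R fd (om \<gamma>) u (xi \<alpha> u))"
    by (rule linear_expansion[OF assms smooth_on_fd_linear[OF smooth_om assms]])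
  then have "N \<gamma> u v w = (\<Sum>\<alpha>\<in>UNIV. (om \<alpha> u \<bullet> v) * N \<gamma> u (xi \<alpha> u) w)"
    by (simp add: inner_sum_left)
  then show ?thesis
    by (subst (asm) inner_expansion[OF assms, of _ w]) (simp add: sum_distrib_left mult.assoc)
qed

text \<open>The pairing of \<open>om \<gamma>\<close> with \<open>xi \<alpha>\<close> is constant,
  so its derivative vanishes.\<close>

lemma N_xi:
  assumes "u \<in> U"
  shows "N \<gamma> u v (xi \<alpha> u) = - (om \<gamma> u \<bullet> fd (xi \<alpha>) u v)"
proof -
  have "((\<lambda>x. om \<gamma> x \<bullet> xi \<alpha> x) has_derivative (\<lambda>v. om \<gamma> u \<bullet> fd (xi \<alpha>) u v + fd (om \<gamma>) u v \<bullet> xi \<alpha> u)) (at u)"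
    by (intro has_derivative_inner smooth_on_has_derivative[OF _ assms] smooth_xi smooth_om)
  moreover have "((\<lambda>x. om \<gamma> x \<bullet> xi \<alpha> x) has_derivative (\<lambda>v. 0)) (at u)"
    by (rule has_derivative_transform_within_open[OF has_derivative_const openU assms])
       (simp add: dual)
  ultimately have "(\<lambda>v. om \<gamma> u \<bullet> fd (xi \<alpha>) u v + fd (om \<gamma>) u v \<bullet> xi \<alpha> u) = (\<lambda>v. 0)"
    by (rule has_derivative_unique)
  then show ?thesis by (metis add_eq_0_iff)
qed

text \<open>Compare the two mixed second derivatives of \<open>F\<close> along \<open>xi \<alpha>\<close> and \<open>xi \<beta>\<close>.\<close>

lemma diagonal_compatibility:
  fixes F :: "real^3 \<Rightarrow> real^3"
  assumes "u \<in> U" and F: "smooth_on U F" and \<sigma>: "smooth_on U (\<sigma> \<gamma>)"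
    and diag: "\<And>x \<alpha> v. x \<in> U \<Longrightarrow> om \<alpha> x \<bullet> fd F x v = \<sigma> \<alpha> x * (om \<alpha> x \<bullet> v)"
    and ne: "\<alpha> \<noteq> \<gamma>" "\<beta> \<noteq> \<gamma>"
  shows "(\<sigma> \<beta> u - \<sigma> \<gamma> u) * N \<gamma> u (xi \<alpha> u) (xi \<beta> u) = (\<sigma> \<alpha> u - \<sigma> \<gamma> u) * N \<gamma> u (xi \<beta> u) (xi \<alpha> u)"
proof -
  have Fxi: "fd F u (xi \<alpha> u) = \<sigma> \<alpha> u *\<^sub>R xi \<alpha> u" for \<alpha>
    by (rule frame_eqI[OF assms(1)]) (simp add: diag[OF assms(1)] dual[OF assms(1)])
  have 1: "N \<gamma> u w (fd F u v) + om \<gamma> u \<bullet> fd (\<lambda>x. fd F x v) u w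
     = fd (\<sigma> \<gamma>) u w * (om \<gamma> u \<bullet> v) + \<sigma> \<gamma> u * N \<gamma> u w v" for v w
  proof -
    have "((\<lambda>x. om \<gamma> x \<bullet> fd F x v) has_derivative
        (\<lambda>w. om \<gamma> u \<bullet> fd (\<lambda>x. fd F x v) u w + N \<gamma> u w (fd F u v))) (at u)"
      by (intro has_derivative_inner smooth_on_has_derivative[OF _ assms(1)] smooth_om smooth_on_fd F)
    moreover have "((\<lambda>x. om \<gamma> x \<bullet> fd F x v) has_derivative
        (\<lambda>w. \<sigma> \<gamma> u * N \<gamma> u w v + fd (\<sigma> \<gamma>) u w * (om \<gamma> u \<bullet> v))) (at u)"
      by (rule has_derivative_transform_within_open[OF has_derivative_mult[OF
              smooth_on_has_derivative[OF \<sigma> assms(1)]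
              has_derivative_inner_left[OF smooth_on_has_derivative[OF smooth_om assms(1)]]] openU assms(1)])
         (simp add: diag)
    ultimately have "(\<lambda>w. om \<gamma> u \<bullet> fd (\<lambda>x. fd F x v) u w + N \<gamma> u w (fd F u v)) =
        (\<lambda>w. \<sigma> \<gamma> u * N \<gamma> u w v + fd (\<sigma> \<gamma>) u w * (om \<gamma> u \<bullet> v))"
      by (rule has_derivative_unique)
    from fun_cong[OF this, of w] show ?thesis by simp
  qed
  show ?thesis
    using 1[of "xi \<alpha> u" "xi \<beta> u"] 1[of "xi \<beta> u" "xi \<alpha> u"] ne
      second_derivative_symmetric[OF openU F assms(1), of "xi \<alpha> u" "xi \<beta> u"]
    by (simp add: Fxi dual[OF assms(1)] algebra_simps)
qed

end

text \<open>The Temple condition and nondiagonalizability enter in pointwise form: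
  \<open>straight\<close> says that the acceleration of a rarefaction curve is tangent to it,
  \<open>nondiag\<close> that the only frame component of \<open>d \<omega>\<close> surviving the
  wedge product with the form itself is nonzero.\<close>

locale temple_system = dual_frames +
  fixes f :: "real^3 \<Rightarrow> real^3" and lam :: "3 \<Rightarrow> real^3 \<Rightarrow> real"
  assumes smooth_f: "smooth_on U f" and smooth_lam: "\<And>\<alpha>. smooth_on U (lam \<alpha>)"
    and lam_distinct: "\<And>u \<alpha> \<beta>. u \<in> U \<Longrightarrow> \<alpha> \<noteq> \<beta> \<Longrightarrow> lam \<alpha> u \<noteq> lam \<beta> u"
    and diag_f: "\<And>u \<alpha> v. u \<in> U \<Longrightarrow> om \<alpha> u \<bullet> fd f u v = lam \<alpha> u * (om \<alpha> u \<bullet> v)"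
    and straight: "\<And>u \<alpha> \<beta>. u \<in> U \<Longrightarrow> \<alpha> \<noteq> \<beta> \<Longrightarrow> om \<beta> u \<bullet> fd (xi \<alpha>) u (xi \<alpha> u) = 0"
    and nondiag: "\<And>u \<alpha> \<beta> \<gamma>. u \<in> U \<Longrightarrow> \<alpha> \<noteq> \<beta> \<Longrightarrow> \<beta> \<noteq> \<gamma> \<Longrightarrow> \<alpha> \<noteq> \<gamma> \<Longrightarrow>
       ext_deriv (om \<gamma>) u (xi \<alpha> u) (xi \<beta> u) \<noteq> 0"
begin

lemma f_xi: "u \<in> U \<Longrightarrow> fd f u (xi \<alpha> u) = lam \<alpha> u *\<^sub>R xi \<alpha> u"
  by (rule frame_eqI) (auto simp: diag_f dual)

lemma N_self: "u \<in> U \<Longrightarrow> \<alpha> \<noteq> \<gamma> \<Longrightarrow> N \<gamma> u (xi \<alpha> u) (xi \<alpha> u) = 0"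
  by (simp add: N_xi straight)

text \<open>Indices are taken modulo 3. Exchanging the two indices other than
  \<open>\<gamma>\<close> changes the signs of numerator and denominator, so the quotient depends on
  \<open>\<gamma>\<close> alone.\<close>

definition kap :: "3 \<Rightarrow> real^3 \<Rightarrow> real" where
  "kap \<gamma> u = - ext_deriv (om \<gamma>) u (xi (\<gamma> + 1) u) (xi (\<gamma> + 2) u) / (lam (\<gamma> + 1) u - lam (\<gamma> + 2) u)"

lemma kap_eq:
  assumes "u \<in> U" "\<alpha> \<noteq> \<beta>" "\<beta> \<noteq> \<gamma>" "\<alpha> \<noteq> \<gamma>"
  shows "kap \<gamma> u = - ext_deriv (om \<gamma>) u (xi \<alpha> u) (xi \<beta> u) / (lam \<alpha> u - lam \<beta> u)"
proof -
  have "(\<alpha> = \<gamma> + 1 \<and> \<beta> = \<gamma> + 2) \<or> (\<beta> = \<gamma> + 1 \<and> \<alpha> = \<gamma> + 2)"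
    using assms(2-4) exhaust_3[of \<alpha>] exhaust_3[of \<beta>] exhaust_3[of \<gamma>] by auto
  moreover have "ext_deriv (om \<gamma>) u (xi \<beta> u) (xi \<alpha> u) = - ext_deriv (om \<gamma>) u (xi \<alpha> u) (xi \<beta> u)"
    by (simp add: ext_deriv_def)
  moreover have "- x / (a - b) = - (- x) / (b - a)" for x a b :: real
    by (metis minus_diff_eq minus_divide_divide)
  ultimately show ?thesis unfolding kap_def by (elim disjE conjE) metis+
qed

lemma kap_nonzero: "u \<in> U \<Longrightarrow> kap \<gamma> u \<noteq> 0"
  using nondiag[of u "\<gamma> + 1" "\<gamma> + 2" \<gamma>] lam_distinct[of u "\<gamma> + 1" "\<gamma> + 2"] exhaust_3[of \<gamma>]
  unfolding kap_def by auto

text \<open>\<open>diagonal_compatibility\<close> for \<open>f\<close> itself makes the two mixed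
  components of the derivative of \<open>om \<gamma>\<close> proportional to
  \<open>lam \<alpha> u - lam \<gamma> u\<close> and \<open>lam \<beta> u - lam \<gamma> u\<close>.
  Their difference is the exterior derivative, which fixes the factor.\<close>

lemma N_kap:
  assumes "u \<in> U" "\<alpha> \<noteq> \<beta>" "\<beta> \<noteq> \<gamma>" "\<alpha> \<noteq> \<gamma>"
  shows "N \<gamma> u (xi \<alpha> u) (xi \<beta> u) = - (lam \<alpha> u - lam \<gamma> u) * kap \<gamma> u"
proof -
  have "(lam \<beta> u - lam \<gamma> u) * N \<gamma> u (xi \<alpha> u) (xi \<beta> u) = (lam \<alpha> u - lam \<gamma> u) * N \<gamma> u (xi \<beta> u) (xi \<alpha> u)"
    using diagonal_compatibility[OF assms(1) smooth_f smooth_lam diag_f] assms by blast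
  then show ?thesis
    using lam_distinct[OF assms(1,2)]
    by (simp add: kap_eq[OF assms] ext_deriv_def field_simps)
qed

lemma smooth_kap: "smooth_on U (kap \<gamma>)"
  unfolding kap_def ext_deriv_def
  using exhaust_3[of \<gamma>]
  by (intro smooth_on_intros smooth_om smooth_xi smooth_lam openU) (auto simp: lam_distinct)

text \<open>\<open>eta \<alpha> e\<close> and \<open>rho e\<close> are the contractions of the covector-valued forms \<open>E\<^sub>\<alpha>\<close> and \<open>R\<close> with a
  constant vector \<open>e\<close>, and \<open>pcoef \<alpha> \<beta>\<close> is \<open>\<phi>\<^sub>\<alpha>(\<xi>\<^sub>\<beta>)\<close> for \<open>\<alpha> \<noteq> \<beta>\<close>; the component \<open>\<phi>\<^sub>\<alpha>(\<xi>\<^sub>\<alpha>)\<close> drops out of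
  \<open>\<phi>\<^sub>\<alpha> \<and> E\<^sub>\<alpha>\<close>.\<close>

definition eta :: "3 \<Rightarrow> real^3 \<Rightarrow> real^3 \<Rightarrow> real^3" where
  "eta \<alpha> e u = ((om \<alpha> u \<bullet> e) / kap \<alpha> u) *\<^sub>R om \<alpha> u"

lemma smooth_eta: "smooth_on U (eta \<alpha> e)"
  unfolding eta_def by (intro smooth_on_intros smooth_om smooth_kap openU kap_nonzero)

definition rho :: "real^3 \<Rightarrow> real^3 \<Rightarrow> real^3 \<Rightarrow> real^3 \<Rightarrow> real" where
  "rho e u v w = - (lam 2 u - lam 3 u) * ((om 2 u \<bullet> v) * (om 3 u \<bullet> w) - (om 3 u \<bullet> v) * (om 2 u \<bullet> w)) * (om 1 u \<bullet> e)
    - (lam 3 u - lam 1 u) * ((om 3 u \<bullet> v) * (om 1 u \<bullet> w) - (om 1 u \<bullet> v) * (om 3 u \<bullet> w)) * (om 2 u \<bullet> e)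
    - (lam 1 u - lam 2 u) * ((om 1 u \<bullet> v) * (om 2 u \<bullet> w) - (om 2 u \<bullet> v) * (om 1 u \<bullet> w)) * (om 3 u \<bullet> e)"

text \<open>Exchanging two indices changes the sign of a speed difference and of the wedge product
  that it multiplies. Hence \<open>rho\<close> does not depend on the labelling and can serve all
  three \<open>eta\<close> at once.\<close>

lemma rho_eq:
  assumes "\<alpha> \<noteq> \<beta>" "\<beta> \<noteq> \<gamma>" "\<alpha> \<noteq> \<gamma>"
  shows "rho e u v w = - (lam \<beta> u - lam \<gamma> u) * ((om \<beta> u \<bullet> v) * (om \<gamma> u \<bullet> w) - (om \<gamma> u \<bullet> v) * (om \<beta> u \<bullet> w)) * (om \<alpha> u \<bullet> e)
    - (lam \<gamma> u - lam \<alpha> u) * ((om \<gamma> u \<bullet> v) * (om \<alpha> u \<bullet> w) - (om \<alpha> u \<bullet> v) * (om \<gamma> u \<bullet> w)) * (om \<beta> u \<bullet> e)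
    - (lam \<alpha> u - lam \<beta> u) * ((om \<alpha> u \<bullet> v) * (om \<beta> u \<bullet> w) - (om \<beta> u \<bullet> v) * (om \<alpha> u \<bullet> w)) * (om \<gamma> u \<bullet> e)"
  using exhaust_3[of \<alpha>] exhaust_3[of \<beta>] exhaust_3[of \<gamma>] assms
  unfolding rho_def by (elim disjE) (simp_all add: algebra_simps)

lemma smooth_rho: "smooth_on U (\<lambda>u. rho e u v w)"
  unfolding rho_def by (intro smooth_on_intros smooth_om smooth_lam openU)

definition pcoef :: "3 \<Rightarrow> 3 \<Rightarrow> real^3 \<Rightarrow> real" where
  "pcoef \<alpha> \<beta> u = fd (kap \<alpha>) u (xi \<beta> u) / kap \<alpha> u + N \<alpha> u (xi \<alpha> u) (xi \<beta> u) - 2 * N \<alpha> u (xi \<beta> u) (xi \<alpha> u)"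

lemma smooth_pcoef: "smooth_on U (pcoef \<alpha> \<beta>)"
  unfolding pcoef_def by (intro smooth_on_intros smooth_om smooth_xi smooth_kap openU kap_nonzero)

text \<open>Only two components of \<open>p\<close> are prescribed: \<open>eta \<alpha> e\<close> is
  a multiple of \<open>om \<alpha>\<close>, so the third one cancels. In frame components the claim
  becomes \<open>eta_identity\<close>.\<close>

lemma ext_deriv_eta:
  assumes u: "u \<in> U" and d: "\<alpha> \<noteq> \<beta>" "\<beta> \<noteq> \<gamma>" "\<alpha> \<noteq> \<gamma>"
    and p: "p \<bullet> xi \<beta> u = pcoef \<alpha> \<beta> u" "p \<bullet> xi \<gamma> u = pcoef \<alpha> \<gamma> u"
  shows "ext_deriv (eta \<alpha> e) u v w = (p \<bullet> w) * (eta \<alpha> e u \<bullet> v) - (p \<bullet> v) * (eta \<alpha> e u \<bullet> w) + rho e u v w"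
proof -
  let ?k = "kap \<alpha> u" and ?dk = "fd (kap \<alpha>) u" and ?w = "om \<alpha> u" and ?dw = "fd (om \<alpha>) u"
  have k: "?k \<noteq> 0" by (rule kap_nonzero[OF u])
  have do: "(om \<alpha> has_derivative ?dw) (at u)" by (rule smooth_on_has_derivative[OF smooth_om u])
  have dk: "(kap \<alpha> has_derivative ?dk) (at u)" by (rule smooth_on_has_derivative[OF smooth_kap u])
  have de: "fd (eta \<alpha> e) u v = ((?w \<bullet> e) / ?k) *\<^sub>R ?dw v
      + ((?dw v \<bullet> e) / ?k - (?w \<bullet> e) * ?dk v / (?k * ?k)) *\<^sub>R ?w" for v
    unfolding eta_def
    by (subst fd_eqI[OF has_derivative_scaleR[OF has_derivative_divide[OF has_derivative_inner_left[OF do] dk k] do]])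
       (use k in \<open>simp add: field_simps\<close>)
  define D where "D = (\<lambda>va vb vc. va * ?dk (xi \<alpha> u) + vb * ?dk (xi \<beta> u) + vc * ?dk (xi \<gamma> u))"
  have D: "?dk v = D (om \<alpha> u \<bullet> v) (om \<beta> u \<bullet> v) (om \<gamma> u \<bullet> v)" for v
    using linear_expansion[OF u smooth_on_fd_linear[OF smooth_kap u], of \<alpha> v]
    by (simp add: sum_3_distinct[OF d] D_def)
  define P where "P = (\<lambda>va vb vc. va * (p \<bullet> xi \<alpha> u) + vb * pcoef \<alpha> \<beta> u + vc * pcoef \<alpha> \<gamma> u)"
  have P: "p \<bullet> v = P (om \<alpha> u \<bullet> v) (om \<beta> u \<bullet> v) (om \<gamma> u \<bullet> v)" for v
    using inner_expansion[OF u, of p v] by (simp add: sum_3_distinct[OF d] p P_def)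
  \<comment> \<open>Straightness removes the terms \<open>vb * wb\<close> and
    \<open>vc * wc\<close>, and \<open>N_kap\<close> evaluates those in \<open>vb * wc\<close> and
    \<open>vc * wb\<close>.\<close>
  define M where "M = (\<lambda>va vb vc wa wb wc. va * wa * N \<alpha> u (xi \<alpha> u) (xi \<alpha> u)
      + va * wb * N \<alpha> u (xi \<alpha> u) (xi \<beta> u) + va * wc * N \<alpha> u (xi \<alpha> u) (xi \<gamma> u)
      + vb * wa * N \<alpha> u (xi \<beta> u) (xi \<alpha> u) - vb * wc * (lam \<beta> u - lam \<alpha> u) * ?k
      + vc * wa * N \<alpha> u (xi \<gamma> u) (xi \<alpha> u) - vc * wb * (lam \<gamma> u - lam \<alpha> u) * ?k)"
  have M: "?dw v \<bullet> w = M (om \<alpha> u \<bullet> v) (om \<beta> u \<bullet> v) (om \<gamma> u \<bullet> v)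
      (om \<alpha> u \<bullet> w) (om \<beta> u \<bullet> w) (om \<gamma> u \<bullet> w)" for v w
    using d by (subst N_expansion[OF u])
      (simp add: M_def sum_3_distinct[OF d] N_self[OF u] N_kap[OF u] algebra_simps)
  show ?thesis
    unfolding ext_deriv_def de rho_eq[OF d] inner_add_left inner_scaleR_left eta_def
    unfolding M P D
    by (rule eta_identity[OF k, where naa = "N \<alpha> u (xi \<alpha> u) (xi \<alpha> u)" and da = "?dk (xi \<alpha> u)"])
       (simp_all add: M_def D_def P_def pcoef_def)
qed

end

lemma ex_third_3: "a \<noteq> b \<Longrightarrow> \<exists>c::3. b \<noteq> c \<and> a \<noteq> c"
proof -
  have "\<exists>c::3. c \<notin> {a, b}"
    using card_mono[of "{a, b}" "UNIV :: 3 set"] card_insert_le_m1[of 2 "{b}" a] by fastforce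
  then show ?thesis by auto
qed

lemma ex_distinct_3: "\<exists>b c::3. a \<noteq> b \<and> b \<noteq> c \<and> a \<noteq> c"
proof -
  have "\<exists>b::3. a \<noteq> b" by (metis one_neq_zero)
  then show ?thesis using ex_third_3 by blast
qed

section \<open>The common closed form \<open>phi\<close>\<close>

context temple_system
begin

text \<open>Take \<open>e = xi \<gamma> u\<close>, frozen at \<open>u\<close>. For
  \<open>a \<noteq> \<gamma>\<close> the form \<open>eta a e\<close> vanishes at \<open>u\<close>,
  so \<open>ext_deriv_structure\<close> leaves
  \<open>pcoef a \<gamma> u * (lam \<alpha> u - lam \<beta> u) = T\<close>, with \<open>T\<close>
  built from \<open>rho\<close> and independent of \<open>a\<close>.\<close>

lemma pcoef_consistent:
  assumes u: "u \<in> U" and d: "\<alpha> \<noteq> \<beta>" "\<beta> \<noteq> \<gamma>" "\<alpha> \<noteq> \<gamma>"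
  shows "pcoef \<alpha> \<gamma> u = pcoef \<beta> \<gamma> u"
proof -
  define e where "e = xi \<gamma> u"
  define T where "T = fd (\<lambda>x. rho e x (xi \<beta> u) (xi \<gamma> u)) u (xi \<alpha> u) + fd (\<lambda>x. rho e x (xi \<gamma> u) (xi \<alpha> u)) u (xi \<beta> u)
    + fd (\<lambda>x. rho e x (xi \<alpha> u) (xi \<beta> u)) u (xi \<gamma> u)"
  have "pcoef a \<gamma> u * (lam \<alpha> u - lam \<beta> u) = T" if a: "a \<noteq> \<gamma>" for a
  proof -
    \<comment> \<open>A smooth form with the two components required by
      \<open>ext_deriv_eta\<close>; the one along \<open>om a\<close> may be chosen freely and is
      set to \<open>pcoef a a\<close>.\<close>
    define \<phi> where "\<phi> = (\<lambda>x. \<Sum>\<delta>\<in>UNIV. pcoef a \<delta> x *\<^sub>R om \<delta> x)"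
    have sm: "smooth_on U \<phi>"
      unfolding \<phi>_def by (intro smooth_on_intros smooth_pcoef smooth_om openU)
    have \<phi>: "\<phi> x \<bullet> xi \<delta> x = pcoef a \<delta> x" if "x \<in> U" for x \<delta>
      by (simp add: \<phi>_def inner_sum_left dual[OF that] if_distrib cong: if_cong)
    have "ext_deriv (eta a e) x v w = (\<phi> x \<bullet> w) * (eta a e x \<bullet> v) - (\<phi> x \<bullet> v) * (eta a e x \<bullet> w) + rho e x v w"
      if "x \<in> U" for x v w
    proof -
      obtain b c where "a \<noteq> b" "b \<noteq> c" "a \<noteq> c"
        using ex_distinct_3 by blast
      from ext_deriv_eta[OF that this \<phi>[OF that] \<phi>[OF that]] show ?thesis .
    qed
    from ext_deriv_structure[OF openU u smooth_eta sm smooth_rho this, of "xi \<alpha> u" "xi \<beta> u" "xi \<gamma> u"]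
    have "(\<phi> u \<bullet> xi \<gamma> u) * rho e u (xi \<alpha> u) (xi \<beta> u) + T = 0"
      using a d by (simp add: e_def eta_def T_def rho_eq[OF d] dual[OF u])
    then show ?thesis using d by (simp add: \<phi>[OF u] rho_eq[OF d] e_def dual[OF u] algebra_simps)
  qed
  from this[of \<alpha>] this[of \<beta>] d have "pcoef \<alpha> \<gamma> u * (lam \<alpha> u - lam \<beta> u) = pcoef \<beta> \<gamma> u * (lam \<alpha> u - lam \<beta> u)"
    by simp
  then show ?thesis using lam_distinct[OF u d(1)] by simp
qed

text \<open>By \<open>pcoef_consistent\<close> the first index of each coefficient may be either of
  the two indices different from the second.\<close>

definition phi :: "real^3 \<Rightarrow> real^3" where
  "phi u = pcoef 2 1 u *\<^sub>R om 1 u + pcoef 3 2 u *\<^sub>R om 2 u + pcoef 1 3 u *\<^sub>R om 3 u"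

lemma smooth_phi: "smooth_on U phi"
  unfolding phi_def by (intro smooth_on_intros smooth_pcoef smooth_om openU)

lemma phi_xi:
  assumes u: "u \<in> U" and d: "\<alpha> \<noteq> \<beta>"
  shows "phi u \<bullet> xi \<beta> u = pcoef \<alpha> \<beta> u"
proof -
  have "pcoef 2 1 u = pcoef 3 1 u" "pcoef 3 2 u = pcoef 1 2 u" "pcoef 1 3 u = pcoef 2 3 u"
    by (rule pcoef_consistent[OF u]; simp)+
  then show ?thesis
    using d exhaust_3[of \<alpha>] exhaust_3[of \<beta>] by (auto simp: phi_def inner_add_left dual[OF u])
qed

lemma ext_deriv_eta_phi:
  assumes "u \<in> U"
  shows "ext_deriv (eta \<alpha> e) u v w = (phi u \<bullet> w) * (eta \<alpha> e u \<bullet> v) - (phi u \<bullet> v) * (eta \<alpha> e u \<bullet> w) + rho e u v w"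
proof -
  obtain b c where d: "\<alpha> \<noteq> b" "b \<noteq> c" "\<alpha> \<noteq> c"
    using ex_distinct_3 by blast
  show ?thesis using ext_deriv_eta[OF assms d phi_xi[OF assms d(1)] phi_xi[OF assms d(3)]] .
qed

text \<open>The right-hand side of \<open>ext_deriv_structure\<close> is the same for every
  \<open>eta a e\<close>. With \<open>e = xi \<gamma> u\<close> the left-hand side is 0 for
  \<open>a = \<alpha>\<close>, and for \<open>a = \<gamma>\<close> it is the component of the
  exterior derivative of \<open>phi\<close> on \<open>xi \<alpha>\<close>,
  \<open>xi \<beta>\<close>, divided by \<open>kap \<gamma> u\<close>.\<close>

lemma phi_closed:
  assumes u: "u \<in> U"
  shows "fd phi u v \<bullet> w = fd phi u w \<bullet> v"
proof -
  have zero: "ext_deriv phi u (xi \<alpha> u) (xi \<beta> u) = 0" if ab: "\<alpha> \<noteq> \<beta>" for \<alpha> \<beta>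
  proof -
    obtain \<gamma> where d: "\<alpha> \<noteq> \<beta>" "\<beta> \<noteq> \<gamma>" "\<alpha> \<noteq> \<gamma>"
      using ab ex_third_3 by blast
    let ?v = "xi \<alpha> u" and ?w = "xi \<beta> u" and ?e = "xi \<gamma> u"
    have *: "ext_deriv phi u ?v ?w * (eta a ?e u \<bullet> ?e) + ext_deriv phi u ?w ?e * (eta a ?e u \<bullet> ?v)
        + ext_deriv phi u ?e ?v * (eta a ?e u \<bullet> ?w)
      = (phi u \<bullet> ?v) * rho ?e u ?w ?e + (phi u \<bullet> ?w) * rho ?e u ?e ?v + (phi u \<bullet> ?e) * rho ?e u ?v ?w
        + fd (\<lambda>x. rho ?e x ?w ?e) u ?v + fd (\<lambda>x. rho ?e x ?e ?v) u ?w + fd (\<lambda>x. rho ?e x ?v ?w) u ?e" for a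
      by (rule ext_deriv_structure[OF openU u smooth_eta smooth_phi smooth_rho ext_deriv_eta_phi])
    have "ext_deriv phi u (xi \<alpha> u) (xi \<beta> u) * (eta \<gamma> (xi \<gamma> u) u \<bullet> xi \<gamma> u) = 0"
      using *[of \<gamma>] *[of \<alpha>] d by (simp add: eta_def dual[OF u])
    then show ?thesis using kap_nonzero[OF u] by (simp add: eta_def dual[OF u])
  qed
  have sym: "fd phi u (xi \<alpha> u) \<bullet> xi \<beta> u = fd phi u (xi \<beta> u) \<bullet> xi \<alpha> u" for \<alpha> \<beta>
    using zero[of \<alpha> \<beta>] by (cases "\<alpha> = \<beta>") (auto simp: ext_deriv_def)
  have bl: "bounded_linear (\<lambda>v. fd phi u v \<bullet> w)" for w
    using bounded_linear_compose[OF bounded_linear_inner_left smooth_on_fd_linear[OF smooth_phi u]] by simp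
  have "fd phi u (xi \<alpha> u) \<bullet> w = fd phi u w \<bullet> xi \<alpha> u" for \<alpha> w
    by (rule linear_eq_on_frame[OF u bounded_linear_inner_right bl]) (rule sym)
  then show ?thesis
    by (intro linear_eq_on_frame[OF u bl bounded_linear_inner_right, of w "fd phi u w" v]) simp
qed

text \<open>If \<open>k\<close> solves \<open>d k = k * phi\<close>, only \<open>k * rho\<close>
  remains, which is the same for every \<open>\<alpha>\<close>. This is why differences of rescaled
  \<open>eta\<close> are closed.\<close>

lemma ext_deriv_k_eta:
  assumes u: "u \<in> U" and k: "smooth_on U k"
  shows "ext_deriv (\<lambda>x. k x *\<^sub>R eta \<alpha> e x) u v w
    = (fd k u v - k u * (phi u \<bullet> v)) * (eta \<alpha> e u \<bullet> w) - (fd k u w - k u * (phi u \<bullet> w)) * (eta \<alpha> e u \<bullet> v)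
      + k u * rho e u v w"
  unfolding ext_deriv_scaleR[OF smooth_on_has_derivative[OF k u] smooth_on_has_derivative[OF smooth_eta u]]
    ext_deriv_eta_phi[OF u]
  by (simp add: algebra_simps)

end

section \<open>Potentials\<close>

lemma has_derivative_inner_Basis_sum:
  fixes p :: "'a::euclidean_space \<Rightarrow> 'a \<Rightarrow> real"
  assumes "\<And>b. b \<in> Basis \<Longrightarrow> (p b has_derivative p' b) F"
  shows "((\<lambda>u. \<Sum>b\<in>Basis. p b u *\<^sub>R b) has_derivative (\<lambda>v. \<Sum>b\<in>Basis. p' b v *\<^sub>R b)) F"
  using assms by (intro has_derivative_sum has_derivative_scaleR_left) auto

text \<open>Each contraction of \<open>H\<close> with a basis vector is a closed form. The
  potentials of these forms are the coordinates of \<open>P\<close>, and symmetry identifies the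
  derivative of \<open>P\<close> with \<open>H\<close>.\<close>

lemma hessian_exact:
  fixes H :: "real^3 \<Rightarrow> real^3 \<Rightarrow> real^3"
  assumes smooth: "\<And>e. smooth_on (ball c r) (\<lambda>u. H u e)"
    and closed: "\<And>e u v w. u \<in> ball c r \<Longrightarrow> ext_deriv (\<lambda>u. H u e) u v w = 0"
    and sym: "\<And>u v w. u \<in> ball c r \<Longrightarrow> H u v \<bullet> w = H u w \<bullet> v"
  shows "\<exists>P. smooth_on (ball c r) P \<and> (\<forall>u\<in>ball c r. (P has_derivative H u) (at u))"
proof -
  have "\<exists>p. \<forall>u\<in>ball c r. (p has_derivative (\<lambda>v. H u e \<bullet> v)) (at u)" for e
    using closed_one_form_exact[OF smooth, of e] closed[of _ e] by (auto simp: ext_deriv_def simp del: mem_ball)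
  then obtain p where p: "\<And>e u. u \<in> ball c r \<Longrightarrow> (p e has_derivative (\<lambda>v. H u e \<bullet> v)) (at u)"
    by metis
  define P where "P = (\<lambda>u. \<Sum>b\<in>Basis. p b u *\<^sub>R b)"
  have dP: "(P has_derivative H u) (at u)" if u: "u \<in> ball c r" for u
  proof -
    have "(P has_derivative (\<lambda>v. \<Sum>b\<in>Basis. (H u b \<bullet> v) *\<^sub>R b)) (at u)"
      unfolding P_def by (rule has_derivative_inner_Basis_sum[OF p[OF u]])
    moreover have "(\<Sum>b\<in>Basis. (H u b \<bullet> v) *\<^sub>R b) = H u v" for v
      using euclidean_representation[of "H u v"] by (simp add: sym[OF u, of _ v])
    ultimately show ?thesis by simp
  qed
  have "smooth_on (ball c r) P" by (rule smooth_onI[OF open_ball dP smooth])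
  then show ?thesis using dP by blast
qed

text \<open>In the exterior derivative of the form \<open>P \<bullet> fd f\<close> the second
  derivatives of \<open>f\<close> cancel by symmetry, and the remaining terms cancel by
  \<open>sym\<close>.\<close>

lemma flux_exact:
  fixes P f :: "real^3 \<Rightarrow> real^3"
  assumes P: "smooth_on (ball c r) P" and f: "smooth_on (ball c r) f"
    and sym: "\<And>u v w. u \<in> ball c r \<Longrightarrow> fd P u v \<bullet> fd f u w = fd P u w \<bullet> fd f u v"
  shows "\<exists>A. smooth_on (ball c r) A \<and> (\<forall>u\<in>ball c r. (A has_derivative (\<lambda>v. P u \<bullet> fd f u v)) (at u))"
proof -
  define G where "G = (\<lambda>u. \<Sum>b\<in>Basis. (P u \<bullet> fd f u b) *\<^sub>R b)"
  have G: "G u \<bullet> v = P u \<bullet> fd f u v" if "u \<in> ball c r" for u v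
  proof -
    have "P u \<bullet> fd f u v = (\<Sum>b\<in>Basis. (v \<bullet> b) * (P u \<bullet> fd f u b))"
      by (subst has_derivative_sum_Basis[OF smooth_on_has_derivative[OF f that], of v]) (simp add: inner_sum_right)
    then show ?thesis by (simp add: G_def inner_sum_right inner_commute[of _ v] mult.commute)
  qed
  have smG: "smooth_on (ball c r) G" unfolding G_def by (intro smooth_on_intros open_ball P f)
  have "fd G u v \<bullet> w = fd G u w \<bullet> v" if u: "u \<in> ball c r" for u v w
  proof -
    have dG: "fd G u v \<bullet> w = P u \<bullet> fd (\<lambda>x. fd f x w) u v + fd P u v \<bullet> fd f u w" for v w
    proof -
      have "((\<lambda>x. P x \<bullet> fd f x w) has_derivative (\<lambda>v. P u \<bullet> fd (\<lambda>x. fd f x w) u v + fd P u v \<bullet> fd f u w)) (at u)"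
        by (intro has_derivative_inner smooth_on_has_derivative[OF _ u] P smooth_on_fd f)
      then have "((\<lambda>x. G x \<bullet> w) has_derivative (\<lambda>v. P u \<bullet> fd (\<lambda>x. fd f x w) u v + fd P u v \<bullet> fd f u w)) (at u)"
        by (rule has_derivative_transform_within_open[OF _ open_ball u]) (simp only: G)
      from has_derivative_unique[OF has_derivative_inner_left[OF smooth_on_has_derivative[OF smG u]] this]
      show ?thesis by (rule fun_cong)
    qed
    show ?thesis
      unfolding dG using second_derivative_symmetric[OF open_ball f u, of v w] sym[OF u, of v w] by simp
  qed
  from closed_one_form_exact[OF smG this] obtain A where
    A: "smooth_on (ball c r) A" "\<And>u. u \<in> ball c r \<Longrightarrow> (A has_derivative (\<lambda>v. G u \<bullet> v)) (at u)" by blast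
  have "(A has_derivative (\<lambda>v. P u \<bullet> fd f u v)) (at u)" if "u \<in> ball c r" for u
    using A(2)[OF that] by (simp add: G[OF that])
  with A(1) show ?thesis by blast
qed

text \<open>\<open>P\<close> and \<open>Q\<close> are the gradients of the additional densities
  \<open>B\<close> and \<open>N'\<close>, with fluxes \<open>A\<close> and \<open>M\<close>;
  \<open>\<psi>\<close> is the integrating factor that makes the Hessians closed.\<close>

locale temple_potentials = temple_system +
  fixes \<psi> :: "real^3 \<Rightarrow> real" and P Q :: "real^3 \<Rightarrow> real^3" and B A N' M :: "real^3 \<Rightarrow> real"
  assumes convU: "convex U" and neU: "U \<noteq> {}"
    and smooth_psi: "smooth_on U \<psi>" and psi_pos: "\<And>u. \<psi> u > 0"
    and fd_psi: "\<And>u v. u \<in> U \<Longrightarrow> fd \<psi> u v = \<psi> u * (phi u \<bullet> v)"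
    and smooth_PQ: "smooth_on U P" "smooth_on U Q"
    and smooth_BN: "smooth_on U B" "smooth_on U A" "smooth_on U N'" "smooth_on U M"
    and fd_P: "\<And>u v. u \<in> U \<Longrightarrow> fd P u v = \<psi> u *\<^sub>R (eta 2 v u - eta 3 v u)"
    and fd_Q: "\<And>u v. u \<in> U \<Longrightarrow> fd Q u v = \<psi> u *\<^sub>R (eta 3 v u - eta 1 v u)"
    and fd_B: "\<And>u v. u \<in> U \<Longrightarrow> fd B u v = P u \<bullet> v"
    and fd_A: "\<And>u v. u \<in> U \<Longrightarrow> fd A u v = P u \<bullet> fd f u v"
    and fd_N: "\<And>u v. u \<in> U \<Longrightarrow> fd N' u v = Q u \<bullet> v"
    and fd_M: "\<And>u v. u \<in> U \<Longrightarrow> fd M u v = Q u \<bullet> fd f u v"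

context temple_system
begin

lemma eta_sym: "eta \<alpha> v u \<bullet> w = eta \<alpha> w u \<bullet> v"
  by (simp add: eta_def)

lemma eta_fd_f_sym: "u \<in> U \<Longrightarrow> eta \<alpha> v u \<bullet> fd f u w = eta \<alpha> w u \<bullet> fd f u v"
  by (simp add: eta_def diag_f)

text \<open>In the difference the two copies of \<open>\<psi> * rho\<close> cancel, so the Hessian
  is closed and integrates to \<open>P\<close> and then to \<open>B\<close>. It is diagonal in the
  frame, as is the derivative of \<open>f\<close>; this is the symmetry required for the flux
  \<open>A\<close>.\<close>

lemma potentials_pair:
  assumes U: "U = ball c r" and \<psi>: "smooth_on U \<psi>"
    and d\<psi>: "\<And>u v. u \<in> U \<Longrightarrow> fd \<psi> u v = \<psi> u * (phi u \<bullet> v)"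
  shows "\<exists>P B A. smooth_on U P \<and> smooth_on U B \<and> smooth_on U A \<and>
    (\<forall>u\<in>U. \<forall>v. fd P u v = \<psi> u *\<^sub>R (eta \<alpha> v u - eta \<beta> v u) \<and> fd B u v = P u \<bullet> v \<and> fd A u v = P u \<bullet> fd f u v)"
proof -
  define H where "H = (\<lambda>u v. \<psi> u *\<^sub>R (eta \<alpha> v u - eta \<beta> v u))"
  have H: "(\<lambda>u. H u e) = (\<lambda>u. \<psi> u *\<^sub>R eta \<alpha> e u + (- \<psi> u) *\<^sub>R eta \<beta> e u)" for e
    by (simp add: H_def scaleR_diff_right)
  have m\<psi>: "smooth_on U (\<lambda>u. - \<psi> u)" by (rule smooth_on_minus[OF openU \<psi>])
  have smH: "smooth_on U (\<lambda>u. H u e)" for e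
    unfolding H by (intro smooth_on_intros smooth_eta \<psi> m\<psi> openU)
  have d\<psi>': "fd (\<lambda>u. - \<psi> u) u v = - (\<psi> u * (phi u \<bullet> v))" if "u \<in> U" for u v
    using fd_eqI[OF has_derivative_minus[OF smooth_on_has_derivative[OF \<psi> that]]] d\<psi>[OF that] by simp
  have closed: "ext_deriv (\<lambda>u. H u e) u v w = 0" if u: "u \<in> U" for e u v w
  proof -
    have "smooth_on U (\<lambda>u. \<psi> u *\<^sub>R eta \<alpha> e u)" "smooth_on U (\<lambda>u. (- \<psi> u) *\<^sub>R eta \<beta> e u)"
      by (intro smooth_on_scaleR smooth_eta \<psi> m\<psi> openU)+
    from ext_deriv_add[OF this[THEN smooth_on_has_derivative, OF u]]
    show ?thesis unfolding H
      by (simp only: ext_deriv_k_eta[OF u \<psi>] ext_deriv_k_eta[OF u m\<psi>] d\<psi>[OF u] d\<psi>'[OF u]) simp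
  qed
  have sym: "H u v \<bullet> w = H u w \<bullet> v" for u v w
    by (simp add: H_def inner_diff_left eta_sym[of _ v _ w])
  obtain P where P: "smooth_on U P" "\<And>u. u \<in> U \<Longrightarrow> (P has_derivative H u) (at u)"
    using hessian_exact[of c r H] smH closed sym unfolding U by blast
  have dP: "fd P u v = H u v" if "u \<in> U" for u v by (rule fd_eqI[OF P(2)[OF that]])
  obtain B where B: "smooth_on U B" "\<And>u. u \<in> U \<Longrightarrow> (B has_derivative (\<lambda>v. P u \<bullet> v)) (at u)"
    using closed_one_form_exact[of c r P] P(1) dP sym unfolding U by metis
  have symf: "fd P u v \<bullet> fd f u w = fd P u w \<bullet> fd f u v" if "u \<in> U" for u v w
    unfolding dP[OF that] by (simp add: H_def inner_diff_left eta_fd_f_sym[OF that, of _ v w])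
  obtain A where A: "smooth_on U A" "\<And>u. u \<in> U \<Longrightarrow> (A has_derivative (\<lambda>v. P u \<bullet> fd f u v)) (at u)"
    using flux_exact[of c r P f] P(1) smooth_f symf unfolding U by blast
  show ?thesis
    using P(1) B(1) A(1) dP fd_eqI[OF B(2)] fd_eqI[OF A(2)] unfolding H_def by blast
qed

text \<open>On a ball the closed form \<open>phi\<close> has a potential, whose exponential is the
  positive integrating factor.\<close>

lemma potentials_exist:
  assumes U: "U = ball c r" and r: "0 < r"
  shows "\<exists>\<psi> P Q B A N' M. temple_potentials U xi om f lam \<psi> P Q B A N' M"
proof -
  obtain \<Phi> where \<Phi>: "smooth_on U \<Phi>" "\<And>u. u \<in> U \<Longrightarrow> (\<Phi> has_derivative (\<lambda>v. phi u \<bullet> v)) (at u)"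
    using closed_one_form_exact[of c r phi] smooth_phi phi_closed unfolding U by blast
  define \<psi> where "\<psi> = (\<lambda>u. exp (\<Phi> u))"
  have \<psi>: "smooth_on U \<psi>" unfolding \<psi>_def by (intro smooth_on_intros \<Phi>(1) openU)
  have d\<psi>: "fd \<psi> u v = \<psi> u * (phi u \<bullet> v)" if "u \<in> U" for u v
    unfolding \<psi>_def using fd_eqI[OF has_derivative_exp[OF \<Phi>(2)[OF that]]] by (simp add: mult.commute)
  from potentials_pair[OF U \<psi> d\<psi>, of 2 3] obtain P B A where
    1: "smooth_on U P" "smooth_on U B" "smooth_on U A"
      "\<And>u v. u \<in> U \<Longrightarrow> fd P u v = \<psi> u *\<^sub>R (eta 2 v u - eta 3 v u) \<and> fd B u v = P u \<bullet> v \<and> fd A u v = P u \<bullet> fd f u v"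
    by blast
  from potentials_pair[OF U \<psi> d\<psi>, of 3 1] obtain Q N' M where
    2: "smooth_on U Q" "smooth_on U N'" "smooth_on U M"
      "\<And>u v. u \<in> U \<Longrightarrow> fd Q u v = \<psi> u *\<^sub>R (eta 3 v u - eta 1 v u) \<and> fd N' u v = Q u \<bullet> v \<and> fd M u v = Q u \<bullet> fd f u v"
    by blast
  have "temple_potentials U xi om f lam \<psi> P Q B A N' M"
    by unfold_locales (use 1 2 \<psi> d\<psi> U r in \<open>auto simp: \<psi>_def simp del: mem_ball\<close>)
  then show ?thesis by blast
qed

end

section \<open>Conservation laws of the Temple system\<close>

lemma exhaust_5:
  fixes x :: 5
  shows "x = 1 \<or> x = 2 \<or> x = 3 \<or> x = 4 \<or> x = 5"
proof (induct x)
  case (of_int z)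
  then have "z = 0 \<or> z = 1 \<or> z = 2 \<or> z = 3 \<or> z = 4" by fastforce
  then show ?case by auto
qed

lemma UNIV_5: "UNIV = {1, 2, 3, 4, 5::5}"
  using exhaust_5 by auto

lemma sum_5: "sum f (UNIV::5 set) = f 1 + f 2 + f 3 + f 4 + f 5"
  unfolding UNIV_5 by (simp add: ac_simps)

definition emb5 :: "real^3 \<Rightarrow> real \<Rightarrow> real \<Rightarrow> real^5" where
  "emb5 x y z = (\<chi> j. if j = 1 then x $ 1 else if j = 2 then x $ 2 else if j = 3 then x $ 3 else if j = 4 then y else z)"

lemma emb5_inner: "emb5 x y z \<bullet> emb5 x' y' z' = x \<bullet> x' + y * y' + z * z'"
  by (simp add: inner_vec_def emb5_def sum_5 sum_3)

lemma emb5_cases: obtains x y z where "v = emb5 x y z"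
proof
  show "v = emb5 (vector [v $ 1, v $ 2, v $ 3]) (v $ 4) (v $ 5)"
    unfolding vec_eq_iff emb5_def
  proof
    fix i :: 5
    show "v $ i = (\<chi> j. if j = 1 then vector [v $ 1, v $ 2, v $ 3] $ (1::3)
       else if j = 2 then vector [v $ 1, v $ 2, v $ 3] $ (2::3)
       else if j = 3 then vector [v $ 1, v $ 2, v $ 3] $ (3::3) else if j = 4 then v $ 4 else v $ 5) $ i"
      using exhaust_5[of i] by auto
  qed
qed

lemma emb5_scaleR: "emb5 (k *\<^sub>R x) (k * y) (k * z) = k *\<^sub>R emb5 x y z"
  by (simp add: emb5_def vec_eq_iff)

lemma emb5_add: "emb5 (x + x') (y + y') (z + z') = emb5 x y z + emb5 x' y' z'"
  by (simp add: emb5_def vec_eq_iff)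

lemma emb5_zero [simp]: "emb5 0 0 0 = 0"
  by (simp add: emb5_def vec_eq_iff)

lemma emb5_uminus: "emb5 (- x) (- y) (- z) = - emb5 x y z"
  by (simp add: emb5_def vec_eq_iff)

lemma emb5_eq_iff: "emb5 x y z = emb5 x' y' z' \<longleftrightarrow> x = x' \<and> y = y' \<and> z = z'"
proof
  assume e: "emb5 x y z = emb5 x' y' z'"
  then have "emb5 x y z $ j = emb5 x' y' z' $ j" for j by simp
  from this[of 1] this[of 2] this[of 3] this[of 4] this[of 5]
  show "x = x' \<and> y = y' \<and> z = z'" by (simp add: emb5_def vec_eq_iff forall_3)
qed simp

lemma bounded_linear_emb5: "bounded_linear (\<lambda>(x, y, z). emb5 x y z)"
  by (intro linear_conv_bounded_linear[THEN iffD1] linearI) (auto simp: emb5_add emb5_scaleR)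

lemma has_derivative_emb5:
  assumes "(p has_derivative p') (at u within T)" "(q has_derivative q') (at u within T)" "(s has_derivative s') (at u within T)"
  shows "((\<lambda>u. emb5 (p u) (q u) (s u)) has_derivative (\<lambda>v. emb5 (p' v) (q' v) (s' v))) (at u within T)"
  using bounded_linear.has_derivative[OF bounded_linear_emb5
      has_derivative_Pair[OF assms(1) has_derivative_Pair[OF assms(2,3)]]] by simp

lemma sum_eq_inner: "(\<Sum>j\<in>UNIV. c j * v $ j) = (\<chi> j. c j) \<bullet> (v :: real^'n)"
  by (simp add: inner_vec_def)

lemma constant_imp_fd_zero:
  assumes "open S" "x \<in> S" "\<And>y. y \<in> S \<Longrightarrow> g y = c" "(g has_derivative g') (at x)"
  shows "g' v = 0"
proof -
  have "(g has_derivative (\<lambda>v. 0)) (at x)"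
    by (rule has_derivative_transform_within_open[OF has_derivative_const assms(1,2)]) (simp add: assms(3))
  from has_derivative_unique[OF assms(4) this] show ?thesis by (rule fun_cong)
qed

lemma fd_zero_imp_constant:
  assumes "convex S" "\<And>x. x \<in> S \<Longrightarrow> (g has_derivative g' x) (at x)" "\<And>x v. x \<in> S \<Longrightarrow> g' x v = 0"
  shows "\<exists>c. \<forall>x\<in>S. g x = c"
proof -
  have "(g has_derivative (\<lambda>v. 0)) (at x within S)" if "x \<in> S" for x
  proof -
    have "g' x = (\<lambda>v. 0)" using assms(3)[OF that] by (rule ext)
    then show ?thesis using has_derivative_at_withinI[OF assms(2)[OF that], of S] by simp
  qed
  from has_derivative_zero_constant[OF assms(1) this] show ?thesis .
qed

context temple_system
begin

lemma eta_xi: "u \<in> U \<Longrightarrow> eta \<alpha> (xi \<beta> u) u = (if \<alpha> = \<beta> then (1 / kap \<alpha> u) *\<^sub>R om \<alpha> u else 0)"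
  by (simp add: eta_def dual)

end

context temple_potentials
begin

lemma has_derivative_P: "u \<in> U \<Longrightarrow> (P has_derivative fd P u) (at u)"
  and has_derivative_Q: "u \<in> U \<Longrightarrow> (Q has_derivative fd Q u) (at u)"
  and has_derivative_f: "u \<in> U \<Longrightarrow> (f has_derivative fd f u) (at u)"
  using smooth_PQ smooth_f smooth_on_has_derivative by blast+

lemma has_derivative_potentials:
  assumes "u \<in> U"
  shows "(B has_derivative (\<lambda>v. P u \<bullet> v)) (at u)" "(A has_derivative (\<lambda>v. P u \<bullet> fd f u v)) (at u)"
    "(N' has_derivative (\<lambda>v. Q u \<bullet> v)) (at u)" "(M has_derivative (\<lambda>v. Q u \<bullet> fd f u v)) (at u)"
proof -
  have e: "fd B u = (\<lambda>v. P u \<bullet> v)" "fd A u = (\<lambda>v. P u \<bullet> fd f u v)"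
    "fd N' u = (\<lambda>v. Q u \<bullet> v)" "fd M u = (\<lambda>v. Q u \<bullet> fd f u v)"
    by (rule ext, rule fd_B[OF assms] fd_A[OF assms] fd_N[OF assms] fd_M[OF assms])+
  show "(B has_derivative (\<lambda>v. P u \<bullet> v)) (at u)" "(A has_derivative (\<lambda>v. P u \<bullet> fd f u v)) (at u)"
    "(N' has_derivative (\<lambda>v. Q u \<bullet> v)) (at u)" "(M has_derivative (\<lambda>v. Q u \<bullet> fd f u v)) (at u)"
    using smooth_BN[THEN smooth_on_has_derivative, OF assms] unfolding e .
qed

lemma psi_nonzero: "\<psi> u \<noteq> 0"
  using psi_pos[of u] by simp

text \<open>The derivative of \<open>P\<close> kills \<open>xi 1\<close>, that of \<open>Q\<close>
  kills \<open>xi 2\<close>, and that of \<open>P + Q\<close> kills \<open>xi 3\<close>. These are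
  the three speeds of the web system.\<close>

lemma hessians_xi:
  assumes "u \<in> U"
  shows "fd P u (xi 1 u) = 0" "fd P u (xi 2 u) = (\<psi> u / kap 2 u) *\<^sub>R om 2 u"
    "fd P u (xi 3 u) = - (\<psi> u / kap 3 u) *\<^sub>R om 3 u"
    "fd Q u (xi 1 u) = - (\<psi> u / kap 1 u) *\<^sub>R om 1 u" "fd Q u (xi 2 u) = 0"
    "fd Q u (xi 3 u) = (\<psi> u / kap 3 u) *\<^sub>R om 3 u"
  by (simp_all add: fd_P[OF assms] fd_Q[OF assms] eta_xi[OF assms])

lemma hessians_independent:
  assumes "u \<in> U" "\<And>v. y *\<^sub>R fd P u v + z *\<^sub>R fd Q u v = 0"
  shows "y = 0" "z = 0"
proof -
  have om: "om \<alpha> u \<noteq> 0" for \<alpha> using dual[OF assms(1), of \<alpha> \<alpha>] by auto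
  show "y = 0" using assms(2)[of "xi 2 u"] kap_nonzero[OF assms(1), of 2] psi_nonzero[of u] om
    by (simp add: hessians_xi[OF assms(1)])
  show "z = 0" using assms(2)[of "xi 1 u"] kap_nonzero[OF assms(1), of 1] psi_nonzero[of u] om
    by (simp add: hessians_xi[OF assms(1)])
qed

definition dens :: "real^3 \<Rightarrow> real^5" where "dens u = emb5 u (B u) (N' u)"
definition flux :: "real^3 \<Rightarrow> real^5" where "flux u = emb5 (f u) (A u) (M u)"

lemma has_derivative_dens:
  assumes "u \<in> U"
  shows "(dens has_derivative (\<lambda>v. emb5 v (P u \<bullet> v) (Q u \<bullet> v))) (at u)"
  unfolding dens_def[abs_def]
  by (intro has_derivative_emb5 has_derivative_ident has_derivative_potentials assms)

lemma has_derivative_flux: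
  assumes "u \<in> U"
  shows "(flux has_derivative (\<lambda>v. emb5 (fd f u v) (P u \<bullet> fd f u v) (Q u \<bullet> fd f u v))) (at u)"
  unfolding flux_def[abs_def]
  by (intro has_derivative_emb5 has_derivative_f has_derivative_potentials assms)

text \<open>One differentiation gives a linear relation between a constant, \<open>P\<close> and
  \<open>Q\<close>; a second one gives a relation between the two Hessians, which are
  independent.\<close>

lemma dens_independent:
  assumes "\<And>u. u \<in> U \<Longrightarrow> emb5 x y z \<bullet> dens u = k"
  shows "x = 0 \<and> y = 0 \<and> z = 0"
proof -
  have 1: "x + y *\<^sub>R P u + z *\<^sub>R Q u = 0" if u: "u \<in> U" for u
  proof -
    have "emb5 x y z \<bullet> emb5 v (P u \<bullet> v) (Q u \<bullet> v) = 0" for v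
      by (rule constant_imp_fd_zero[OF openU u assms has_derivative_inner_right[OF has_derivative_dens[OF u]]])
    then have "(x + y *\<^sub>R P u + z *\<^sub>R Q u) \<bullet> v = 0" for v
      by (simp add: emb5_inner inner_add_left)
    then show ?thesis using inner_eq_zero_iff by blast
  qed
  have 2: "y *\<^sub>R fd P u v + z *\<^sub>R fd Q u v = 0" if u: "u \<in> U" for u v
  proof -
    have "((\<lambda>u. x + y *\<^sub>R P u + z *\<^sub>R Q u) has_derivative (\<lambda>v. 0 + y *\<^sub>R fd P u v + z *\<^sub>R fd Q u v)) (at u)"
      by (intro has_derivative_add has_derivative_const has_derivative_scaleR_right
          has_derivative_P has_derivative_Q u)
    from constant_imp_fd_zero[OF openU u 1 this] show ?thesis by simp
  qed
  obtain u where u: "u \<in> U" using neU by blast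
  from hessians_independent[OF u 2[OF u]] 1[OF u] show ?thesis by simp
qed

text \<open>The Hessian of a conserved density is diagonal in the frame, hence a combination of the
  \<open>eta\<close>. Its closedness determines the coefficients up to two constants, so it is a
  combination of the Hessians of \<open>B\<close> and \<open>N'\<close>, and two integrations finish
  the proof.\<close>

lemma dens_flux_complete:
  assumes b0: "smooth_on U b0" and a0: "smooth_on U a0"
    and law: "\<And>u \<alpha>. u \<in> U \<Longrightarrow> fd a0 u (xi \<alpha> u) = lam \<alpha> u * fd b0 u (xi \<alpha> u)"
  shows "\<exists>x y z k l. \<forall>u\<in>U. b0 u = emb5 x y z \<bullet> dens u + k \<and> a0 u = emb5 x y z \<bullet> flux u + l"
proof -
  define p where "p = (\<lambda>u. \<Sum>b\<in>Basis. fd b0 u b *\<^sub>R b)"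
  have smp: "smooth_on U p" unfolding p_def by (intro smooth_on_intros openU b0)
  have p: "fd b0 u v = p u \<bullet> v" if "u \<in> U" for u v
    by (subst has_derivative_sum_Basis[OF smooth_on_has_derivative[OF b0 that]])
       (simp add: p_def inner_sum_left inner_commute[of _ v] mult.commute inner_sum_right)
  have fa0: "fd a0 u v = p u \<bullet> fd f u v" if "u \<in> U" for u v
  proof (rule linear_eq_on_frame[OF that smooth_on_fd_linear[OF a0 that]])
    show "bounded_linear (\<lambda>v. p u \<bullet> fd f u v)"
      using bounded_linear_compose[OF bounded_linear_inner_right smooth_on_fd_linear[OF smooth_f that]] by simp
    show "fd a0 u (xi \<alpha> u) = p u \<bullet> fd f u (xi \<alpha> u)" for \<alpha>
      by (simp add: law[OF that] f_xi[OF that] p[OF that])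
  qed
  have psym: "fd p u v \<bullet> w = fd p u w \<bullet> v" if u: "u \<in> U" for u v w
  proof -
    have "fd p u v \<bullet> w = fd (\<lambda>x. fd b0 x w) u v" for v w
    proof -
      have "((\<lambda>x. fd b0 x w) has_derivative (\<lambda>v. fd p u v \<bullet> w)) (at u)"
        by (rule has_derivative_transform_within_open[OF
              has_derivative_inner_left[OF smooth_on_has_derivative[OF smp u]] openU u]) (simp add: p)
      from fd_eqI[OF this] show ?thesis by simp
    qed
    then show ?thesis using second_derivative_symmetric[OF openU b0 u] by simp
  qed
  have pfsym: "fd p u v \<bullet> fd f u w = fd p u w \<bullet> fd f u v" if u: "u \<in> U" for u v w
  proof -
    have *: "fd (\<lambda>x. fd a0 x w) u v = p u \<bullet> fd (\<lambda>x. fd f x w) u v + fd p u v \<bullet> fd f u w" for v w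
    proof -
      have "((\<lambda>x. p x \<bullet> fd f x w) has_derivative (\<lambda>v. p u \<bullet> fd (\<lambda>x. fd f x w) u v + fd p u v \<bullet> fd f u w)) (at u)"
        by (intro has_derivative_inner smooth_on_has_derivative[OF _ u] smp smooth_on_fd smooth_f)
      then have "((\<lambda>x. fd a0 x w) has_derivative (\<lambda>v. p u \<bullet> fd (\<lambda>x. fd f x w) u v + fd p u v \<bullet> fd f u w)) (at u)"
        by (rule has_derivative_transform_within_open[OF _ openU u]) (simp add: fa0)
      from fd_eqI[OF this] show ?thesis by simp
    qed
    show ?thesis
      using *[of w v] *[of v w] second_derivative_symmetric[OF openU a0 u, of v w]
        second_derivative_symmetric[OF openU smooth_f u, of v w] by simp
  qed
  \<comment> \<open>The Hessian is symmetric and so is its composition with the derivative of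
    \<open>f\<close>; distinct speeds then force the off-diagonal entries to vanish.\<close>
  have diag: "fd p u (xi \<alpha> u) \<bullet> xi \<beta> u = 0" if u: "u \<in> U" and ne: "\<alpha> \<noteq> \<beta>" for u \<alpha> \<beta>
  proof -
    have "(lam \<beta> u - lam \<alpha> u) * (fd p u (xi \<alpha> u) \<bullet> xi \<beta> u) = 0"
      using pfsym[OF u, of "xi \<alpha> u" "xi \<beta> u"] psym[OF u, of "xi \<alpha> u" "xi \<beta> u"]
      by (simp add: f_xi[OF u] algebra_simps)
    then show ?thesis using lam_distinct[OF u ne] by simp
  qed
  define k where "k = (\<lambda>\<alpha> u. kap \<alpha> u * (fd p u (xi \<alpha> u) \<bullet> xi \<alpha> u))"
  have smk: "smooth_on U (k \<alpha>)" for \<alpha>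
    unfolding k_def by (intro smooth_on_intros openU smooth_kap smp smooth_xi)
  have pk: "fd p u v = (\<Sum>\<alpha>\<in>UNIV. k \<alpha> u *\<^sub>R eta \<alpha> v u)" if u: "u \<in> U" for u v
  proof (rule coframe_eqI[OF u])
    fix \<beta>
    have "fd p u v \<bullet> xi \<beta> u = fd p u (xi \<beta> u) \<bullet> v" by (rule psym[OF u])
    also have "\<dots> = (\<Sum>\<alpha>\<in>UNIV. (om \<alpha> u \<bullet> v) * (fd p u (xi \<beta> u) \<bullet> xi \<alpha> u))"
      by (rule inner_expansion[OF u])
    also have "\<dots> = (\<Sum>\<alpha>\<in>UNIV. (k \<alpha> u *\<^sub>R eta \<alpha> v u) \<bullet> xi \<beta> u)"
    proof (rule sum.cong[OF refl])
      show "(om \<alpha> u \<bullet> v) * (fd p u (xi \<beta> u) \<bullet> xi \<alpha> u) = (k \<alpha> u *\<^sub>R eta \<alpha> v u) \<bullet> xi \<beta> u" for \<alpha>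
        using diag[OF u, of \<beta> \<alpha>] kap_nonzero[OF u, of \<alpha>]
        by (cases "\<alpha> = \<beta>") (simp_all add: eta_def dual[OF u] k_def)
    qed
    also have "\<dots> = (\<Sum>\<alpha>\<in>UNIV. k \<alpha> u *\<^sub>R eta \<alpha> v u) \<bullet> xi \<beta> u"
      by (rule inner_sum_left[symmetric])
    finally show "fd p u v \<bullet> xi \<beta> u = (\<Sum>\<alpha>\<in>UNIV. k \<alpha> u *\<^sub>R eta \<alpha> v u) \<bullet> xi \<beta> u" .
  qed
  \<comment> \<open>Closedness of the Hessian, expanded with \<open>ext_deriv_k_eta\<close>.\<close>
  have codazzi: "(\<Sum>\<alpha>\<in>UNIV. (fd (k \<alpha>) u v - k \<alpha> u * (phi u \<bullet> v)) * (eta \<alpha> e u \<bullet> w)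
      - (fd (k \<alpha>) u w - k \<alpha> u * (phi u \<bullet> w)) * (eta \<alpha> e u \<bullet> v) + k \<alpha> u * rho e u v w) = 0"
    if u: "u \<in> U" for u e v w
  proof -
    have sm: "smooth_on U (\<lambda>x. k \<alpha> x *\<^sub>R eta \<alpha> e x)" for \<alpha>
      by (intro smooth_on_intros openU smk smooth_eta)
    have "fd (\<lambda>x. fd p x e) u v = (\<Sum>\<alpha>\<in>UNIV. fd (\<lambda>x. k \<alpha> x *\<^sub>R eta \<alpha> e x) u v)" for v
    proof -
      have "((\<lambda>x. \<Sum>\<alpha>\<in>UNIV. k \<alpha> x *\<^sub>R eta \<alpha> e x) has_derivative (\<lambda>v. \<Sum>\<alpha>\<in>UNIV. fd (\<lambda>x. k \<alpha> x *\<^sub>R eta \<alpha> e x) u v)) (at u)"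
        by (intro has_derivative_sum smooth_on_has_derivative[OF sm u])
      then have "((\<lambda>x. fd p x e) has_derivative (\<lambda>v. \<Sum>\<alpha>\<in>UNIV. fd (\<lambda>x. k \<alpha> x *\<^sub>R eta \<alpha> e x) u v)) (at u)"
        by (rule has_derivative_transform_within_open[OF _ openU u]) (simp add: pk)
      from fd_eqI[OF this] show ?thesis by simp
    qed
    then have "ext_deriv (\<lambda>x. fd p x e) u v w = (\<Sum>\<alpha>\<in>UNIV. ext_deriv (\<lambda>x. k \<alpha> x *\<^sub>R eta \<alpha> e x) u v w)"
      by (simp add: ext_deriv_def inner_sum_left sum_subtractf)
    moreover have "ext_deriv (\<lambda>x. fd p x e) u v w = 0"
    proof -
      have "fd (\<lambda>x. fd p x e) u v \<bullet> w = fd (\<lambda>x. fd p x w) u v \<bullet> e" for v w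
      proof -
        have d: "((\<lambda>x. fd p x e \<bullet> w) has_derivative (\<lambda>v. fd (\<lambda>x. fd p x e) u v \<bullet> w)) (at u)" for e w
          by (intro has_derivative_inner_left smooth_on_has_derivative[OF smooth_on_fd[OF smp] u])
        have "((\<lambda>x. fd p x e \<bullet> w) has_derivative (\<lambda>v. fd (\<lambda>x. fd p x w) u v \<bullet> e)) (at u)"
          by (rule has_derivative_transform_within_open[OF d openU u]) (rule psym)
        from has_derivative_unique[OF d this] show ?thesis by (rule fun_cong)
      qed
      then show ?thesis
        using second_derivative_symmetric[OF openU smp u, of v w] by (simp add: ext_deriv_def)
    qed
    ultimately show ?thesis by (simp add: ext_deriv_k_eta[OF u smk])
  qed
  \<comment> \<open>On three distinct frame vectors all \<open>eta\<close> terms vanish and only the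
    sum of the coefficients times \<open>rho\<close> is left.\<close>
  have ksum: "k 1 u + k 2 u + k 3 u = 0" if u: "u \<in> U" for u
  proof -
    have "(lam 2 u - lam 1 u) * (k 1 u + k 2 u + k 3 u) = 0"
      using codazzi[OF u, of "xi 1 u" "xi 3 u" "xi 2 u"]
      by (simp add: sum_3 rho_def eta_def dual[OF u] algebra_simps)
    then show ?thesis using lam_distinct[OF u, of 2 1] by simp
  qed
  \<comment> \<open>Off the diagonal this follows from \<open>codazzi\<close> with
    \<open>xi \<alpha> u\<close> in two slots. Along \<open>xi \<alpha> u\<close> itself,
    \<open>k \<alpha>\<close> is minus the sum of the other two coefficients, to which the
    off-diagonal case applies.\<close>
  have dk: "fd (k \<alpha>) u v = k \<alpha> u * (phi u \<bullet> v)" if u: "u \<in> U" for \<alpha> u v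
  proof -
    have off: "fd (k \<alpha>) u (xi \<beta> u) = k \<alpha> u * (phi u \<bullet> xi \<beta> u)" if ne: "\<alpha> \<noteq> \<beta>" for \<alpha> \<beta>
    proof -
      have r: "rho (xi \<alpha> u) u (xi \<beta> u) (xi \<alpha> u) = 0"
        using exhaust_3[of \<alpha>] exhaust_3[of \<beta>] ne by (auto simp: rho_def dual[OF u])
      have "(\<Sum>\<delta>\<in>UNIV. if \<delta> = \<alpha> then (fd (k \<alpha>) u (xi \<beta> u) - k \<alpha> u * (phi u \<bullet> xi \<beta> u)) * (1 / kap \<alpha> u) else 0) = 0"
        using ne by (subst codazzi[OF u, of "xi \<beta> u" "xi \<alpha> u" "xi \<alpha> u", symmetric])
          (intro sum.cong, auto simp: r eta_def dual[OF u])
      then show ?thesis using kap_nonzero[OF u] by simp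
    qed
    have sum0: "fd (k 1) u v + fd (k 2) u v + fd (k 3) u v = 0" for v
      by (rule constant_imp_fd_zero[where g = "\<lambda>u. k 1 u + k 2 u + k 3 u", OF openU u ksum])
         (assumption, intro has_derivative_add smooth_on_has_derivative[OF smk u])
    have s: "k a u + k b u + k c u = 0" "fd (k a) u v + fd (k b) u v + fd (k c) u v = 0"
      if d: "a \<noteq> b" "b \<noteq> c" "a \<noteq> c" for a b c v
      using sum_3_distinct[OF d, of "\<lambda>\<alpha>. k \<alpha> u"] sum_3_distinct[OF d, of "\<lambda>\<alpha>. fd (k \<alpha>) u v"]
        ksum[OF u] sum0[of v] by (simp_all add: sum_3)
    show ?thesis
    proof (rule linear_eq_on_frame[OF u smooth_on_fd_linear[OF smk u]])
      show "bounded_linear (\<lambda>v. k \<alpha> u * (phi u \<bullet> v))"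
        by (intro bounded_linear_const_mult bounded_linear_inner_right)
      fix \<beta>
      show "fd (k \<alpha>) u (xi \<beta> u) = k \<alpha> u * (phi u \<bullet> xi \<beta> u)"
      proof (cases "\<alpha> = \<beta>")
        case True
        obtain b c where d: "\<alpha> \<noteq> b" "b \<noteq> c" "\<alpha> \<noteq> c" using ex_distinct_3 by blast
        have "fd (k \<alpha>) u (xi \<alpha> u) = - (k b u + k c u) * (phi u \<bullet> xi \<alpha> u)"
          using s(2)[OF d, of "xi \<alpha> u"] off[of b \<alpha>] off[of c \<alpha>] d by (simp add: algebra_simps)
        moreover have "k \<alpha> u = - (k b u + k c u)" using s(1)[OF d] by simp
        ultimately show ?thesis using True by simp
      qed (rule off)
    qed
  qed
  have "\<exists>c. \<forall>u\<in>U. k \<alpha> u / \<psi> u = c" for \<alpha>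
    by (rule fd_zero_imp_constant[OF convU has_derivative_divide[OF
          smooth_on_has_derivative[OF smk] smooth_on_has_derivative[OF smooth_psi] psi_nonzero]])
       (simp_all add: dk fd_psi psi_nonzero field_simps)
  then obtain c where c: "\<And>\<alpha> u. u \<in> U \<Longrightarrow> k \<alpha> u = c \<alpha> * \<psi> u"
    by (metis nonzero_eq_divide_eq psi_nonzero)
  have c0: "c 3 = - c 1 - c 2"
  proof -
    obtain u where u: "u \<in> U" using neU by blast
    have "(c 1 + c 2 + c 3) * \<psi> u = 0" using ksum[OF u] by (simp add: c[OF u] algebra_simps)
    then show ?thesis using psi_nonzero[of u] by simp
  qed
  have pPQ: "fd p u v = c 2 *\<^sub>R fd P u v - c 1 *\<^sub>R fd Q u v" if u: "u \<in> U" for u v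
    by (simp add: pk[OF u] fd_P[OF u] fd_Q[OF u] sum_3 c[OF u] c0 algebra_simps)
  have "\<exists>x. \<forall>u\<in>U. p u - c 2 *\<^sub>R P u + c 1 *\<^sub>R Q u = x"
    by (rule fd_zero_imp_constant[OF convU has_derivative_add[OF has_derivative_diff[OF
          smooth_on_has_derivative[OF smp] has_derivative_scaleR_right[OF has_derivative_P]]
          has_derivative_scaleR_right[OF has_derivative_Q]]]) (simp_all add: pPQ)
  then obtain x where x: "\<And>u. u \<in> U \<Longrightarrow> p u - c 2 *\<^sub>R P u + c 1 *\<^sub>R Q u = x" by blast
  have pin: "p u \<bullet> v = x \<bullet> v + c 2 * (P u \<bullet> v) - c 1 * (Q u \<bullet> v)" if "u \<in> U" for u v
    by (simp add: x[OF that, symmetric] inner_add_left inner_diff_left)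
  define w where "w = emb5 x (c 2) (- c 1)"
  have "\<exists>l. \<forall>u\<in>U. b0 u - w \<bullet> dens u = l"
    by (rule fd_zero_imp_constant[OF convU has_derivative_diff[OF
          smooth_on_has_derivative[OF b0] has_derivative_inner_right[OF has_derivative_dens]]])
       (simp_all add: p pin w_def emb5_inner)
  moreover have "\<exists>l. \<forall>u\<in>U. a0 u - w \<bullet> flux u = l"
    by (rule fd_zero_imp_constant[OF convU has_derivative_diff[OF
          smooth_on_has_derivative[OF a0] has_derivative_inner_right[OF has_derivative_flux]]])
       (simp_all add: fa0 pin w_def emb5_inner)
  ultimately obtain l m where "\<And>u. u \<in> U \<Longrightarrow> b0 u - w \<bullet> dens u = l" "\<And>u. u \<in> U \<Longrightarrow> a0 u - w \<bullet> flux u = m"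
    by blast
  then have "\<forall>u\<in>U. b0 u = w \<bullet> dens u + l \<and> a0 u = w \<bullet> flux u + m" by (simp add: algebra_simps)
  then show ?thesis unfolding w_def by blast
qed

end

section \<open>Conservation laws of the web system\<close>

context temple_system
begin

text \<open>A map with diagonal derivative in the frame satisfies the same algebraic relation as \<open>f\<close>,
  so its eigenvalues are an affine function of the characteristic speeds.\<close>

lemma diagonal_maps:
  assumes W: "smooth_on U W" and conv: "convex U" "U \<noteq> {}"
    and diag: "\<And>u \<alpha> \<beta>. u \<in> U \<Longrightarrow> \<alpha> \<noteq> \<beta> \<Longrightarrow> om \<beta> u \<bullet> fd W u (xi \<alpha> u) = 0"
  shows "\<exists>m n x. \<forall>u\<in>U. W u = m *\<^sub>R f u + n *\<^sub>R u + x"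
proof -
  define \<sigma> where "\<sigma> = (\<lambda>\<alpha> u. om \<alpha> u \<bullet> fd W u (xi \<alpha> u))"
  have sm\<sigma>: "smooth_on U (\<sigma> \<alpha>)" for \<alpha>
    unfolding \<sigma>_def by (intro smooth_on_intros openU smooth_om W smooth_xi)
  have d\<sigma>: "om \<alpha> u \<bullet> fd W u v = \<sigma> \<alpha> u * (om \<alpha> u \<bullet> v)" if u: "u \<in> U" for u v \<alpha>
  proof (rule linear_eq_on_frame[OF u])
    show "bounded_linear (\<lambda>v. om \<alpha> u \<bullet> fd W u v)"
      using bounded_linear_compose[OF bounded_linear_inner_right smooth_on_fd_linear[OF W u]] by simp
    show "bounded_linear (\<lambda>v. \<sigma> \<alpha> u * (om \<alpha> u \<bullet> v))"
      by (intro bounded_linear_const_mult bounded_linear_inner_right)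
    show "om \<alpha> u \<bullet> fd W u (xi \<beta> u) = \<sigma> \<alpha> u * (om \<alpha> u \<bullet> xi \<beta> u)" for \<beta>
      using diag[OF u, of \<beta> \<alpha>] by (cases "\<alpha> = \<beta>") (simp_all add: \<sigma>_def dual[OF u])
  qed
  define m where "m = (\<lambda>u. (\<sigma> 1 u - \<sigma> 2 u) / (lam 1 u - lam 2 u))"
  define n where "n = (\<lambda>u. \<sigma> 1 u - m u * lam 1 u)"
  have l: "lam 1 u \<noteq> lam 2 u" "lam 1 u \<noteq> lam 3 u" "lam 2 u \<noteq> lam 3 u" if "u \<in> U" for u
    using lam_distinct[OF that] by simp_all
  have smm: "smooth_on U m"
    unfolding m_def by (intro smooth_on_intros openU sm\<sigma> smooth_lam) (use l in auto)
  have smn: "smooth_on U n" unfolding n_def by (intro smooth_on_intros openU sm\<sigma> smooth_lam smm)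
  have affine: "\<sigma> \<alpha> u = m u * lam \<alpha> u + n u" if u: "u \<in> U" for u \<alpha>
  proof -
    have "(\<sigma> 2 u - \<sigma> 3 u) * N 3 u (xi 1 u) (xi 2 u) = (\<sigma> 1 u - \<sigma> 3 u) * N 3 u (xi 2 u) (xi 1 u)"
      by (rule diagonal_compatibility[OF u W sm\<sigma> d\<sigma>]) simp_all
    then have "((\<sigma> 2 u - \<sigma> 3 u) * (lam 1 u - lam 3 u)) * kap 3 u = ((\<sigma> 1 u - \<sigma> 3 u) * (lam 2 u - lam 3 u)) * kap 3 u"
      by (simp add: N_kap[OF u] algebra_simps)
    then have e: "(\<sigma> 2 u - \<sigma> 3 u) * (lam 1 u - lam 3 u) = (\<sigma> 1 u - \<sigma> 3 u) * (lam 2 u - lam 3 u)"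
      using kap_nonzero[OF u, of 3] by simp
    have m: "m u * (lam 1 u - lam 2 u) = \<sigma> 1 u - \<sigma> 2 u" using l[OF u] by (simp add: m_def)
    have 2: "\<sigma> 2 u = m u * lam 2 u + n u" using m by (simp add: n_def algebra_simps)
    have "(\<sigma> 3 u - (m u * lam 3 u + n u)) * (lam 1 u - lam 2 u) = 0"
      using e m by (simp add: n_def) algebra
    then have 3: "\<sigma> 3 u = m u * lam 3 u + n u" using l[OF u] by simp
    show ?thesis using exhaust_3[of \<alpha>] 2 3 by (auto simp: n_def)
  qed
  have dW: "fd W u v = m u *\<^sub>R fd f u v + n u *\<^sub>R v" if u: "u \<in> U" for u v
    by (rule frame_eqI[OF u]) (simp add: d\<sigma>[OF u] affine[OF u] inner_add_right diag_f[OF u] algebra_simps)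
  have sym: "fd m u w *\<^sub>R fd f u v + fd n u w *\<^sub>R v = fd m u v *\<^sub>R fd f u w + fd n u v *\<^sub>R w"
    if u: "u \<in> U" for u v w
  proof -
    have "fd (\<lambda>x. fd W x v) u w = m u *\<^sub>R fd (\<lambda>x. fd f x v) u w + fd m u w *\<^sub>R fd f u v + fd n u w *\<^sub>R v" for v w
    proof -
      have "((\<lambda>x. m x *\<^sub>R fd f x v + n x *\<^sub>R v) has_derivative
          (\<lambda>w. m u *\<^sub>R fd (\<lambda>x. fd f x v) u w + fd m u w *\<^sub>R fd f u v + fd n u w *\<^sub>R v)) (at u)"
        by (intro has_derivative_add has_derivative_scaleR has_derivative_scaleR_left
            smooth_on_has_derivative[OF _ u] smm smn smooth_on_fd smooth_f)
      then have "((\<lambda>x. fd W x v) has_derivative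
          (\<lambda>w. m u *\<^sub>R fd (\<lambda>x. fd f x v) u w + fd m u w *\<^sub>R fd f u v + fd n u w *\<^sub>R v)) (at u)"
        by (rule has_derivative_transform_within_open[OF _ openU u]) (simp add: dW)
      from fd_eqI[OF this] show ?thesis by simp
    qed
    then show ?thesis
      using second_derivative_symmetric[OF openU W u, of v w]
        second_derivative_symmetric[OF openU smooth_f u, of v w] by simp
  qed
  \<comment> \<open>On \<open>xi \<alpha> u\<close> and \<open>xi \<beta> u\<close>, the
    \<open>om \<beta>\<close> component of \<open>sym\<close> is a linear equation for the
    derivatives of \<open>m\<close> and \<open>n\<close> along \<open>xi \<alpha> u\<close>. The two
    choices of \<open>\<beta>\<close> give distinct speeds, so both derivatives vanish.\<close>
  have zero: "fd m u v = 0 \<and> fd n u v = 0" if u: "u \<in> U" for u v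
  proof -
    have xi: "fd m u (xi \<alpha> u) = 0 \<and> fd n u (xi \<alpha> u) = 0" for \<alpha>
    proof -
      obtain b c where d: "\<alpha> \<noteq> b" "b \<noteq> c" "\<alpha> \<noteq> c" using ex_distinct_3 by blast
      have e: "fd m u (xi \<alpha> u) * lam \<beta> u + fd n u (xi \<alpha> u) = 0" if ne: "\<alpha> \<noteq> \<beta>" for \<beta>
        using arg_cong[OF sym[OF u, of "xi \<alpha> u" "xi \<beta> u"], of "\<lambda>x. om \<beta> u \<bullet> x"] ne
        by (simp add: inner_add_right f_xi[OF u] dual[OF u])
      have "fd m u (xi \<alpha> u) * (lam b u - lam c u) = 0"
        using e[OF d(1)] e[OF d(3)] by algebra
      then have "fd m u (xi \<alpha> u) = 0" using lam_distinct[OF u d(2)] by simp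
      then show ?thesis using e[OF d(1)] by simp
    qed
    show ?thesis
      using linear_eq_on_frame[OF u smooth_on_fd_linear[OF smm u] bounded_linear_zero, of v]
        linear_eq_on_frame[OF u smooth_on_fd_linear[OF smn u] bounded_linear_zero, of v] xi by simp
  qed
  obtain m0 n0 where mn: "\<And>u. u \<in> U \<Longrightarrow> m u = m0" "\<And>u. u \<in> U \<Longrightarrow> n u = n0"
    using fd_zero_imp_constant[OF conv(1) smooth_on_has_derivative[OF smm]]
      fd_zero_imp_constant[OF conv(1) smooth_on_has_derivative[OF smn]] zero by metis
  have "\<exists>x. \<forall>u\<in>U. W u - (m0 *\<^sub>R f u + n0 *\<^sub>R u) = x"
    by (rule fd_zero_imp_constant[OF conv(1) has_derivative_diff[OF smooth_on_has_derivative[OF W]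
          has_derivative_add[OF has_derivative_scaleR_right[OF smooth_on_has_derivative[OF smooth_f]]
            has_derivative_scaleR_right[OF has_derivative_ident]]]])
       (simp_all add: dW mn)
  then show ?thesis by (metis diff_add_cancel add.commute)
qed

end

context temple_potentials
begin

text \<open>\<open>P u \<bullet> u - B u\<close> is the Legendre transform of \<open>B\<close>, and
  \<open>P u \<bullet> f u - A u\<close> is its analogue for the flux. Together with
  \<open>- P u\<close> they are coordinates of a hyperplane tangent to the ruled
  hypersurface.\<close>

definition dens' :: "real^3 \<Rightarrow> real^5" where
  "dens' u = emb5 (- P u) (P u \<bullet> u - B u) (P u \<bullet> f u - A u)"
definition flux' :: "real^3 \<Rightarrow> real^5" where
  "flux' u = emb5 (- Q u) (Q u \<bullet> u - N' u) (Q u \<bullet> f u - M u)"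

text \<open>As for a Legendre transform, the terms that do not differentiate \<open>P\<close>
  cancel. The derivative depends on the direction only through \<open>fd P u v\<close>, so it
  vanishes wherever that does.\<close>

lemma has_derivative_dens':
  assumes "u \<in> U"
  shows "(dens' has_derivative (\<lambda>v. emb5 (- fd P u v) (fd P u v \<bullet> u) (fd P u v \<bullet> f u))) (at u)"
proof -
  note d = has_derivative_emb5[OF has_derivative_minus[OF has_derivative_P[OF assms]]
    has_derivative_diff[OF has_derivative_inner[OF has_derivative_P[OF assms] has_derivative_ident] has_derivative_potentials(1)[OF assms]]
    has_derivative_diff[OF has_derivative_inner[OF has_derivative_P[OF assms] has_derivative_f[OF assms]] has_derivative_potentials(2)[OF assms]]]
  show ?thesis unfolding dens'_def[abs_def] by (rule has_derivative_eq_rhs[OF d]) simp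
qed

lemma has_derivative_flux':
  assumes "u \<in> U"
  shows "(flux' has_derivative (\<lambda>v. emb5 (- fd Q u v) (fd Q u v \<bullet> u) (fd Q u v \<bullet> f u))) (at u)"
proof -
  note d = has_derivative_emb5[OF has_derivative_minus[OF has_derivative_Q[OF assms]]
    has_derivative_diff[OF has_derivative_inner[OF has_derivative_Q[OF assms] has_derivative_ident] has_derivative_potentials(3)[OF assms]]
    has_derivative_diff[OF has_derivative_inner[OF has_derivative_Q[OF assms] has_derivative_f[OF assms]] has_derivative_potentials(4)[OF assms]]]
  show ?thesis unfolding flux'_def[abs_def] by (rule has_derivative_eq_rhs[OF d]) simp
qed

text \<open>One differentiation shows that \<open>- x + y *\<^sub>R u + z *\<^sub>R f u\<close> is
  annihilated by a coframe, hence is zero; differentiating again leaves a relation between the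
  identity and the derivative of \<open>f\<close>, excluded by distinct speeds.\<close>

lemma dens'_independent:
  assumes k: "\<And>u. u \<in> U \<Longrightarrow> emb5 x y z \<bullet> dens' u = k" and l: "\<And>u. u \<in> U \<Longrightarrow> emb5 x y z \<bullet> flux' u = l"
  shows "x = 0 \<and> y = 0 \<and> z = 0"
proof -
  have 1: "- x + y *\<^sub>R u + z *\<^sub>R f u = 0" if u: "u \<in> U" for u
  proof -
    let ?w = "- x + y *\<^sub>R u + z *\<^sub>R f u"
    have "emb5 x y z \<bullet> emb5 (- fd P u v) (fd P u v \<bullet> u) (fd P u v \<bullet> f u) = 0" for v
      by (rule constant_imp_fd_zero[OF openU u k has_derivative_inner_right[OF has_derivative_dens'[OF u]]])
    then have P: "fd P u v \<bullet> ?w = 0" for v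
      by (simp add: emb5_inner inner_add_right inner_diff_right inner_add_left inner_diff_left inner_commute)
    have "emb5 x y z \<bullet> emb5 (- fd Q u v) (fd Q u v \<bullet> u) (fd Q u v \<bullet> f u) = 0" for v
      by (rule constant_imp_fd_zero[OF openU u l has_derivative_inner_right[OF has_derivative_flux'[OF u]]])
    then have Q: "fd Q u v \<bullet> ?w = 0" for v
      by (simp add: emb5_inner inner_add_right inner_diff_right inner_add_left inner_diff_left inner_commute)
    \<comment> \<open>The values of \<open>fd P u\<close> on \<open>xi 2 u\<close>,
      \<open>xi 3 u\<close> and of \<open>fd Q u\<close> on \<open>xi 1 u\<close> are nonzero
      multiples of the three characteristic forms.\<close>
    have "om \<alpha> u \<bullet> ?w = 0" for \<alpha>
      using P[of "xi 2 u"] P[of "xi 3 u"] Q[of "xi 1 u"] exhaust_3[of \<alpha>] kap_nonzero[OF u] psi_nonzero[of u]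
      unfolding hessians_xi[OF u] inner_scaleR_left by auto
    then show ?thesis by (intro frame_eqI[OF u]) simp
  qed
  have 2: "y *\<^sub>R v + z *\<^sub>R fd f u v = 0" if u: "u \<in> U" for u v
  proof -
    have "((\<lambda>u. - x + y *\<^sub>R u + z *\<^sub>R f u) has_derivative (\<lambda>v. 0 + y *\<^sub>R v + z *\<^sub>R fd f u v)) (at u)"
      by (intro has_derivative_add has_derivative_const has_derivative_scaleR_right has_derivative_ident
          has_derivative_f u)
    from constant_imp_fd_zero[OF openU u 1 this] show ?thesis by simp
  qed
  obtain u where u: "u \<in> U" using neU by blast
  have 3: "y + z * lam \<alpha> u = 0" for \<alpha>
    using arg_cong[OF 2[OF u, of "xi \<alpha> u"], of "\<lambda>x. om \<alpha> u \<bullet> x"]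
    by (simp add: f_xi[OF u] dual[OF u] inner_add_right)
  have "z * (lam 1 u - lam 2 u) = 0" using 3[of 1] 3[of 2] by algebra
  then have "z = 0" using lam_distinct[OF u, of 1 2] by simp
  then show ?thesis using 3[of 1] 1[OF u] by simp
qed

lemma dens'_flux'_complete:
  assumes b0: "smooth_on U b0" and a0: "smooth_on U a0"
    and law: "\<And>u. u \<in> U \<Longrightarrow> fd b0 u (xi 1 u) = 0" "\<And>u. u \<in> U \<Longrightarrow> fd a0 u (xi 2 u) = 0"
      "\<And>u. u \<in> U \<Longrightarrow> fd a0 u (xi 3 u) = - fd b0 u (xi 3 u)"
  shows "\<exists>x y z k l. \<forall>u\<in>U. b0 u = emb5 x y z \<bullet> dens' u + k \<and> a0 u = emb5 x y z \<bullet> flux' u + l"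
proof -
  \<comment> \<open>The coefficients are read off from \<open>hessians_xi\<close> so that
    \<open>b\<close> and \<open>a\<close> below hold; the relation between the two derivatives along
    \<open>xi 3\<close> makes the third coefficient serve both.\<close>
  define W where "W = (\<lambda>u. (- (kap 1 u * fd a0 u (xi 1 u) / \<psi> u)) *\<^sub>R xi 1 u
    + (kap 2 u * fd b0 u (xi 2 u) / \<psi> u) *\<^sub>R xi 2 u + (- (kap 3 u * fd b0 u (xi 3 u) / \<psi> u)) *\<^sub>R xi 3 u)"
  have smW: "smooth_on U W"
    unfolding W_def
    by (intro smooth_on_intros openU a0 b0 smooth_xi smooth_kap smooth_psi psi_nonzero)
  have bl: "bounded_linear (\<lambda>v. fd F u v \<bullet> w)" if "smooth_on U F" "u \<in> U"
    for F :: "real^3 \<Rightarrow> real^3" and u w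
    using bounded_linear_compose[OF bounded_linear_inner_left smooth_on_fd_linear[OF that]] by simp
  have b: "fd b0 u v = fd P u v \<bullet> W u" if u: "u \<in> U" for u v
  proof (rule linear_eq_on_frame[OF u smooth_on_fd_linear[OF b0 u] bl[OF smooth_PQ(1) u]])
    show "fd b0 u (xi \<alpha> u) = fd P u (xi \<alpha> u) \<bullet> W u" for \<alpha>
      using exhaust_3[of \<alpha>] law(1)[OF u] kap_nonzero[OF u] psi_nonzero[of u]
      by (auto simp: hessians_xi[OF u] W_def inner_add_right inner_diff_right dual[OF u])
  qed
  have a: "fd a0 u v = fd Q u v \<bullet> W u" if u: "u \<in> U" for u v
  proof (rule linear_eq_on_frame[OF u smooth_on_fd_linear[OF a0 u] bl[OF smooth_PQ(2) u]])
    show "fd a0 u (xi \<alpha> u) = fd Q u (xi \<alpha> u) \<bullet> W u" for \<alpha>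
      using exhaust_3[of \<alpha>] law(2,3)[OF u] kap_nonzero[OF u] psi_nonzero[of u]
      by (auto simp: hessians_xi[OF u] W_def inner_add_right inner_diff_right dual[OF u])
  qed
  have sym: "fd F u v \<bullet> fd W u w = fd F u w \<bullet> fd W u v"
    if u: "u \<in> U" and F: "smooth_on U F" and g: "smooth_on U g" "\<And>u v. u \<in> U \<Longrightarrow> fd g u v = fd F u v \<bullet> W u"
    for F :: "real^3 \<Rightarrow> real^3" and g u v w
  proof -
    have "fd (\<lambda>x. fd g x v) u w = fd F u v \<bullet> fd W u w + fd (\<lambda>x. fd F x v) u w \<bullet> W u" for v w
    proof -
      have "((\<lambda>x. fd F x v \<bullet> W x) has_derivative (\<lambda>w. fd F u v \<bullet> fd W u w + fd (\<lambda>x. fd F x v) u w \<bullet> W u)) (at u)"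
        by (intro has_derivative_inner smooth_on_has_derivative[OF _ u] smooth_on_fd F smW)
      then have "((\<lambda>x. fd g x v) has_derivative (\<lambda>w. fd F u v \<bullet> fd W u w + fd (\<lambda>x. fd F x v) u w \<bullet> W u)) (at u)"
        by (rule has_derivative_transform_within_open[OF _ openU u]) (simp add: g(2))
      from fd_eqI[OF this] show ?thesis by simp
    qed
    then show ?thesis
      using second_derivative_symmetric[OF openU g(1) u, of v w]
        second_derivative_symmetric[OF openU F u, of v w] by simp
  qed
  \<comment> \<open>In \<open>sym\<close> a vector killed by one Hessian makes one side vanish,
    which yields four off-diagonal entries. The last two, \<open>13\<close> and \<open>23\<close>,
    follow by symmetry from \<open>31\<close> and \<open>32\<close>.\<close>
  have diag: "om \<beta> u \<bullet> fd W u (xi \<alpha> u) = 0" if u: "u \<in> U" and ne: "\<alpha> \<noteq> \<beta>" for u \<alpha> \<beta>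
  proof -
    let ?s = "\<lambda>\<beta> \<alpha>. om \<beta> u \<bullet> fd W u (xi \<alpha> u)"
    note P = sym[OF u smooth_PQ(1) b0 b] and Q = sym[OF u smooth_PQ(2) a0 a]
    have 21: "?s 2 1 = 0" using P[of "xi 2 u" "xi 1 u"] kap_nonzero[OF u, of 2] psi_nonzero[of u]
      by (simp add: hessians_xi[OF u])
    have 31: "?s 3 1 = 0" using P[of "xi 3 u" "xi 1 u"] kap_nonzero[OF u, of 3] psi_nonzero[of u]
      by (simp add: hessians_xi[OF u])
    have 12: "?s 1 2 = 0" using Q[of "xi 1 u" "xi 2 u"] kap_nonzero[OF u, of 1] psi_nonzero[of u]
      by (simp add: hessians_xi[OF u])
    have 32: "?s 3 2 = 0" using Q[of "xi 3 u" "xi 2 u"] kap_nonzero[OF u, of 3] psi_nonzero[of u]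
      by (simp add: hessians_xi[OF u])
    have 13: "?s 1 3 = 0" using Q[of "xi 1 u" "xi 3 u"] 31 kap_nonzero[OF u, of 1] psi_nonzero[of u]
      by (simp add: hessians_xi[OF u])
    have 23: "?s 2 3 = 0" using P[of "xi 2 u" "xi 3 u"] 32 kap_nonzero[OF u, of 2] psi_nonzero[of u]
      by (simp add: hessians_xi[OF u])
    show ?thesis
      using exhaust_3[of \<alpha>] exhaust_3[of \<beta>] ne 21 31 12 32 13 23 by auto
  qed
  from diagonal_maps[OF smW convU neU diag] obtain m n x
    where W: "\<And>u. u \<in> U \<Longrightarrow> W u = m *\<^sub>R f u + n *\<^sub>R u + x" by blast
  define w where "w = emb5 (- x) n m"
  have "\<exists>l. \<forall>u\<in>U. b0 u - w \<bullet> dens' u = l"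
    by (rule fd_zero_imp_constant[OF convU has_derivative_diff[OF
          smooth_on_has_derivative[OF b0] has_derivative_inner_right[OF has_derivative_dens']]])
       (simp_all add: b W w_def emb5_inner inner_add_right inner_commute)
  moreover have "\<exists>l. \<forall>u\<in>U. a0 u - w \<bullet> flux' u = l"
    by (rule fd_zero_imp_constant[OF convU has_derivative_diff[OF
          smooth_on_has_derivative[OF a0] has_derivative_inner_right[OF has_derivative_flux']]])
       (simp_all add: a W w_def emb5_inner inner_add_right inner_commute)
  ultimately obtain l1 l2 where "\<And>u. u \<in> U \<Longrightarrow> b0 u - w \<bullet> dens' u = l1" "\<And>u. u \<in> U \<Longrightarrow> a0 u - w \<bullet> flux' u = l2"
    by blast
  then have "\<forall>u\<in>U. b0 u = w \<bullet> dens' u + l1 \<and> a0 u = w \<bullet> flux' u + l2" by (simp add: algebra_simps)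
  then show ?thesis unfolding w_def by blast
qed

end

section \<open>Maximal rank and duality\<close>

lemma emb5_nth:
  "emb5 x y z $ j = (if j = 1 then x $ 1 else if j = 2 then x $ 2 else if j = 3 then x $ 3 else if j = 4 then y else z)"
  by (simp add: emb5_def)

lemma smooth_on_emb5_nth:
  assumes "open S" "smooth_on S p" "smooth_on S q" "smooth_on S s"
  shows "smooth_on S (\<lambda>u. emb5 (p u) (q u) (s u) $ j)"
  unfolding emb5_nth using exhaust_5[of j] assms by (auto intro: smooth_on_vec_nth)

text \<open>A law \<open>(b, a)\<close> corresponds to the Abelian relation
  \<open>(b, a, - b - a)\<close>: the three speeds say exactly that each member is constant along
  its own foliation. The inverse map drops the third function.\<close>

lemma web_rank_from_conservation_basis:
  assumes V: "open V" and basis: "conservation_basis (web_system V X) b a"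
  shows "web_rank V X 5"
proof -
  \<comment> \<open>Translates between the index type \<open>5\<close> of a conservation basis and
    the natural numbers used by \<open>web_rank\<close>.\<close>
  obtain g where g: "bij_betw g {..<5::nat} (UNIV :: 5 set)"
    using ex_bij_betw_nat_finite[of "UNIV :: 5 set"] by (auto simp: atLeast0LessThan)
  define E :: "nat \<Rightarrow> 3 \<Rightarrow> real^3 \<Rightarrow> real" where
    "E = (\<lambda>j k u. if k = 1 then b u $ g j else if k = 2 then a u $ g j else - b u $ g j - a u $ g j)"
  have law: "conservation_law (web_system V X) (\<lambda>u. b u $ j) (\<lambda>u. a u $ j)"
    and indep: "\<And>c k l. (\<forall>u\<in>V. (\<Sum>j\<in>UNIV. c j * b u $ j) = k \<and> (\<Sum>j\<in>UNIV. c j * a u $ j) = l) \<Longrightarrow> \<forall>j. c j = 0"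
    and span: "\<And>b0 a0. conservation_law (web_system V X) b0 a0 \<Longrightarrow>
        \<exists>c k l. \<forall>u\<in>V. b0 u = (\<Sum>j\<in>UNIV. c j * b u $ j) + k \<and> a0 u = (\<Sum>j\<in>UNIV. c j * a u $ j) + l" for j
    using basis unfolding conservation_basis_def by (auto simp: web_system_def)
  have sb: "smooth_on V (\<lambda>u. b u $ j)" and sa: "smooth_on V (\<lambda>u. a u $ j)"
    and D: "\<And>u \<alpha>. u \<in> V \<Longrightarrow> \<exists>m. (fd (\<lambda>u. b u $ j) u (X \<alpha> u), fd (\<lambda>u. a u $ j) u (X \<alpha> u))
        = m *\<^sub>R (if \<alpha> = 1 then (0, 1) else if \<alpha> = 2 then (1, 0) else (1, -1))" for j
    using law[of j] unfolding conservation_law_def by (auto simp: web_system_def)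
  have abel: "abelian_relation V X (E j)" for j
    unfolding abelian_relation_def
  proof (intro conjI allI ballI)
    fix k
    show "smooth_on V (E j k)"
      unfolding E_def using sb[of "g j"] sa[of "g j"] V
      by (cases "k = 1"; cases "k = 2") (auto intro!: smooth_on_diff smooth_on_minus)
  next
    fix u k assume u: "u \<in> V"
    have d3: "fd (\<lambda>u. - b u $ g j - a u $ g j) u v = - fd (\<lambda>u. b u $ g j) u v - fd (\<lambda>u. a u $ g j) u v" for v
      by (rule fd_eqI[OF has_derivative_diff[OF has_derivative_minus]])
         (rule smooth_on_has_derivative[OF _ u], rule sb sa)+
    show "fd (E j k) u (X k u) = 0"
      using D[OF u, of "g j" k] exhaust_3[of k] by (auto simp: E_def d3)
  next
    fix u
    show "(\<Sum>k\<in>UNIV. E j k u) = 0" by (simp add: sum_3 E_def)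
  qed
  have reindex: "(\<Sum>j<5. h (g j)) = (\<Sum>j\<in>UNIV. h j)" for h :: "5 \<Rightarrow> real"
    by (rule sum.reindex_bij_betw[OF g])
  define g' where "g' = inv_into {..<5::nat} g"
  have g': "g' (g j) = j" if "j < 5" for j
    unfolding g'_def using g that by (simp add: bij_betw_def inv_into_f_f)
  have "\<forall>j<5. c j = 0" if c: "\<forall>k. \<exists>d. \<forall>u\<in>V. (\<Sum>j<5. c j * E j k u) = d" for c
  proof -
    have r: "(\<Sum>j<5. c j * h (g j)) = (\<Sum>j\<in>UNIV. c (g' j) * h j)" for h :: "5 \<Rightarrow> real"
      using reindex[of "\<lambda>j. c (g' j) * h j"] g' by simp
    obtain d where d: "\<And>u. u \<in> V \<Longrightarrow> (\<Sum>j<5. c j * E j 1 u) = d" using c by meson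
    obtain d' where d': "\<And>u. u \<in> V \<Longrightarrow> (\<Sum>j<5. c j * E j 2 u) = d'" using c by meson
    have "\<forall>u\<in>V. (\<Sum>j\<in>UNIV. c (g' j) * b u $ j) = d \<and> (\<Sum>j\<in>UNIV. c (g' j) * a u $ j) = d'"
      using d d' r by (simp add: E_def)
    from indep[OF this] show ?thesis using g' by metis
  qed
  moreover have "\<exists>c. \<forall>k. \<exists>d. \<forall>u\<in>V. I k u = (\<Sum>j<5. c j * E j k u) + d"
    if I: "abelian_relation V X I" for I
  proof -
    have smI: "smooth_on V (I k)" for k using I by (simp add: abelian_relation_def)
    have dI: "fd (I k) u (X k u) = 0" and sI: "I 1 u + I 2 u + I 3 u = 0" if "u \<in> V" for u k
      using I that unfolding abelian_relation_def by (auto simp: sum_3)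
    have s: "fd (I 1) u v + fd (I 2) u v + fd (I 3) u v = 0" if u: "u \<in> V" for u v
      by (rule constant_imp_fd_zero[where g = "\<lambda>u. I 1 u + I 2 u + I 3 u", OF V u sI])
         (assumption, intro has_derivative_add smooth_on_has_derivative[OF smI u])
    have "conservation_law (web_system V X) (I 1) (I 2)"
      unfolding conservation_law_def
    proof (intro conjI ballI allI)
      fix u and \<alpha> :: 3 assume "u \<in> field_dom (web_system V X)"
      then have u: "u \<in> V" by (simp add: web_system_def)
      consider "\<alpha> = 1" | "\<alpha> = 2" | "\<alpha> = 3" using exhaust_3 by blast
      then show "\<exists>m. (fd (I 1) u (frame (web_system V X) \<alpha> u), fd (I 2) u (frame (web_system V X) \<alpha> u))
          = m *\<^sub>R speed (web_system V X) \<alpha> u"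
      proof cases
        case 1
        then show ?thesis using dI[OF u, of 1] by (simp add: web_system_def)
      next
        case 2
        then show ?thesis using dI[OF u, of 2] by (simp add: web_system_def)
      next
        case 3
        then show ?thesis using dI[OF u, of 3] s[OF u, of "X 3 u"] by (simp add: web_system_def)
      qed
    qed (use smI in \<open>auto simp: web_system_def\<close>)
    from span[OF this] obtain c k l where
      c: "\<And>u. u \<in> V \<Longrightarrow> I 1 u = (\<Sum>j\<in>UNIV. c j * b u $ j) + k \<and> I 2 u = (\<Sum>j\<in>UNIV. c j * a u $ j) + l" by blast
    have I12: "I 1 u = (\<Sum>j<5. c (g j) * b u $ g j) + k" "I 2 u = (\<Sum>j<5. c (g j) * a u $ g j) + l" if "u \<in> V" for u
      using c[OF that] reindex[of "\<lambda>j. c j * b u $ j"] reindex[of "\<lambda>j. c j * a u $ j"] by simp_all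
    have I3: "I 3 u = (\<Sum>j<5. c (g j) * (- b u $ g j - a u $ g j)) - k - l" if "u \<in> V" for u
      using sI[OF that] I12[OF that] by (simp add: right_diff_distrib sum_subtractf sum_negf)
    have "\<exists>d. \<forall>u\<in>V. I i u = (\<Sum>j<5. c (g j) * E j i u) + d" for i
    proof -
      consider "i = 1" | "i = 2" | "i = 3" using exhaust_3 by blast
      then show ?thesis
      proof cases
        case 1
        then show ?thesis using I12(1) by (auto simp: E_def)
      next
        case 2
        then show ?thesis using I12(2) by (auto simp: E_def)
      next
        case 3
        then show ?thesis using I3 by (intro exI[of _ "- k - l"]) (auto simp: E_def)
      qed
    qed
    then show ?thesis by (intro exI[of _ "\<lambda>j. c (g j)"]) blast
  qed
  ultimately show ?thesis unfolding web_rank_def using abel by (intro exI[of _ E]) blast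
qed

section \<open>The ruled hypersurface and its dual in coordinates\<close>

lemma ruled_point_derivative:
  assumes "(b has_derivative b') (at u)" "(a has_derivative a') (at u)"
  shows "fd (ruled_point b a) (u, s, r) (v, \<sigma>, \<rho>) = (\<sigma>, s *\<^sub>R b' v + \<sigma> *\<^sub>R b u + (r *\<^sub>R a' v + \<rho> *\<^sub>R a u), \<rho>)"
proof -
  let ?z = "(u, s, r)"
  have f: "(fst has_derivative fst) (at ?z)" by (rule bounded_linear_imp_has_derivative[OF bounded_linear_fst])
  have s: "((\<lambda>z. fst (snd z)) has_derivative (\<lambda>z. fst (snd z))) (at ?z)"
    and r: "((\<lambda>z. snd (snd z)) has_derivative (\<lambda>z. snd (snd z))) (at ?z)"
    by (auto intro!: derivative_eq_intros)
  have b: "((\<lambda>z. b (fst z)) has_derivative (\<lambda>w. b' (fst w))) (at ?z)"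
    and a: "((\<lambda>z. a (fst z)) has_derivative (\<lambda>w. a' (fst w))) (at ?z)"
    using has_derivative_compose[OF f, of b b'] has_derivative_compose[OF f, of a a'] assms by simp_all
  have e: "ruled_point b a = (\<lambda>z. (fst (snd z), fst (snd z) *\<^sub>R b (fst z) + snd (snd z) *\<^sub>R a (fst z), snd (snd z)))"
    by (auto simp: ruled_point_def)
  show ?thesis
    unfolding e
    by (subst fd_eqI[OF has_derivative_Pair[OF s has_derivative_Pair[OF has_derivative_add[OF
          has_derivative_scaleR[OF s b] has_derivative_scaleR[OF r a]] r]]]) simp
qed

text \<open>In the coordinates \<open>(n\<^sup>0, (x, y, z), n\<^sup>6)\<close> of a hyperplane, the pencil of hyperplanes tangent
  to the ruled hypersurface along a line is parametrized by \<open>(y, z)\<close>; the polarity interchanges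
  \<open>(y, z)\<close> with \<open>(n\<^sup>0, n\<^sup>6)\<close>.\<close>

definition polarity :: "R7 \<Rightarrow> R7" where
  "polarity = (\<lambda>(n0, m, n6). (m $ 4, emb5 (\<chi> i. if i = 1 then m $ 1 else if i = 2 then m $ 2 else m $ 3) n0 n6, m $ 5))"

lemma polarity_emb5: "polarity (n0, emb5 x y z, n6) = (y, emb5 x n0 n6, z)"
proof -
  have x: "(\<chi> i. if i = 1 then emb5 x y z $ 1 else if i = 2 then emb5 x y z $ 2 else emb5 x y z $ 3) = x"
    by (simp add: vec_eq_iff forall_3 emb5_nth)
  show ?thesis unfolding polarity_def split_conv x by (simp add: emb5_nth)
qed

lemma linear_polarity: "linear polarity"
proof (rule linearI)
  fix p q :: R7 and k :: real
  obtain n0 m n6 n0' m' n6' where pq: "p = (n0, m, n6)" "q = (n0', m', n6')" by (metis prod_cases3)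
  obtain x y z x' y' z' where m: "m = emb5 x y z" "m' = emb5 x' y' z'" by (metis emb5_cases)
  show "polarity (p + q) = polarity p + polarity q"
    unfolding pq m by (simp add: emb5_add[symmetric] polarity_emb5)
  show "polarity (k *\<^sub>R p) = k *\<^sub>R polarity p"
    unfolding pq m by (simp add: emb5_scaleR[symmetric] polarity_emb5)
qed

lemma bij_polarity: "bij polarity"
proof (rule involuntory_imp_bij)
  fix p :: R7
  obtain n0 m n6 where p: "p = (n0, m, n6)" by (metis prod_cases3)
  obtain x y z where m: "m = emb5 x y z" by (metis emb5_cases)
  show "polarity (polarity p) = p" unfolding p m by (simp add: polarity_emb5)
qed

section \<open>Nonintegrability read off from the coframe\<close>

context dual_frames
begin

text \<open>Every other frame component of the exterior derivative contains the factor
  \<open>om \<gamma>\<close> and disappears in the wedge product with it.\<close>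

lemma ext_deriv_wedge_zero:
  assumes u: "u \<in> U" and d: "\<alpha> \<noteq> \<beta>" "\<beta> \<noteq> \<gamma>" "\<alpha> \<noteq> \<gamma>"
    and zero: "ext_deriv (om \<gamma>) u (xi \<alpha> u) (xi \<beta> u) = 0"
  shows "ext_deriv_wedge (om \<gamma>) u v1 v2 v3 = 0"
proof -
  let ?d = "\<lambda>\<alpha> \<beta>. ext_deriv (om \<gamma>) u (xi \<alpha> u) (xi \<beta> u)" and ?c = "\<lambda>\<alpha> v. om \<alpha> u \<bullet> v"
  have *: "ext_deriv (om \<gamma>) u v w = ?d \<beta> \<gamma> * (?c \<beta> v * ?c \<gamma> w - ?c \<gamma> v * ?c \<beta> w)
      + ?d \<gamma> \<alpha> * (?c \<gamma> v * ?c \<alpha> w - ?c \<alpha> v * ?c \<gamma> w)" for v w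
  proof -
    have "ext_deriv (om \<gamma>) u v w = ?d \<alpha> \<beta> * (?c \<alpha> v * ?c \<beta> w - ?c \<beta> v * ?c \<alpha> w)
      + ?d \<beta> \<gamma> * (?c \<beta> v * ?c \<gamma> w - ?c \<gamma> v * ?c \<beta> w) + ?d \<gamma> \<alpha> * (?c \<gamma> v * ?c \<alpha> w - ?c \<alpha> v * ?c \<gamma> w)"
      unfolding ext_deriv_def
      by (subst N_expansion[OF u, of \<gamma> v w], subst N_expansion[OF u, of \<gamma> w v])
         (simp add: sum_3_distinct[OF d] algebra_simps)
    then show ?thesis by (simp add: zero)
  qed
  show ?thesis unfolding ext_deriv_wedge_def using *[of v1 v2] *[of v2 v3] *[of v3 v1] by algebra
qed

lemma frame_web:
  assumes u: "u \<in> U"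
  shows "inj (\<lambda>k. xi k u)" "independent (range (\<lambda>k. xi k u))"
proof -
  show inj: "inj (\<lambda>k. xi k u)"
    using dual[OF u] by (intro injI) (metis zero_neq_one)
  show "independent (range (\<lambda>k. xi k u))"
  proof
    assume "dependent (range (\<lambda>k. xi k u))"
    then obtain t c v where t: "finite t" "t \<subseteq> range (\<lambda>k. xi k u)" "(\<Sum>v\<in>t. c v *\<^sub>R v) = 0" "v \<in> t" "c v \<noteq> 0"
      unfolding dependent_explicit by blast
    obtain k where k: "v = xi k u" using t(2,4) by blast
    have "0 = om k u \<bullet> (\<Sum>v\<in>t. c v *\<^sub>R v)" by (simp add: t(3))
    also have "\<dots> = (\<Sum>w\<in>t. c w * (om k u \<bullet> w))" by (simp add: inner_sum_right)
    also have "\<dots> = (\<Sum>w\<in>t. if w = v then c v else 0)"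
    proof (rule sum.cong[OF refl])
      fix w assume "w \<in> t"
      then obtain j where "w = xi j u" using t(2) by blast
      then show "c w * (om k u \<bullet> w) = (if w = v then c v else 0)"
        using dual[OF u] k injD[OF inj, of j k] by auto
    qed
    also have "\<dots> = c v" using t(1,4) by simp
    finally show False using t(5) by simp
  qed
qed

text \<open>Because the pairings of \<open>om \<gamma>\<close> with the frame are constant,
  \<open>om \<gamma>\<close> takes on the bracket the negative of its exterior derivative, while it
  vanishes on the span.\<close>

lemma frame_nonintegrable:
  assumes u: "u \<in> U" and d: "\<alpha> \<noteq> \<beta>" "\<beta> \<noteq> \<gamma>" "\<alpha> \<noteq> \<gamma>"
    and ne: "ext_deriv (om \<gamma>) u (xi \<alpha> u) (xi \<beta> u) \<noteq> 0"
  shows "lie_bracket (xi \<alpha>) (xi \<beta>) u \<notin> span {xi \<alpha> u, xi \<beta> u}"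
proof
  assume *: "lie_bracket (xi \<alpha>) (xi \<beta>) u \<in> span {xi \<alpha> u, xi \<beta> u}"
  have "subspace {y. om \<gamma> u \<bullet> y = 0}" by (rule subspace_hyperplane)
  then have "span {xi \<alpha> u, xi \<beta> u} \<subseteq> {y. om \<gamma> u \<bullet> y = 0}"
    by (intro span_minimal) (use d dual[OF u] in auto)
  with * have "om \<gamma> u \<bullet> lie_bracket (xi \<alpha>) (xi \<beta>) u = 0" by blast
  then show False using ne by (simp add: lie_bracket_def inner_diff_right ext_deriv_def N_xi[OF u])
qed

end

context temple_potentials
begin

lemma conservation_basis_source: "conservation_basis (conservation_system U lam xi) dens flux"
  unfolding conservation_basis_def
proof (intro conjI allI impI)
  fix j
  have e: "frechet_derivative (\<lambda>u. dens u $ j) (at u) v = emb5 v (P u \<bullet> v) (Q u \<bullet> v) $ j"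
    "frechet_derivative (\<lambda>u. flux u $ j) (at u) v = emb5 (fd f u v) (P u \<bullet> fd f u v) (Q u \<bullet> fd f u v) $ j"
    if "u \<in> U" for u v
    by (rule fd_eqI[OF bounded_linear.has_derivative[OF bounded_linear_vec_nth has_derivative_dens[OF that]]]
        fd_eqI[OF bounded_linear.has_derivative[OF bounded_linear_vec_nth has_derivative_flux[OF that]]])+
  have "smooth_on U (\<lambda>u. dens u $ j)" "smooth_on U (\<lambda>u. flux u $ j)"
    unfolding dens_def flux_def
    by (intro smooth_on_emb5_nth openU smooth_on_id smooth_BN smooth_f)+
  then show "conservation_law (conservation_system U lam xi) (\<lambda>u. dens u $ j) (\<lambda>u. flux u $ j)"
    by (auto simp: conservation_law_def conservation_system_def e f_xi emb5_scaleR)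
next
  fix c k l j
  assume "\<forall>u\<in>field_dom (conservation_system U lam xi). (\<Sum>j\<in>UNIV. c j * dens u $ j) = k \<and> (\<Sum>j\<in>UNIV. c j * flux u $ j) = l"
  then have *: "(\<chi> j. c j) \<bullet> dens u = k" if "u \<in> U" for u
    using that by (simp add: conservation_system_def sum_eq_inner)
  obtain x y z where c: "(\<chi> j. c j) = emb5 x y z" by (metis emb5_cases)
  have "emb5 x y z = 0" using dens_independent[of x y z k] * unfolding c by simp
  with c show "c j = 0" by (metis vec_lambda_beta zero_index)
next
  fix b0 a0 assume law: "conservation_law (conservation_system U lam xi) b0 a0"
  have sm: "smooth_on U b0" "smooth_on U a0"
    using law by (auto simp: conservation_law_def conservation_system_def)
  have "fd a0 u (xi \<alpha> u) = lam \<alpha> u * fd b0 u (xi \<alpha> u)" if "u \<in> U" for u \<alpha>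
    using law that by (fastforce simp: conservation_law_def conservation_system_def)
  from dens_flux_complete[OF sm this] obtain x y z k l where
    *: "\<forall>u\<in>U. b0 u = emb5 x y z \<bullet> dens u + k \<and> a0 u = emb5 x y z \<bullet> flux u + l" by blast
  then show "\<exists>c k l. \<forall>u\<in>field_dom (conservation_system U lam xi).
      b0 u = (\<Sum>j\<in>UNIV. c j * dens u $ j) + k \<and> a0 u = (\<Sum>j\<in>UNIV. c j * flux u $ j) + l"
    by (intro exI[of _ "\<lambda>j. emb5 x y z $ j"] exI[of _ k] exI[of _ l])
       (simp add: conservation_system_def sum_eq_inner)
qed

text \<open>The derivatives of \<open>dens'\<close> and \<open>flux'\<close> depend linearly on
  those of \<open>P\<close> and \<open>Q\<close>, so the three relations of
  \<open>hessians_xi\<close> become the three speeds of the web system.\<close>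

lemma conservation_basis_web: "conservation_basis (web_system U xi) dens' flux'"
  unfolding conservation_basis_def
proof (intro conjI allI impI)
  fix j
  have e: "frechet_derivative (\<lambda>u. dens' u $ j) (at u) v = emb5 (- fd P u v) (fd P u v \<bullet> u) (fd P u v \<bullet> f u) $ j"
    "frechet_derivative (\<lambda>u. flux' u $ j) (at u) v = emb5 (- fd Q u v) (fd Q u v \<bullet> u) (fd Q u v \<bullet> f u) $ j"
    if "u \<in> U" for u v
    by (rule fd_eqI[OF bounded_linear.has_derivative[OF bounded_linear_vec_nth has_derivative_dens'[OF that]]]
        fd_eqI[OF bounded_linear.has_derivative[OF bounded_linear_vec_nth has_derivative_flux'[OF that]]])+
  have sm: "smooth_on U (\<lambda>u. dens' u $ j)" "smooth_on U (\<lambda>u. flux' u $ j)"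
    unfolding dens'_def flux'_def
    by (intro smooth_on_emb5_nth smooth_on_minus smooth_on_diff smooth_on_inner openU smooth_on_id
        smooth_BN smooth_PQ smooth_f)+
  show "conservation_law (web_system U xi) (\<lambda>u. dens' u $ j) (\<lambda>u. flux' u $ j)"
    unfolding conservation_law_def
  proof (intro conjI ballI allI)
    fix u and \<alpha> :: 3 assume "u \<in> field_dom (web_system U xi)"
    then have u: "u \<in> U" by (simp add: web_system_def)
    have neg: "fd Q u (xi 3 u) = - fd P u (xi 3 u)" by (simp add: hessians_xi[OF u])
    have "emb5 (- fd Q u (xi 3 u)) (fd Q u (xi 3 u) \<bullet> u) (fd Q u (xi 3 u) \<bullet> f u)
        = - emb5 (- fd P u (xi 3 u)) (fd P u (xi 3 u) \<bullet> u) (fd P u (xi 3 u) \<bullet> f u)"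
      unfolding neg emb5_uminus[symmetric] by simp
    then show "\<exists>m. (frechet_derivative (\<lambda>u. dens' u $ j) (at u) (frame (web_system U xi) \<alpha> u),
        frechet_derivative (\<lambda>u. flux' u $ j) (at u) (frame (web_system U xi) \<alpha> u))
      = m *\<^sub>R speed (web_system U xi) \<alpha> u"
      using exhaust_3[of \<alpha>] by (auto simp: web_system_def e[OF u] hessians_xi(1,5)[OF u])
  qed (use sm in \<open>auto simp: web_system_def\<close>)
next
  fix c k l j
  assume "\<forall>u\<in>field_dom (web_system U xi). (\<Sum>j\<in>UNIV. c j * dens' u $ j) = k \<and> (\<Sum>j\<in>UNIV. c j * flux' u $ j) = l"
  then have *: "(\<chi> j. c j) \<bullet> dens' u = k" "(\<chi> j. c j) \<bullet> flux' u = l" if "u \<in> U" for u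
    using that by (simp_all add: web_system_def sum_eq_inner)
  obtain x y z where c: "(\<chi> j. c j) = emb5 x y z" by (metis emb5_cases)
  have "emb5 x y z = 0" using dens'_independent[of x y z k l] * unfolding c by simp
  with c show "c j = 0" by (metis vec_lambda_beta zero_index)
next
  fix b0 a0 assume law: "conservation_law (web_system U xi) b0 a0"
  have sm: "smooth_on U b0" "smooth_on U a0"
    using law by (auto simp: conservation_law_def web_system_def)
  have D: "\<exists>m. (fd b0 u (xi \<alpha> u), fd a0 u (xi \<alpha> u)) = m *\<^sub>R (if \<alpha> = 1 then (0, 1) else if \<alpha> = 2 then (1, 0) else (1, -1))"
    if "u \<in> U" for u \<alpha>
    using law that by (simp add: conservation_law_def web_system_def)
  have "fd b0 u (xi 1 u) = 0" "fd a0 u (xi 2 u) = 0" "fd a0 u (xi 3 u) = - fd b0 u (xi 3 u)" if "u \<in> U" for u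
    using D[OF that, of 1] D[OF that, of 2] D[OF that, of 3] by auto
  from dens'_flux'_complete[OF sm this] obtain x y z k l where
    *: "\<forall>u\<in>U. b0 u = emb5 x y z \<bullet> dens' u + k \<and> a0 u = emb5 x y z \<bullet> flux' u + l" by blast
  then show "\<exists>c k l. \<forall>u\<in>field_dom (web_system U xi).
      b0 u = (\<Sum>j\<in>UNIV. c j * dens' u $ j) + k \<and> a0 u = (\<Sum>j\<in>UNIV. c j * flux' u $ j) + l"
    by (intro exI[of _ "\<lambda>j. emb5 x y z $ j"] exI[of _ k] exI[of _ l])
       (simp add: web_system_def sum_eq_inner)
qed

text \<open>The parameters \<open>s\<close> and \<open>r\<close> do not occur on the right: the
  tangent space is the same at all regular points of a ruling line, so each line contributes a
  pencil of hyperplanes with coordinates \<open>(y, z)\<close>.\<close>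

lemma dual_hypersurface_iff:
  "n \<in> dual_hypersurface U dens flux \<longleftrightarrow> (\<exists>u y z. u \<in> U \<and> (y, z) \<noteq> (0, 0) \<and>
     n = (y * (P u \<bullet> u - B u) + z * (Q u \<bullet> u - N' u), emb5 (- y *\<^sub>R P u - z *\<^sub>R Q u) y z,
          y * (P u \<bullet> f u - A u) + z * (Q u \<bullet> f u - M u)))"
proof
  assume "n \<in> dual_hypersurface U dens flux"
  then obtain u s r where n: "n \<noteq> 0" and u: "u \<in> U"
    and inj: "inj (fd (ruled_point dens flux) (u, s, r))"
    and tan: "\<And>w. n \<bullet> fd (ruled_point dens flux) (u, s, r) w = 0"
    unfolding dual_hypersurface_def by blast
  note rd = ruled_point_derivative[OF has_derivative_dens[OF u] has_derivative_flux[OF u]]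
  obtain n0 m n6 where nm: "n = (n0, m, n6)" by (metis prod_cases3)
  obtain x y z where m: "m = emb5 x y z" by (metis emb5_cases)
  have f0: "fd f u 0 = 0"
    by (rule linear_0[OF bounded_linear.linear[OF smooth_on_fd_linear[OF smooth_f u]]])
  \<comment> \<open>The directions of \<open>s\<close> and \<open>r\<close> express that the
    hyperplane contains the ruling line and determine the outer coordinates.\<close>
  have n0: "n0 = - (m \<bullet> dens u)" using tan[of "(0, 1, 0)"] by (simp add: rd nm f0)
  have n6: "n6 = - (m \<bullet> flux u)" using tan[of "(0, 0, 1)"] by (simp add: rd nm f0)
  \<comment> \<open>Along \<open>xi \<alpha> u\<close> the tangency condition carries the factor
    \<open>s + r * lam \<alpha> u\<close>, which is nonzero where the parametrization is an
    immersion and can be cancelled.\<close>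
  have x: "x = - y *\<^sub>R P u - z *\<^sub>R Q u"
  proof (rule coframe_eqI[OF u])
    fix \<alpha>
    let ?d = "emb5 (xi \<alpha> u) (P u \<bullet> xi \<alpha> u) (Q u \<bullet> xi \<alpha> u)"
    have dr: "fd (ruled_point dens flux) (u, s, r) (xi \<alpha> u, 0, 0) = (0, (s + r * lam \<alpha> u) *\<^sub>R ?d, 0)"
      by (simp add: rd f_xi[OF u] emb5_scaleR scaleR_add_left)
    have "xi \<alpha> u \<noteq> 0" using dual[OF u, of \<alpha> \<alpha>] by auto
    then have "fd (ruled_point dens flux) (u, s, r) (xi \<alpha> u, 0, 0) \<noteq> fd (ruled_point dens flux) (u, s, r) (0, 0, 0)"
      using injD[OF inj] by blast
    moreover have "fd (ruled_point dens flux) (u, s, r) (0, 0, 0) = 0"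
      by (simp add: rd f0 zero_prod_def)
    ultimately have "s + r * lam \<alpha> u \<noteq> 0" unfolding dr by (auto simp: zero_prod_def)
    then have "m \<bullet> ?d = 0" using tan[of "(xi \<alpha> u, 0, 0)"] unfolding dr nm by simp
    then show "x \<bullet> xi \<alpha> u = (- y *\<^sub>R P u - z *\<^sub>R Q u) \<bullet> xi \<alpha> u"
      by (simp add: m emb5_inner inner_diff_left)
  qed
  with n have "(y, z) \<noteq> (0, 0)" by (auto simp: nm n0 n6 m zero_prod_def)
  moreover have "n = (y * (P u \<bullet> u - B u) + z * (Q u \<bullet> u - N' u), emb5 (- y *\<^sub>R P u - z *\<^sub>R Q u) y z,
          y * (P u \<bullet> f u - A u) + z * (Q u \<bullet> f u - M u))"
    by (simp add: nm n0 n6 m x dens_def flux_def emb5_inner inner_diff_left algebra_simps)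
  ultimately show "\<exists>u y z. u \<in> U \<and> (y, z) \<noteq> (0, 0) \<and>
     n = (y * (P u \<bullet> u - B u) + z * (Q u \<bullet> u - N' u), emb5 (- y *\<^sub>R P u - z *\<^sub>R Q u) y z,
          y * (P u \<bullet> f u - A u) + z * (Q u \<bullet> f u - M u))"
    using u by blast
next
  assume "\<exists>u y z. u \<in> U \<and> (y, z) \<noteq> (0, 0) \<and>
     n = (y * (P u \<bullet> u - B u) + z * (Q u \<bullet> u - N' u), emb5 (- y *\<^sub>R P u - z *\<^sub>R Q u) y z,
          y * (P u \<bullet> f u - A u) + z * (Q u \<bullet> f u - M u))"
  then obtain u y z where u: "u \<in> U" and yz: "(y, z) \<noteq> (0, 0)"
    and n: "n = (y * (P u \<bullet> u - B u) + z * (Q u \<bullet> u - N' u), emb5 (- y *\<^sub>R P u - z *\<^sub>R Q u) y z,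
          y * (P u \<bullet> f u - A u) + z * (Q u \<bullet> f u - M u))" by blast
  note rd = ruled_point_derivative[OF has_derivative_dens[OF u] has_derivative_flux[OF u]]
  have "emb5 (- y *\<^sub>R P u - z *\<^sub>R Q u) y z \<noteq> emb5 0 0 0" using yz unfolding emb5_eq_iff by auto
  then have "n \<noteq> 0" by (simp add: n zero_prod_def)
  \<comment> \<open>The point \<open>(s, r) = (1, 0)\<close> is regular on every ruling line, since
    there the factor above equals 1.\<close>
  moreover have "inj (fd (ruled_point dens flux) (u, 1, 0))"
    by (rule injI) (auto simp: rd emb5_eq_iff split_paired_all)
  moreover have "n \<bullet> fd (ruled_point dens flux) (u, 1, 0) (v, \<sigma>, \<rho>) = 0" for v \<sigma> \<rho>
    by (simp add: rd n dens_def flux_def inner_add_right emb5_inner inner_diff_left algebra_simps)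
  ultimately show "n \<in> dual_hypersurface U dens flux"
    using u unfolding dual_hypersurface_def
    by (intro CollectI conjI exI[of _ u] exI[of _ "1::real"] exI[of _ "0::real"]) (auto simp: split_paired_all)
qed

text \<open>After the polarity the pencil over \<open>u\<close> becomes the line through
  \<open>dens' u\<close> and \<open>flux' u\<close>, with the pencil parameters
  \<open>(y, z)\<close> as its homogeneous coordinates.\<close>

lemma polarity_dual_hypersurface:
  "polarity ` dual_hypersurface U dens flux = ruled_hypersurface U dens' flux'"
proof -
  define h where "h = (\<lambda>u y z. (y * (P u \<bullet> u - B u) + z * (Q u \<bullet> u - N' u), emb5 (- y *\<^sub>R P u - z *\<^sub>R Q u) y z,
      y * (P u \<bullet> f u - A u) + z * (Q u \<bullet> f u - M u)))"
  have "ruled_point dens' flux' (u, y, z) = polarity (h u y z)" for u y z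
    unfolding h_def polarity_emb5
    by (simp add: ruled_point_def dens'_def flux'_def emb5_scaleR[symmetric] emb5_add[symmetric])
  then have r: "ruled_hypersurface U dens' flux' = {polarity (h u y z) | u y z. u \<in> U \<and> (y, z) \<noteq> (0, 0)}"
    by (simp add: ruled_hypersurface_def)
  have d: "dual_hypersurface U dens flux = {h u y z | u y z. u \<in> U \<and> (y, z) \<noteq> (0, 0)}"
    by (rule set_eqI) (simp only: dual_hypersurface_iff h_def mem_Collect_eq conj_assoc conj_commute)
  show ?thesis unfolding r d by blast
qed

lemma dual_to_web: "dual_systems (conservation_system U lam xi) (web_system U xi)"
proof -
  have "projectively_equivalent (dual_hypersurface U dens flux) (ruled_hypersurface U dens' flux')"
    unfolding projectively_equivalent_def
    using linear_polarity bij_polarity polarity_dual_hypersurface by blast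
  then show ?thesis
    unfolding dual_systems_def
    using conservation_basis_source conservation_basis_web
    by (intro exI[of _ dens] exI[of _ flux] exI[of _ dens'] exI[of _ flux'])
       (simp add: conservation_system_def web_system_def)
qed

lemma maximal_rank: "maximal_rank_web U xi"
proof -
  have "lie_bracket (xi i) (xi j) u \<notin> span {xi i u, xi j u}" if u: "u \<in> U" and ne: "i \<noteq> j" for u i j
  proof -
    obtain k where d: "i \<noteq> j" "j \<noteq> k" "i \<noteq> k" using ne ex_third_3 by blast
    show ?thesis by (rule frame_nonintegrable[OF u d nondiag[OF u d]])
  qed
  then have "web3 U xi"
    unfolding web3_def
    by (intro conjI ballI allI impI openU convex_connected[OF convU] neU smooth_xi frame_web)
  then show ?thesis
    unfolding maximal_rank_web_def
    using web_rank_from_conservation_basis[OF openU conservation_basis_web] by blast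
qed

end

text \<open>Passes from the global hypotheses to their pointwise forms: \<open>straight\<close> by
  differentiating along integral curves, \<open>nondiag\<close> as the contrapositive of
  \<open>ext_deriv_wedge_zero\<close>.\<close>

lemma temple_system_on_ball:
  assumes hyp: "strictly_hyperbolic U f lam xi om" and temple: "temple_class U xi"
    and nd: "nondiagonalizable U om" and sub: "ball c r \<subseteq> U"
  shows "temple_system (ball c r) xi om f lam"
proof -
  have U: "open U" "smooth_on U f" and sm: "\<And>\<alpha>. smooth_on U (lam \<alpha>)" "\<And>\<alpha>. smooth_on U (xi \<alpha>)" "\<And>\<alpha>. smooth_on U (om \<alpha>)"
    and inj: "\<And>u. u \<in> U \<Longrightarrow> inj (\<lambda>\<alpha>. lam \<alpha> u)"
    and diag: "\<And>u \<alpha> v. u \<in> U \<Longrightarrow> om \<alpha> u \<bullet> fd f u v = lam \<alpha> u * (om \<alpha> u \<bullet> v)"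
    and dual: "\<And>u \<alpha> \<beta>. u \<in> U \<Longrightarrow> om \<alpha> u \<bullet> xi \<beta> u = (if \<alpha> = \<beta> then 1 else 0)"
    using hyp unfolding strictly_hyperbolic_def by blast+
  interpret dual_frames U xi om
    by unfold_locales (use U sm dual in auto)
  have straight: "om \<beta> u \<bullet> fd (xi \<alpha>) u (xi \<alpha> u) = 0" if "u \<in> U" "\<alpha> \<noteq> \<beta>" for u \<alpha> \<beta>
    using temple that dual[OF that(1)] unfolding temple_class_def
    by (intro straight_integral_curves_acceleration[OF U(1) sm(2)]) auto
  have nondiag: "ext_deriv (om \<gamma>) u (xi \<alpha> u) (xi \<beta> u) \<noteq> 0"
    if "u \<in> U" "\<alpha> \<noteq> \<beta>" "\<beta> \<noteq> \<gamma>" "\<alpha> \<noteq> \<gamma>" for u \<alpha> \<beta> \<gamma>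
    using nd that(1) ext_deriv_wedge_zero[OF that] unfolding nondiagonalizable_def by blast
  have lam: "lam \<alpha> u \<noteq> lam \<beta> u" if "u \<in> U" "\<alpha> \<noteq> \<beta>" for u \<alpha> \<beta>
    using injD[OF inj[OF that(1)]] that(2) by blast
  show ?thesis
    by unfold_locales
       (use sub smooth_on_subset[OF U(2) sub] smooth_on_subset[OF sm(1) sub] smooth_on_subset[OF sm(2) sub]
          smooth_on_subset[OF sm(3) sub] diag dual straight nondiag lam in \<open>auto simp: subset_iff simp del: mem_ball\<close>)
qed

theorem theorem13:
  fixes U :: "(real^3) set"
    and f :: "real^3 \<Rightarrow> real^3"
    and lam :: "3 \<Rightarrow> real^3 \<Rightarrow> real"
    and xi om :: "3 \<Rightarrow> real^3 \<Rightarrow> real^3"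
    and u0 :: "real^3"
  assumes "strictly_hyperbolic U f lam xi om"
    and "temple_class U xi"
    and "nondiagonalizable U om"
    and "u0 \<in> U"
  shows "\<exists>U' V X. open U' \<and> connected U' \<and> u0 \<in> U' \<and> U' \<subseteq> U \<and>
           maximal_rank_web V X \<and>
           dual_systems (conservation_system U' lam xi) (web_system V X)"
proof -
  have "open U" using assms(1) unfolding strictly_hyperbolic_def by blast
  then obtain r where r: "0 < r" "ball u0 r \<subseteq> U" using assms(4) open_contains_ball by blast
  interpret temple_system "ball u0 r" xi om f lam
    by (rule temple_system_on_ball[OF assms(1-3) r(2)])
  obtain \<psi> P Q B A N' M where "temple_potentials (ball u0 r) xi om f lam \<psi> P Q B A N' M"
    using potentials_exist[OF refl r(1)] by blast
  then interpret temple_potentials "ball u0 r" xi om f lam \<psi> P Q B A N' M .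
  \<comment> \<open>The web consists of the rarefaction curves themselves, on the same ball as the
    restricted system.\<close>
  show ?thesis
    using r maximal_rank dual_to_web
    by (intro exI[of _ "ball u0 r"] exI[of _ xi]) auto
qed

end
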